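(* For a given $k\in\mathbb{N}$ there is an algorithm that decides whether a graph $G=(V,E)$ with $|V|=n$ and $|E|=m$ is $k$-equidominating in time $\mathcal{O}\left(nm^2+n^kk^k+n^{2k+2}k^{-k-1}+k^{3k+3}\right)$, and that computes a $k$-equidominating structure within this time if one exists. Further, for $t\in\mathbb{N}$, the same algorithm (with $k$ set to $t$) can be used to decide whether $G$ is target-$t$ equidominating.
   Context: All graphs are finite, simple and undirected; $\mathbb{N}=\{1,2,\dots\}$. A minimal dominating set (mds) of $G=(V,E)$ is an inclusion-minimal set $D\subseteq V$ such that every vertex is in $D$ or adjacent to a vertex of $D$. An equidominating structure of $G$ is a pair $(w,t)$ with $t\in\mathbb{N}$ and $w\colon V\to\mathbb{N}$ such that for all $D\subseteq V$: $D$ is an mds iff $\sum_{v\in D}w(v)=t$. $G$ is $k$-equidominating if it has an equidominating structure $(w,t)$ with $w\colon V\to\{1,\dots,k\}$ (a $k$-equidominating structure), and target-$t$ equidominating if it has an equidominating structure of the form $(w,t)$. *)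

theory Defs
  imports Complex_Main
begin

section \<open>Equidominating graphs\<close>

text \<open>A graph is given by its vertex set and its set of edges, each edge being a two-element
  set of vertices.\<close>

definition fin_simple_graph :: "'a set \<Rightarrow> 'a set set \<Rightarrow> bool" where
  "fin_simple_graph V E \<longleftrightarrow> finite V \<and> E \<subseteq> {e. e \<subseteq> V \<and> card e = 2}"

definition dominating :: "'a set \<Rightarrow> 'a set set \<Rightarrow> 'a set \<Rightarrow> bool" where
  "dominating V E D \<longleftrightarrow> D \<subseteq> V \<and> (\<forall>v\<in>V. v \<in> D \<or> (\<exists>u\<in>D. {u, v} \<in> E))"

definition mds :: "'a set \<Rightarrow> 'a set set \<Rightarrow> 'a set \<Rightarrow> bool" where
  "mds V E D \<longleftrightarrow> dominating V E D \<and> (\<forall>D'. D' \<subset> D \<longrightarrow> \<not> dominating V E D')"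

text \<open>Here the positive integers are rendered as natural numbers that are at least 1.  Only the
  values of the weight function on the vertices matter.\<close>

definition equidominating_structure ::
    "'a set \<Rightarrow> 'a set set \<Rightarrow> ('a \<Rightarrow> nat) \<Rightarrow> nat \<Rightarrow> bool" where
  "equidominating_structure V E w t \<longleftrightarrow>
     t \<ge> 1 \<and> (\<forall>v\<in>V. w v \<ge> 1) \<and> (\<forall>D. D \<subseteq> V \<longrightarrow> (mds V E D \<longleftrightarrow> (\<Sum>v\<in>D. w v) = t))"

definition k_equidominating_structure ::
    "nat \<Rightarrow> 'a set \<Rightarrow> 'a set set \<Rightarrow> ('a \<Rightarrow> nat) \<Rightarrow> nat \<Rightarrow> bool" where
  "k_equidominating_structure k V E w t \<longleftrightarrow>
     equidominating_structure V E w t \<and> (\<forall>v\<in>V. w v \<in> {1..k})"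

definition k_equidominating :: "nat \<Rightarrow> 'a set \<Rightarrow> 'a set set \<Rightarrow> bool" where
  "k_equidominating k V E \<longleftrightarrow> (\<exists>w t. k_equidominating_structure k V E w t)"

definition target_equidominating :: "nat \<Rightarrow> 'a set \<Rightarrow> 'a set set \<Rightarrow> bool" where
  "target_equidominating t V E \<longleftrightarrow> (\<exists>w. equidominating_structure V E w t)"


section \<open>Random access machine with uniform cost\<close>

text \<open>The machine has registers and unbounded arrays, all holding natural numbers.  Registers and
  array names occur in programs only as constants, so a program uses finitely many of them; the
  arrays a program uses can be interleaved in one memory with constant overhead.  As in the RAM of
  Cook and Reckhow, addition and (truncated) subtraction are the only arithmetic operations and
  have unit cost; multiplication is not available.  Control flow is structured instead of using
  jumps, which changes running times by constant factors only.\<close>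

record state =
  reg :: "nat \<Rightarrow> nat"
  arr :: "nat \<Rightarrow> nat \<Rightarrow> nat"

datatype aexp =
    Const nat
  | Reg nat
  | Read nat aexp
  | Add aexp aexp
  | Sub aexp aexp

fun aval :: "aexp \<Rightarrow> state \<Rightarrow> nat" where
  "aval (Const c) s = c"
| "aval (Reg r) s = reg s r"
| "aval (Read a e) s = arr s a (aval e s)"
| "aval (Add e1 e2) s = aval e1 s + aval e2 s"
| "aval (Sub e1 e2) s = aval e1 s - aval e2 s"

fun acost :: "aexp \<Rightarrow> nat" where
  "acost (Const c) = 1"
| "acost (Reg r) = 1"
| "acost (Read a e) = 1 + acost e"
| "acost (Add e1 e2) = 1 + acost e1 + acost e2"
| "acost (Sub e1 e2) = 1 + acost e1 + acost e2"

text \<open>Tests are for being nonzero; in \<open>Write a e1 e2\<close> the index is \<open>e1\<close> and the new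
  value is \<open>e2\<close>.\<close>

datatype com =
    Skip
  | Assign nat aexp
  | Write nat aexp aexp
  | Seq com com
  | If aexp com com
  | While aexp com

text \<open>\<open>exec c s T s'\<close>: started in \<open>s\<close>, the program \<open>c\<close> halts in state \<open>s'\<close> after exactly
  \<open>T\<close> elementary steps.\<close>

inductive exec :: "com \<Rightarrow> state \<Rightarrow> nat \<Rightarrow> state \<Rightarrow> bool" where
  Skip: "exec Skip s 1 s"
| Assign: "exec (Assign r e) s (1 + acost e) (s\<lparr>reg := (reg s)(r := aval e s)\<rparr>)"
| Write: "exec (Write a e1 e2) s (1 + acost e1 + acost e2)
    (s\<lparr>arr := (arr s)(a := (arr s a)(aval e1 s := aval e2 s))\<rparr>)"
| Seq: "exec c1 s T1 s1 \<Longrightarrow> exec c2 s1 T2 s2 \<Longrightarrow> exec (Seq c1 c2) s (T1 + T2) s2"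
| IfTrue: "aval e s \<noteq> 0 \<Longrightarrow> exec c1 s T s' \<Longrightarrow> exec (If e c1 c2) s (1 + acost e + T) s'"
| IfFalse: "aval e s = 0 \<Longrightarrow> exec c2 s T s' \<Longrightarrow> exec (If e c1 c2) s (1 + acost e + T) s'"
| WhileFalse: "aval e s = 0 \<Longrightarrow> exec (While e c) s (1 + acost e) s"
| WhileTrue: "aval e s \<noteq> 0 \<Longrightarrow> exec c s T1 s1 \<Longrightarrow> exec (While e c) s1 T2 s2
    \<Longrightarrow> exec (While e c) s (1 + acost e + T1 + T2) s2"

inductive_cases SkipE: "exec Skip s T s'"
inductive_cases AssignE: "exec (Assign r e) s T s'"
inductive_cases WriteE: "exec (Write a e1 e2) s T s'"
inductive_cases SeqE: "exec (Seq c1 c2) s T s'"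
inductive_cases IfE: "exec (If e c1 c2) s T s'"
inductive_cases WhileE: "exec (While e c) s T s'"

lemma exec_deterministic:
  "exec c s T s' \<Longrightarrow> exec c s U s'' \<Longrightarrow> T = U \<and> s' = s''"
proof (induction arbitrary: U s'' rule: exec.induct)
  case (Seq c1 s T1 s1 c2 T2 s2)
  from Seq.prems obtain U1 r U2 where
    "exec c1 s U1 r" "exec c2 r U2 s''" "U = U1 + U2"
    by (rule SeqE)
  with Seq.IH show ?case by blast
next
  case (IfTrue e s c1 T s' c2)
  from IfTrue.prems IfTrue.hyps(1) obtain U1 where
    "exec c1 s U1 s''" "U = 1 + acost e + U1"
    by (auto elim: IfE)
  with IfTrue.IH show ?case by blast
next
  case (IfFalse e s c2 T s' c1)
  from IfFalse.prems IfFalse.hyps(1) obtain U1 where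
    "exec c2 s U1 s''" "U = 1 + acost e + U1"
    by (auto elim: IfE)
  with IfFalse.IH show ?case by blast
next
  case (WhileTrue e s c T1 s1 T2 s2)
  from WhileTrue.prems WhileTrue.hyps(1) obtain U1 r U2 where
    "exec c s U1 r" "exec (While e c) r U2 s''" "U = 1 + acost e + U1 + U2"
    by (auto elim: WhileE)
  with WhileTrue.IH show ?case by blast
qed (auto elim: SkipE AssignE WriteE WhileE)

definition halts_within :: "com \<Rightarrow> state \<Rightarrow> real \<Rightarrow> state \<Rightarrow> bool" where
  "halts_within P s B s' \<longleftrightarrow> (\<exists>T. exec P s T s' \<and> real T \<le> B)"


section \<open>Input, output and time bound\<close>

text \<open>A graph is presented to the machine by a numbering \<open>vs\<close> of its vertices by
  \<open>0, 1, \<dots>\<close> and by a list \<open>es\<close> of pairs of vertex numbers in which each edge occurs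
  exactly once, the order of the edges and of their two ends being arbitrary.\<close>

definition represents :: "'a list \<Rightarrow> (nat \<times> nat) list \<Rightarrow> 'a set \<Rightarrow> 'a set set \<Rightarrow> bool" where
  "represents vs es V E \<longleftrightarrow>
     distinct vs \<and> set vs = V \<and>
     (\<forall>(i, j)\<in>set es. i < length vs \<and> j < length vs) \<and>
     length es = card E \<and> (\<lambda>(i, j). {vs ! i, vs ! j}) ` set es = E"

definition input_state :: "nat \<Rightarrow> 'a list \<Rightarrow> (nat \<times> nat) list \<Rightarrow> state" where
  "input_state k vs es =
    \<lparr>reg = (\<lambda>_. 0)(0 := k, 1 := length vs, 2 := length es),
     arr = (\<lambda>_ _. 0)(0 := (\<lambda>i. if i < length es then fst (es ! i) else 0),
                     1 := (\<lambda>i. if i < length es then snd (es ! i) else 0))\<rparr>"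

text \<open>Output convention for a run with parameter \<open>k\<close>: register 0 answers whether the graph is
  \<open>k\<close>-equidominating; if so, register 1 holds the target value and array 0 the weights of the
  vertices.  Register 2 answers whether the graph is equidominating with target \<open>k\<close>.\<close>

definition accepts :: "state \<Rightarrow> bool" where
  "accepts s \<longleftrightarrow> reg s 0 \<noteq> 0"

definition outputs_structure :: "'a list \<Rightarrow> state \<Rightarrow> ('a \<Rightarrow> nat) \<Rightarrow> nat \<Rightarrow> bool" where
  "outputs_structure vs s w t \<longleftrightarrow> reg s 1 = t \<and> (\<forall>i<length vs. arr s 0 i = w (vs ! i))"

definition accepts_target :: "state \<Rightarrow> bool" where
  "accepts_target s \<longleftrightarrow> reg s 2 \<noteq> 0"

definition time_bound :: "nat \<Rightarrow> nat \<Rightarrow> nat \<Rightarrow> real" where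
  "time_bound k n m =
     real n * real m ^ 2 + real n ^ k * real k ^ k
     + real n ^ (2 * k + 2) * real k powi (- int k - 1) + real k ^ (3 * k + 3)"

end

theory Submission
  imports Defs "HOL-Combinatorics.Transposition"
begin

text \<open>Call two vertices interchangeable if swapping them preserves the dominating sets; this can be
  tested in polynomial time.  Vertices of equal weight in an equidominating structure are
  interchangeable, so up to swaps a weight function is given by a vector \<open>f\<close> of \<open>k\<close> numbers at most
  \<open>n\<close>: the first vertex of each weight.  For a candidate \<open>w\<close> built from such an \<open>f\<close>, whether \<open>D\<close> is
  a minimal dominating set depends only on the numbers \<open>d j\<close> of vertices of weight \<open>j\<close> in \<open>D\<close>, and
  it can be read off in time \<open>O (k n)\<close> from the numbers of neighbours of each weight.  There are
  \<open>(n + 1) ^ k\<close> candidates and, by the inequality of the means, at most \<open>((n + k) / k) ^ k\<close> vectors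
  \<open>d\<close> for each of them.  The target is the weight of one fixed minimal dominating set.  Since every
  vertex lies in a minimal dominating set, weights never exceed the target, which settles the
  second question.\<close>

section \<open>Total correctness with running times\<close>

text \<open>Two observations leave a candidate to be tested for nothing but being a structure.
  Interchangeability is an equivalence relation, so whatever \<open>f\<close> is, vertices that
  receive the same nonzero weight are interchangeable, and count vectors suffice for the test.
  Conversely, the weights of a structure may be permuted inside a class, hence sorted along it, and
  a sorted weight function is recovered from the starting points of its weights.

  The obstacle is the budget. Let N be the maximum of n and k^2. Up to constant factors there are at
  most N^k candidates with at most (N/k)^k count vectors each, while the bound offers
  N^(2k+2)/k^(k+1). A vector may thus cost N^2/k steps, which is at least k N because k^2 \<le> N.
  This is why minimality is read off from forced numbers of neighbours, without recounting after
  each deletion, and why everything that depends only on the graph or only on the weights is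
  tabulated outside the loop over vectors. For k = 1 the allowance is N^4, the order of the cost of
  testing interchangeability.\<close>

fun wregs :: "com \<Rightarrow> nat set" where
  "wregs Skip = {}"
| "wregs (Assign r e) = {r}"
| "wregs (Write a e1 e2) = {}"
| "wregs (Seq c1 c2) = wregs c1 \<union> wregs c2"
| "wregs (If e c1 c2) = wregs c1 \<union> wregs c2"
| "wregs (While e c) = wregs c"

fun warrs :: "com \<Rightarrow> nat set" where
  "warrs Skip = {}"
| "warrs (Assign r e) = {}"
| "warrs (Write a e1 e2) = {a}"
| "warrs (Seq c1 c2) = warrs c1 \<union> warrs c2"
| "warrs (If e c1 c2) = warrs c1 \<union> warrs c2"
| "warrs (While e c) = warrs c"

definition same :: "nat set \<Rightarrow> nat set \<Rightarrow> state \<Rightarrow> state \<Rightarrow> bool" where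
  "same R A s s' \<longleftrightarrow> (\<forall>r. r \<notin> R \<longrightarrow> reg s' r = reg s r) \<and> (\<forall>a. a \<notin> A \<longrightarrow> arr s' a = arr s a)"

lemma same_trans:
  "same R A s s1 \<Longrightarrow> same R' A' s1 s2 \<Longrightarrow> R \<subseteq> R'' \<Longrightarrow> R' \<subseteq> R'' \<Longrightarrow> A \<subseteq> A'' \<Longrightarrow> A' \<subseteq> A''
   \<Longrightarrow> same R'' A'' s s2"
  unfolding same_def by (metis subsetD)

lemma exec_same: "exec c s T s' \<Longrightarrow> same (wregs c) (warrs c) s s'"
proof (induction rule: exec.induct)
  case (Seq c1 s T1 s1 c2 T2 s2)
  then show ?case by (auto intro: same_trans)
next
  case (WhileTrue e s c T1 s1 T2 s2)
  then show ?case by (auto intro: same_trans)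
qed (auto simp: same_def)

definition runs :: "com \<Rightarrow> state \<Rightarrow> nat \<Rightarrow> (state \<Rightarrow> bool) \<Rightarrow> bool" where
  "runs c s B Q \<longleftrightarrow> (\<exists>T s'. exec c s T s' \<and> T \<le> B \<and> Q s')"

text \<open>By \<open>exec_same\<close> a postcondition may be strengthened by the frame condition
  for free, so a specification has to mention only what the program computes.\<close>

lemma runs_conseq:
  assumes "runs c s B Q" "B \<le> B'"
    and "\<And>s'. Q s' \<Longrightarrow> same (wregs c) (warrs c) s s' \<Longrightarrow> Q' s'"
  shows "runs c s B' Q'"
  using assms exec_same unfolding runs_def by (meson le_trans)

lemma runs_Skip: "Q s \<Longrightarrow> 1 \<le> B \<Longrightarrow> runs Skip s B Q"
  unfolding runs_def using exec.Skip by blast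

lemma runs_Assign:
  "Q (s\<lparr>reg := (reg s)(r := aval e s)\<rparr>) \<Longrightarrow> 1 + acost e \<le> B \<Longrightarrow> runs (Assign r e) s B Q"
  unfolding runs_def using exec.Assign by blast

lemma runs_Write:
  "Q (s\<lparr>arr := (arr s)(a := (arr s a)(aval e1 s := aval e2 s))\<rparr>) \<Longrightarrow> 1 + acost e1 + acost e2 \<le> B
   \<Longrightarrow> runs (Write a e1 e2) s B Q"
  unfolding runs_def using exec.Write by blast

lemma runs_Seq:
  assumes "runs c1 s B1 Q1"
    and "\<And>s1. Q1 s1 \<Longrightarrow> same (wregs c1) (warrs c1) s s1 \<Longrightarrow> runs c2 s1 B2 Q"
  shows "runs (Seq c1 c2) s (B1 + B2) Q"
proof -
  obtain T1 s1 where 1: "exec c1 s T1 s1" "T1 \<le> B1" "Q1 s1"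
    using assms(1) runs_def by auto
  obtain T2 s2 where 2: "exec c2 s1 T2 s2" "T2 \<le> B2" "Q s2"
    using assms(2)[OF 1(3) exec_same[OF 1(1)]] runs_def by auto
  show ?thesis unfolding runs_def using exec.Seq[OF 1(1) 2(1)] 1 2 by (meson add_mono)
qed

lemma runs_If:
  assumes "aval e s \<noteq> 0 \<Longrightarrow> runs c1 s B Q" "aval e s = 0 \<Longrightarrow> runs c2 s B Q"
  shows "runs (If e c1 c2) s (1 + acost e + B) Q"
proof (cases "aval e s = 0")
  case True
  then obtain T s' where "exec c2 s T s'" "T \<le> B" "Q s'"
    using assms runs_def by auto
  then show ?thesis
    unfolding runs_def using exec.IfFalse[OF True] by (meson add_left_mono)
next
  case False
  then obtain T s' where "exec c1 s T s'" "T \<le> B" "Q s'"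
    using assms runs_def by auto
  then show ?thesis
    unfolding runs_def using exec.IfTrue[OF False] by (meson add_left_mono)
qed

text \<open>The invariant carries the number of rounds done, which fixes the total at
  \<open>N\<close> and replaces a variant; hence the induction on \<open>N - j\<close>.\<close>

lemma runs_While:
  assumes step: "\<And>j s. j < N \<Longrightarrow> I j s \<Longrightarrow>
      aval e s \<noteq> 0 \<and> runs c s B (\<lambda>s'. I (Suc j) s')"
    and final: "\<And>s. I N s \<Longrightarrow> aval e s = 0"
    and init: "I j s" "j \<le> N"
  shows "runs (While e c) s ((N - j) * (B + 1 + acost e) + 1 + acost e) (I N)"
  using init
proof (induction "N - j" arbitrary: j s)
  case 0
  then have "I N s" by simp
  then have "exec (While e c) s (1 + acost e) s"
    using exec.WhileFalse final by blast
  then show ?case unfolding runs_def using \<open>I N s\<close> by fastforce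
next
  case (Suc i)
  then have "j < N" by simp
  with Suc.prems step obtain T1 s1 where 1: "aval e s \<noteq> 0" "exec c s T1 s1" "T1 \<le> B" "I (Suc j) s1"
    unfolding runs_def by blast
  have "runs (While e c) s1 ((N - Suc j) * (B + 1 + acost e) + 1 + acost e) (I N)"
    using Suc 1 \<open>j < N\<close> by auto
  then obtain T2 s2 where 2: "exec (While e c) s1 T2 s2"
      "T2 \<le> (N - Suc j) * (B + 1 + acost e) + 1 + acost e" "I N s2"
    unfolding runs_def by blast
  have N: "N - j = Suc (N - Suc j)" using \<open>j < N\<close> by simp
  have "1 + acost e + T1 + T2 \<le> (N - j) * (B + 1 + acost e) + 1 + acost e"
    unfolding N using 1(3) 2(2) by simp
  then show ?case
    unfolding runs_def using exec.WhileTrue[OF 1(1,2) 2(1)] 2(3) by blast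
qed

section \<open>Counting loops, accumulated values and tables\<close>

definition For :: "nat \<Rightarrow> aexp \<Rightarrow> com \<Rightarrow> com" where
  "For i e c = Seq (Assign i (Const 0))
     (While (Sub e (Reg i)) (Seq c (Assign i (Add (Reg i) (Const 1)))))"

lemma written_For [simp]:
  "wregs (For i e c) = insert i (wregs c)" "warrs (For i e c) = warrs c"
  by (auto simp: For_def)

text \<open>The guard is a truncated difference, nonzero exactly while the counter is below the
  bound. A round costs \<open>B\<close>, 4 for the increment and at most 8 for the guard; one extra
  round pays for the initialisation and the failing test.\<close>

lemma runs_For:
  assumes i: "i \<notin> wregs c"
    and bound: "\<And>s'. same (insert i (wregs c)) (warrs c) s s' \<Longrightarrow> aval e s' = N"
    and cost: "acost e \<le> 5"
    and init: "I 0 (s\<lparr>reg := (reg s)(i := 0)\<rparr>)"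
    and step: "\<And>j s'. j < N \<Longrightarrow> same (insert i (wregs c)) (warrs c) s s' \<Longrightarrow> reg s' i = j \<Longrightarrow>
      I j s' \<Longrightarrow> runs c s' B (\<lambda>s''. I (Suc j) (s''\<lparr>reg := (reg s'')(i := Suc j)\<rparr>))"
  shows "runs (For i e c) s ((N + 1) * (B + 12)) (I N)"
proof -
  let ?J = "\<lambda>j s'. I j s' \<and> reg s' i = j \<and> same (insert i (wregs c)) (warrs c) s s'"
  let ?e = "Sub e (Reg i)" and ?c = "Seq c (Assign i (Add (Reg i) (Const 1)))"
  have W: "runs (While ?e ?c) s1 ((N - 0) * (B + 4 + 1 + acost ?e) + 1 + acost ?e) (?J N)"
    if "?J 0 s1" for s1
  proof (rule runs_While[where I = ?J])
    fix j s2
    assume j: "j < N" and J: "?J j s2"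
    have "runs ?c s2 (B + 4) (?J (Suc j))"
    proof (rule runs_Seq)
      show "runs c s2 B (\<lambda>s''. I (Suc j) (s''\<lparr>reg := (reg s'')(i := Suc j)\<rparr>))"
        using step j J by blast
    next
      fix s3
      assume I3: "I (Suc j) (s3\<lparr>reg := (reg s3)(i := Suc j)\<rparr>)"
        and s3: "same (wregs c) (warrs c) s2 s3"
      have "same (insert i (wregs c)) (warrs c) s s3"
        using same_trans[of _ _ s s2 "wregs c" "warrs c" s3] J s3 by blast
      moreover have "reg s3 i = j" using s3 i J by (simp add: same_def)
      ultimately show "runs (Assign i (Add (Reg i) (Const 1))) s3 4 (?J (Suc j))"
        using I3 by (auto intro!: runs_Assign simp: same_def)
    qed
    moreover have "aval ?e s2 \<noteq> 0" using bound[of s2] j J by simp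
    ultimately show "aval ?e s2 \<noteq> 0 \<and> runs ?c s2 (B + 4) (?J (Suc j))" by blast
  next
    fix s2 assume "?J N s2"
    then show "aval ?e s2 = 0" using bound[of s2] by simp
  qed (use that in auto)
  have "runs (For i e c) s (2 + ((N - 0) * (B + 4 + 1 + acost ?e) + 1 + acost ?e)) (?J N)"
    unfolding For_def
  proof (rule runs_Seq)
    show "runs (Assign i (Const 0)) s 2 (?J 0)"
      using init by (auto intro!: runs_Assign simp: same_def)
  qed (use W in auto)
  moreover have "2 + ((N - 0) * (B + 4 + 1 + acost ?e) + 1 + acost ?e) \<le> (N + 1) * (B + 12)"
  proof -
    have "N * acost e \<le> N * 5" using cost by (rule mult_left_mono) simp
    then have "acost e + N * acost e \<le> 5 + N * 5" using cost by linarith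
    then show ?thesis by (simp only: acost.simps distrib_left distrib_right) simp
  qed
  ultimately show ?thesis by (rule runs_conseq) auto
qed

definition Fold :: "nat \<Rightarrow> nat \<Rightarrow> aexp \<Rightarrow> com \<Rightarrow> aexp \<Rightarrow> com" where
  "Fold r i e c x = Seq (Assign r (Const 0)) (For i e (Seq c (Assign r x)))"

lemma written_Fold [simp]:
  "wregs (Fold r i e c x) = insert r (insert i (wregs c))" "warrs (Fold r i e c x) = warrs c"
  by (auto simp: Fold_def)

lemma runs_Fold:
  assumes i: "i \<notin> wregs c" "r \<notin> wregs c" "i \<noteq> r"
    and bound: "\<And>s'. same (insert r (insert i (wregs c))) (warrs c) s s' \<Longrightarrow> aval e s' = N"
    and cost: "acost e \<le> 5" "acost x \<le> 60"
    and init: "G 0 = 0"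
    and step: "\<And>j s'. j < N \<Longrightarrow> same (insert r (insert i (wregs c))) (warrs c) s s' \<Longrightarrow>
      reg s' i = j \<Longrightarrow> reg s' r = G j \<Longrightarrow> runs c s' B (\<lambda>s''. aval x s'' = G (Suc j))"
  shows "runs (Fold r i e c x) s ((N + 1) * (B + 80)) (\<lambda>s'. reg s' r = G N)"
proof -
  have "runs (Fold r i e c x) s (2 + (N + 1) * (B + 61 + 12)) (\<lambda>s'. reg s' r = G N)"
    unfolding Fold_def
  proof (rule runs_Seq)
    show "runs (Assign r (Const 0)) s 2 (\<lambda>s'. reg s' r = 0)"
      by (auto intro!: runs_Assign)
  next
    fix s1 assume r0: "reg s1 r = 0" and s1: "same (wregs (Assign r (Const 0))) (warrs (Assign r (Const 0))) s s1"
    show "runs (For i e (Seq c (Assign r x))) s1 ((N + 1) * (B + 61 + 12)) (\<lambda>s'. reg s' r = G N)"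
    proof (rule runs_For)
      show "i \<notin> wregs (Seq c (Assign r x))" using i by simp
      show "acost e \<le> 5" by fact
      have *: "same (insert r (insert i (wregs c))) (warrs c) s s'"
        if "same (insert i (wregs (Seq c (Assign r x)))) (warrs (Seq c (Assign r x))) s1 s'" for s'
        using s1 that by (auto simp: same_def)
      then show "\<And>s'. same (insert i (wregs (Seq c (Assign r x)))) (warrs (Seq c (Assign r x))) s1 s' \<Longrightarrow>
         aval e s' = N" using bound by blast
      show "reg (s1\<lparr>reg := (reg s1)(i := 0)\<rparr>) r = G 0"
        using r0 i init by simp
      fix j s'
      assume j: "j < N" "reg s' i = j" "reg s' r = G j"
        and s': "same (insert i (wregs (Seq c (Assign r x)))) (warrs (Seq c (Assign r x))) s1 s'"
      show "runs (Seq c (Assign r x)) s' (B + 61)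
          (\<lambda>s''. reg (s''\<lparr>reg := (reg s'')(i := Suc j)\<rparr>) r = G (Suc j))"
        by (rule runs_Seq[OF step[OF j(1) *[OF s'] j(2,3)]])
          (use cost i in \<open>auto intro!: runs_Assign\<close>)
    qed
  qed
  moreover have "2 + (N + 1) * (B + 61 + 12) \<le> (N + 1) * (B + 80)"
    by (simp add: algebra_simps)
  ultimately show ?thesis by (rule runs_conseq) auto
qed

definition Sum :: "nat \<Rightarrow> nat \<Rightarrow> aexp \<Rightarrow> com \<Rightarrow> aexp \<Rightarrow> com" where
  "Sum r i e c x = Fold r i e c (Add (Reg r) x)"

lemma written_Sum [simp]:
  "wregs (Sum r i e c x) = insert r (insert i (wregs c))" "warrs (Sum r i e c x) = warrs c"
  by (auto simp: Sum_def)

lemma runs_Sum: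
  assumes i: "i \<notin> wregs c" "r \<notin> wregs c" "i \<noteq> r"
    and bound: "\<And>s'. same (insert r (insert i (wregs c))) (warrs c) s s' \<Longrightarrow> aval e s' = N"
    and cost: "acost e \<le> 5" "acost x \<le> 58"
    and step: "\<And>j s'. j < N \<Longrightarrow> same (insert r (insert i (wregs c))) (warrs c) s s' \<Longrightarrow>
      reg s' i = j \<Longrightarrow> runs c s' B (\<lambda>s''. aval x s'' = g j)"
  shows "runs (Sum r i e c x) s ((N + 1) * (B + 80)) (\<lambda>s'. reg s' r = (\<Sum>j<N. g j))"
  unfolding Sum_def
proof (rule runs_Fold)
  fix j s'
  assume "j < N" "same (insert r (insert i (wregs c))) (warrs c) s s'"
      "reg s' i = j" and r: "reg s' r = (\<Sum>j<j. g j)"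
  then have "runs c s' B (\<lambda>s''. aval x s'' = g j)" using step by blast
  then show "runs c s' B (\<lambda>s''. aval (Add (Reg r) x) s'' = (\<Sum>j<Suc j. g j))"
    by (rule runs_conseq) (use r i in \<open>auto simp: same_def\<close>)
qed (use assms in auto)

lemma runs_Sum0:
  assumes i: "i \<noteq> r"
    and bound: "\<And>s'. same {r, i} {} s s' \<Longrightarrow> aval e s' = N"
    and cost: "acost e \<le> 5" "acost x \<le> 58"
    and step: "\<And>j s'. j < N \<Longrightarrow> same {r, i} {} s s' \<Longrightarrow> reg s' i = j \<Longrightarrow> aval x s' = g j"
  shows "runs (Sum r i e Skip x) s ((N + 1) * 81) (\<lambda>s'. reg s' r = (\<Sum>j<N. g j))"
proof -
  have "runs (Sum r i e Skip x) s ((N + 1) * (1 + 80)) (\<lambda>s'. reg s' r = (\<Sum>j<N. g j))"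
    by (rule runs_Sum) (use assms in \<open>auto intro: runs_Skip\<close>)
  then show ?thesis by simp
qed

definition Tab :: "nat \<Rightarrow> nat \<Rightarrow> aexp \<Rightarrow> com \<Rightarrow> aexp \<Rightarrow> com" where
  "Tab a i e c x = For i e (Seq c (Write a (Reg i) x))"

lemma written_Tab [simp]:
  "wregs (Tab a i e c x) = insert i (wregs c)" "warrs (Tab a i e c x) = insert a (warrs c)"
  by (auto simp: Tab_def)

text \<open>The step may rely on the entries already written. The table of \<open>greedy\<close>
  needs this, being defined by recursion on earlier entries.\<close>

lemma runs_Tab:
  assumes i: "i \<notin> wregs c" "a \<notin> warrs c"
    and bound: "\<And>s'. same (insert i (wregs c)) (insert a (warrs c)) s s' \<Longrightarrow> aval e s' = N"
    and cost: "acost e \<le> 5" "acost x \<le> 60"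
    and step: "\<And>j s'. j < N \<Longrightarrow> same (insert i (wregs c)) (insert a (warrs c)) s s' \<Longrightarrow>
      reg s' i = j \<Longrightarrow> (\<And>y. y < j \<Longrightarrow> arr s' a y = g y) \<Longrightarrow> runs c s' B (\<lambda>s''. aval x s'' = g j)"
  shows "runs (Tab a i e c x) s ((N + 1) * (B + 80)) (\<lambda>s'. \<forall>y<N. arr s' a y = g y)"
proof -
  have "runs (Tab a i e c x) s ((N + 1) * (B + 62 + 12)) (\<lambda>s'. \<forall>y<N. arr s' a y = g y)"
    unfolding Tab_def
  proof (rule runs_For)
    fix j s'
    assume j: "j < N" "reg s' i = j" "\<forall>y<j. arr s' a y = g y"
      and s': "same (insert i (wregs (Seq c (Write a (Reg i) x)))) (warrs (Seq c (Write a (Reg i) x))) s s'"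
    have *: "runs c s' B (\<lambda>s''. aval x s'' = g j)"
      by (rule step) (use j s' in \<open>auto simp: same_def\<close>)
    show "runs (Seq c (Write a (Reg i) x)) s' (B + 62)
        (\<lambda>s''. \<forall>y<Suc j. arr (s''\<lparr>reg := (reg s'')(i := Suc j)\<rparr>) a y = g y)"
      by (rule runs_Seq[OF *])
        (use cost i j in \<open>auto intro!: runs_Write simp: same_def less_Suc_eq\<close>)
  next
    show "aval e s' = N"
      if "same (insert i (wregs (Seq c (Write a (Reg i) x)))) (warrs (Seq c (Write a (Reg i) x))) s s'"
      for s' by (rule bound) (use that in \<open>auto simp: same_def\<close>)
  qed (use assms in auto)
  moreover have "(N + 1) * (B + 62 + 12) \<le> (N + 1) * (B + 80)" by (simp add: algebra_simps)
  ultimately show ?thesis by (rule runs_conseq) auto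
qed

definition Tab2 :: "nat \<Rightarrow> nat \<Rightarrow> nat \<Rightarrow> aexp \<Rightarrow> aexp \<Rightarrow> com \<Rightarrow> aexp \<Rightarrow> com" where
  "Tab2 a i j e1 e2 c x = For i e1 (For j e2 (Seq c (Write a (Add (Read 2 (Reg i)) (Reg j)) x)))"

lemma written_Tab2 [simp]:
  "wregs (Tab2 a i j e1 e2 c x) = insert i (insert j (wregs c))"
  "warrs (Tab2 a i j e1 e2 c x) = insert a (warrs c)"
  by (auto simp: Tab2_def)

text \<open>Uniqueness of quotient and remainder; it separates the cells of a matrix and the digits
  of a mixed-radix number.\<close>

lemma index_inj:
  fixes n :: nat
  assumes "u * n + v = u' * n + v'" "v < n" "v' < n"
  shows "u = u' \<and> v = v'"
proof -
  have "u = (u * n + v) div n" "u' = (u' * n + v') div n" using assms(2,3) by auto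
  then show ?thesis using assms by (metis add_left_cancel)
qed

lemma runs_Tab2:
  assumes i: "i \<notin> wregs c" "j \<notin> wregs c" "i \<noteq> j" "a \<notin> warrs c" "2 \<notin> warrs c" "a \<noteq> 2"
    and off: "\<And>u. u < N1 \<Longrightarrow> arr s 2 u = u * N2"
    and bound: "\<And>s'. same (insert i (insert j (wregs c))) (insert a (warrs c)) s s' \<Longrightarrow>
      aval e1 s' = N1 \<and> aval e2 s' = N2"
    and cost: "acost e1 \<le> 5" "acost e2 \<le> 5" "acost x \<le> 60"
    and step: "\<And>u v s'. u < N1 \<Longrightarrow> v < N2 \<Longrightarrow>
      same (insert i (insert j (wregs c))) (insert a (warrs c)) s s' \<Longrightarrow>
      reg s' i = u \<Longrightarrow> reg s' j = v \<Longrightarrow> runs c s' B (\<lambda>s''. aval x s'' = g u v)"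
  shows "runs (Tab2 a i j e1 e2 c x) s ((N1 + 1) * ((N2 + 1) * (B + 90)))
    (\<lambda>s'. \<forall>u<N1. \<forall>v<N2. arr s' a (u * N2 + v) = g u v)"
proof -
  let ?w = "Write a (Add (Read 2 (Reg i)) (Reg j)) x"
  let ?R = "insert i (insert j (wregs c))" and ?A = "insert a (warrs c)"
  have "runs (Tab2 a i j e1 e2 c x) s ((N1 + 1) * ((N2 + 1) * (B + 65 + 12) + 12))
    (\<lambda>s'. \<forall>u<N1. \<forall>v<N2. arr s' a (u * N2 + v) = g u v)"
    unfolding Tab2_def
  proof (rule runs_For)
    fix u s1
    assume u: "u < N1" "reg s1 i = u"
      and 1: "\<forall>u'<u. \<forall>v<N2. arr s1 a (u' * N2 + v) = g u' v"
      and "same (insert i (wregs (For j e2 (Seq c ?w)))) (warrs (For j e2 (Seq c ?w))) s s1"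
    then have s1: "same ?R ?A s s1" by (simp add: insert_commute)
    have "runs (For j e2 (Seq c ?w)) s1 ((N2 + 1) * (B + 65 + 12))
      (\<lambda>s'. (\<forall>u'<u. \<forall>v<N2. arr s' a (u' * N2 + v) = g u' v) \<and>
            (\<forall>v<N2. arr s' a (u * N2 + v) = g u v))"
    proof (rule runs_For[where I = "\<lambda>m s'. (\<forall>u'<u. \<forall>v<N2. arr s' a (u' * N2 + v) = g u' v) \<and>
            (\<forall>v<m. arr s' a (u * N2 + v) = g u v)"])
      fix v s2
      assume v: "v < N2" "reg s2 j = v"
        and 2: "(\<forall>u'<u. \<forall>v<N2. arr s2 a (u' * N2 + v) = g u' v) \<and>
            (\<forall>v'<v. arr s2 a (u * N2 + v') = g u v')"
        and s2: "same (insert j (wregs (Seq c ?w))) (warrs (Seq c ?w)) s1 s2"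
      have s2': "same ?R ?A s s2" using s1 s2 by (auto simp: same_def)
      have i2: "reg s2 i = u" using s2 i u by (auto simp: same_def)
      have *: "runs c s2 B (\<lambda>s''. aval x s'' = g u v)"
        by (rule step) (use u v s2' i2 in auto)
      show "runs (Seq c ?w) s2 (B + 65) (\<lambda>s'.
          (\<forall>u'<u. \<forall>v'<N2. arr (s'\<lparr>reg := (reg s')(j := Suc v)\<rparr>) a (u' * N2 + v') = g u' v') \<and>
          (\<forall>v'<Suc v. arr (s'\<lparr>reg := (reg s')(j := Suc v)\<rparr>) a (u * N2 + v') = g u v'))"
      proof (rule runs_Seq[OF *])
        fix s3
        assume x: "aval x s3 = g u v" and s3: "same (wregs c) (warrs c) s2 s3"
        have ij: "reg s3 i = u" "reg s3 j = v" using s3 i i2 v by (auto simp: same_def)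
        have o: "arr s3 2 u = u * N2" using off[OF u(1)] s2' s3 i by (auto simp: same_def)
        have a: "arr s3 a = arr s2 a" using s3 i by (auto simp: same_def)
        show "runs ?w s3 65 (\<lambda>s'.
          (\<forall>u'<u. \<forall>v'<N2. arr (s'\<lparr>reg := (reg s')(j := Suc v)\<rparr>) a (u' * N2 + v') = g u' v') \<and>
          (\<forall>v'<Suc v. arr (s'\<lparr>reg := (reg s')(j := Suc v)\<rparr>) a (u * N2 + v') = g u v'))"
        proof -
          \<comment> \<open>Columns stay below the row length, so the cell to be written lies in no
            earlier row.\<close>
          have "arr s2 a (u' * N2 + v') = g u' v' \<and> u' * N2 + v' \<noteq> u * N2 + v"
            if "u' < u" "v' < N2" for u' v'
            using that 2 v index_inj[of u' N2 v' u v] by blast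
          then show ?thesis
            using 2 cost by (intro runs_Write) (auto simp: ij o a x less_Suc_eq)
        qed
      qed
    next
      show "aval e2 s' = N2" if "same (insert j (wregs (Seq c ?w))) (warrs (Seq c ?w)) s1 s'" for s'
        using bound[of s'] s1 that by (auto simp: same_def)
    qed (use assms 1 in auto)
    then show "runs (For j e2 (Seq c ?w)) s1 ((N2 + 1) * (B + 65 + 12))
      (\<lambda>s''. \<forall>u'<Suc u. \<forall>v<N2. arr (s''\<lparr>reg := (reg s'')(i := Suc u)\<rparr>) a (u' * N2 + v) = g u' v)"
      by (rule runs_conseq) (auto simp: less_Suc_eq)
  next
    show "aval e1 s' = N1"
      if "same (insert i (wregs (For j e2 (Seq c ?w)))) (warrs (For j e2 (Seq c ?w))) s s'" for s'
      using bound[of s'] that by (simp add: insert_commute)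
  qed (use assms in auto)
  moreover have "(N1 + 1) * ((N2 + 1) * (B + 65 + 12) + 12) \<le> (N1 + 1) * ((N2 + 1) * (B + 90))"
    by (rule mult_left_mono) (simp_all add: algebra_simps)
  ultimately show ?thesis by (rule runs_conseq) auto
qed

section \<open>Interchangeable vertices\<close>

locale reflexive_graph =
  fixes n :: nat and adj :: "nat \<Rightarrow> nat \<Rightarrow> bool"
  assumes adj_refl: "v < n \<Longrightarrow> adj v v" and adj_sym: "adj u v \<Longrightarrow> adj v u"
begin

definition dom :: "nat set \<Rightarrow> bool" where
  "dom D \<longleftrightarrow> D \<subseteq> {..<n} \<and> (\<forall>x<n. \<exists>u\<in>D. adj x u)"

definition min_dom :: "nat set \<Rightarrow> bool" where
  "min_dom D \<longleftrightarrow> dom D \<and> (\<forall>D'. D' \<subset> D \<longrightarrow> \<not> dom D')"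

definition interchangeable :: "nat \<Rightarrow> nat \<Rightarrow> bool" where
  "interchangeable u v \<longleftrightarrow> (\<forall>D. dom D \<longrightarrow> dom (transpose u v ` D))"

definition struct :: "(nat \<Rightarrow> nat) \<Rightarrow> nat \<Rightarrow> bool" where
  "struct w t \<longleftrightarrow> t \<ge> 1 \<and> (\<forall>v<n. w v \<ge> 1) \<and> (\<forall>D\<subseteq>{..<n}. min_dom D \<longleftrightarrow> sum w D = t)"

lemma dom_mono: "dom D \<Longrightarrow> D \<subseteq> D' \<Longrightarrow> D' \<subseteq> {..<n} \<Longrightarrow> dom D'"
  unfolding dom_def by blast

text \<open>Domination is monotone, so a dominating proper subset already shows up after the
  deletion of a single vertex.\<close>

lemma min_dom_iff: "min_dom D \<longleftrightarrow> dom D \<and> (\<forall>u\<in>D. \<not> dom (D - {u}))"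
proof
  assume *: "dom D \<and> (\<forall>u\<in>D. \<not> dom (D - {u}))"
  have False if D': "D' \<subset> D" "dom D'" for D'
  proof -
    obtain u where "u \<in> D" "u \<notin> D'" using D' by blast
    then have "D' \<subseteq> D - {u}" "D - {u} \<subseteq> {..<n}" using D' * by (auto simp: dom_def)
    then have "dom (D - {u})" by (rule dom_mono[OF D'(2)])
    then show False using * \<open>u \<in> D\<close> by blast
  qed
  then show "min_dom D" using * by (auto simp: min_dom_def)
qed (auto simp: min_dom_def)

lemma dom_contains_min_dom:
  assumes "dom D"
  obtains D' where "D' \<subseteq> D" "min_dom D'"
proof -
  have "finite D" using assms by (auto simp: dom_def intro: finite_subset)
  then have "\<exists>D'\<subseteq>D. min_dom D'" using assms
  proof (induction D rule: finite_psubset_induct)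
    case (psubset D)
    show ?case
    proof (cases "min_dom D")
      case False
      then obtain E where "E \<subset> D" "dom E" using psubset.prems by (auto simp: min_dom_def)
      then show ?thesis using psubset.IH[of E] by (meson psubset_imp_subset subset_trans)
    qed auto
  qed
  then show thesis using that by blast
qed

lemma transpose_closed: "u < n \<Longrightarrow> v < n \<Longrightarrow> D \<subseteq> {..<n} \<Longrightarrow> transpose u v ` D \<subseteq> {..<n}"
  by (auto simp: transpose_def)

text \<open>The swap preserves total weight, so it maps minimal dominating sets to such sets. Every
  dominating set contains one of them, and monotonicity does the rest.\<close>

lemma struct_interchangeable:
  assumes "struct w t" "u < n" "v < n" "w u = w v"
  shows "interchangeable u v"
  unfolding interchangeable_def
proof (intro allI impI)
  fix D assume "dom D"
  then obtain D' where D': "D' \<subseteq> D" "min_dom D'" by (rule dom_contains_min_dom)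
  have sub: "D \<subseteq> {..<n}" using \<open>dom D\<close> by (simp add: dom_def)
  have "sum w (transpose u v ` D') = sum w D'"
    using assms(4) by (subst sum.reindex) (auto simp: transpose_def intro!: sum.cong)
  then have "min_dom (transpose u v ` D')"
    using assms D' sub transpose_closed[of u v D'] by (auto simp: struct_def)
  then show "dom (transpose u v ` D)"
    using dom_mono[of "transpose u v ` D'"] D' transpose_closed[OF assms(2,3) sub]
    by (auto simp: min_dom_def)
qed

lemma interchangeable_refl: "interchangeable u u"
  by (simp add: interchangeable_def)

lemma interchangeable_sym: "interchangeable u v \<Longrightarrow> interchangeable v u"
  by (simp add: interchangeable_def transpose_commute)

text \<open>For distinct vertices, the swap of \<open>u\<close> and \<open>v\<close> is the
  conjugate of the swap of \<open>a\<close> and \<open>v\<close> by the swap of \<open>u\<close> and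
  \<open>a\<close>.\<close>

lemma interchangeable_trans:
  assumes "interchangeable u a" "interchangeable a v"
  shows "interchangeable u v"
proof (cases "u = a \<or> a = v \<or> u = v")
  case True
  then show ?thesis using assms interchangeable_refl by auto
next
  case False
  have "transpose u v ` D = transpose u a ` transpose a v ` transpose u a ` D" for D
    using False by (simp add: image_image transpose_triple)
  then show ?thesis using assms unfolding interchangeable_def by metis
qed

text \<open>A criterion that quantifies over vertices instead of sets. The swap may take from
  \<open>x\<close> its dominator \<open>u\<close>. The vertex \<open>y\<close> shows that no harm is
  done: a dominator of \<open>y\<close> is not \<open>u\<close>, and it either is \<open>v\<close>,
  which the swap turns into \<open>u\<close>, or dominates \<open>x\<close> as well.\<close>

definition exchange :: "nat \<Rightarrow> nat \<Rightarrow> bool" where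
  "exchange u v \<longleftrightarrow> (\<forall>x<n. adj x u \<and> \<not> adj x v \<longrightarrow>
     (\<exists>y<n. \<not> adj y u \<and> (\<forall>z<n. adj y z \<longrightarrow> adj x z \<or> z = v)))"

lemma interchangeable_imp_exchange:
  assumes "u < n" "v < n" "interchangeable u v"
  shows "exchange u v"
  unfolding exchange_def
proof (intro allI impI)
  fix x assume x: "x < n" "adj x u \<and> \<not> adj x v"
  \<comment> \<open>The largest set whose image under the swap fails to dominate \<open>x\<close>. A
    vertex that this set itself leaves undominated is the required \<open>y\<close>.\<close>
  let ?D = "{z. z < n \<and> \<not> adj x (transpose u v z)}"
  have "\<not> dom (transpose u v ` ?D)"
    using x by (auto simp: dom_def)
  then have "\<not> dom ?D" using assms by (auto simp: interchangeable_def)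
  then obtain y where y: "y < n" "\<forall>z\<in>?D. \<not> adj y z"
    by (auto simp: dom_def)
  then show "\<exists>y<n. \<not> adj y u \<and> (\<forall>z<n. adj y z \<longrightarrow> adj x z \<or> z = v)"
    using x assms by (intro exI[of _ y]) (auto simp: transpose_def split: if_splits)
qed

text \<open>If \<open>x\<close> is adjacent to both or neither of \<open>u\<close> and
  \<open>v\<close>, the swap maps a dominator of \<open>x\<close> to a dominator. If it is adjacent
  to exactly one, a dominator of the witness \<open>y\<close> is mapped to a dominator of
  \<open>x\<close>.\<close>

lemma exchange_imp_interchangeable:
  assumes "u < n" "v < n" "exchange u v" "exchange v u"
  shows "interchangeable u v"
  unfolding interchangeable_def
proof (intro allI impI)
  fix D assume D: "dom D"
  have hit: "\<exists>z\<in>D. adj x (transpose u v z)" if x: "x < n" for x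
  proof -
    have *: "\<exists>z\<in>D. adj x (transpose a b z)"
      if ab: "exchange a b" "adj x a" "\<not> adj x b" for a b
    proof -
      obtain y where y: "y < n" "\<not> adj y a" "\<forall>z<n. adj y z \<longrightarrow> adj x z \<or> z = b"
        using ab x by (auto simp: exchange_def)
      obtain z where z: "z \<in> D" "adj y z" using D y(1) unfolding dom_def by meson
      then have "z < n" using D by (auto simp: dom_def)
      then have "adj x (transpose a b z)" using y(2,3) ab z(2) by (metis transpose_def)
      then show ?thesis using z(1) by blast
    qed
    consider "adj x u" "\<not> adj x v" | "adj x v" "\<not> adj x u" | "adj x u \<longleftrightarrow> adj x v" by blast
    then show ?thesis
    proof cases
      case 1 then show ?thesis using * assms by blast
    next
      case 2 then show ?thesis using *[of v u] assms by (metis transpose_commute)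
    next
      case 3
      obtain z where z: "z \<in> D" "adj x z" using D x unfolding dom_def by meson
      then have "adj x (transpose u v z)" using 3 by (metis transpose_def)
      then show ?thesis using z(1) by blast
    qed
  qed
  have "D \<subseteq> {..<n}" using D by (simp add: dom_def)
  then have "transpose u v ` D \<subseteq> {..<n}" by (rule transpose_closed[OF assms(1,2)])
  then show "dom (transpose u v ` D)" using hit by (simp add: dom_def)
qed

lemma interchangeable_iff:
  "u < n \<Longrightarrow> v < n \<Longrightarrow> interchangeable u v \<longleftrightarrow> exchange u v \<and> exchange v u"
  using interchangeable_imp_exchange[of u v] interchangeable_imp_exchange[of v u]
    exchange_imp_interchangeable[of u v] interchangeable_sym[of u v] by argo


section \<open>Checking a candidate on types of vertex sets\<close>

definition class_invariant :: "(nat \<Rightarrow> nat) \<Rightarrow> bool" where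
  "class_invariant w \<longleftrightarrow> (\<forall>u<n. \<forall>v<n. w u = w v \<longrightarrow> interchangeable u v)"

definition profile :: "(nat \<Rightarrow> nat) \<Rightarrow> nat set \<Rightarrow> nat \<Rightarrow> nat" where
  "profile w D j = card {u \<in> D. w u = Suc j}"

text \<open>The pigeonhole number: of \<open>d j\<close> vertices chosen among those of weight
  \<open>j + 1\<close>, at least this many lie in the closed neighbourhood of \<open>x\<close>.
  Truncation at 0 is intended. Summed over the weights, as in \<open>hits\<close>, it is the number
  of dominators that the counts alone force upon \<open>x\<close>.\<close>

definition excess :: "(nat \<Rightarrow> nat) \<Rightarrow> (nat \<Rightarrow> nat) \<Rightarrow> nat \<Rightarrow> nat \<Rightarrow> nat" where
  "excess w d x j = (profile w {u. u < n \<and> adj x u} j + d j) - profile w {..<n} j"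

definition hits :: "nat \<Rightarrow> (nat \<Rightarrow> nat) \<Rightarrow> (nat \<Rightarrow> nat) \<Rightarrow> nat \<Rightarrow> nat" where
  "hits k w d x = (\<Sum>j<k. excess w d x j)"

text \<open>Induction on the size of \<open>D - D'\<close>. A vertex of \<open>D - D'\<close> is
  traded for one of the same weight in \<open>D' - D\<close>, which exists because the counts agree;
  the base case is monotonicity.\<close>

lemma dom_exchange_many:
  assumes "class_invariant w" "dom D" "D' \<subseteq> {..<n}"
    and "\<And>j. card {u\<in>D. w u = j} = card {u\<in>D'. w u = j}"
  shows "dom D'"
  using assms(2,4)
proof (induction "card (D - D')" arbitrary: D)
  case 0
  have "finite D" using 0(2) by (auto simp: dom_def intro: finite_subset)
  then have "D \<subseteq> D'" using 0(1) by simp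
  then show ?case using dom_mono[OF 0(2)] assms(3) by simp
next
  case (Suc c)
  have fin: "finite D" "finite D'"
    using Suc.prems(1) assms(3) by (auto simp: dom_def intro: finite_subset)
  have "D - D' \<noteq> {}" using Suc(2) by force
  then obtain u where u: "u \<in> D" "u \<notin> D'" by blast
  have "\<not> {v\<in>D'. w v = w u} \<subseteq> {v\<in>D. w v = w u}"
  proof
    assume "{v\<in>D'. w v = w u} \<subseteq> {v\<in>D. w v = w u}"
    then have "{v\<in>D'. w v = w u} = {v\<in>D. w v = w u}"
      using fin Suc.prems(2)[of "w u"] by (intro card_subset_eq) auto
    then show False using u by blast
  qed
  then obtain v where v: "v \<in> D'" "v \<notin> D" "w v = w u" by blast
  have lt: "u < n" "v < n" using u v Suc.prems(1) assms(3) by (auto simp: dom_def)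
  let ?E = "transpose u v ` D"
  have E: "?E = insert v (D - {u})" using u v
    by (intro set_eqI) (auto simp only: in_transpose_image_iff transpose_def insert_iff Diff_iff split: if_splits)
  have "interchangeable u v" using assms(1) lt v by (simp add: class_invariant_def)
  then have "dom ?E" using Suc.prems(1) by (simp add: interchangeable_def)
  moreover have "card {x\<in>?E. w x = j} = card {x\<in>D'. w x = j}" for j
  proof -
    have "w (transpose u v x) = w x" for x using v by (simp add: transpose_def)
    then have "{x\<in>?E. w x = j} = transpose u v ` {x\<in>D. w x = j}"
      by (simp add: set_eq_iff in_transpose_image_iff)
    then have "card {x\<in>?E. w x = j} = card {x\<in>D. w x = j}"
      by (simp add: card_image)
    then show ?thesis using Suc.prems by simp
  qed
  moreover have "c = card (?E - D')"
  proof -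
    have "?E - D' = (D - D') - {u}" unfolding E using v by blast
    then show ?thesis using Suc(2)[symmetric] u fin by simp
  qed
  ultimately show ?case using Suc(1)[of ?E] by simp
qed

lemma profile_mono: "A \<subseteq> B \<Longrightarrow> finite B \<Longrightarrow> profile w A j \<le> profile w B j"
  unfolding profile_def by (intro card_mono) auto

text \<open>If a dominator of \<open>x\<close> is forced, there is one, by the pigeonhole principle.
  If none is forced, a set with the same counts can be chosen that avoids the neighbourhood of
  \<open>x\<close>; by \<open>dom_exchange_many\<close> it would have to dominate along with
  \<open>D\<close>.\<close>

lemma dom_iff_hits:
  assumes inv: "class_invariant w" and range: "\<And>u. u < n \<Longrightarrow> w u \<in> {1..k}" and D: "D \<subseteq> {..<n}"
    and d: "\<And>j. j < k \<Longrightarrow> d j = profile w D j"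
  shows "dom D \<longleftrightarrow> (\<forall>x<n. hits k w d x \<noteq> 0)"
proof
  assume *: "\<forall>x<n. hits k w d x \<noteq> 0"
  have "\<exists>u\<in>D. adj x u" if "x < n" for x
  proof -
    obtain j where j: "j < k" "excess w d x j \<noteq> 0"
      using * \<open>x < n\<close> by (auto simp: hits_def)
    let ?A = "{u \<in> {u. u < n \<and> adj x u}. w u = Suc j}" and ?B = "{u \<in> D. w u = Suc j}"
    have "?A \<inter> ?B \<noteq> {}"
    proof
      assume "?A \<inter> ?B = {}"
      then have "card ?A + card ?B = card (?A \<union> ?B)"
        using D by (subst card_Un_disjoint) (auto intro: finite_subset)
      also have "\<dots> \<le> profile w {..<n} j" unfolding profile_def using D by (intro card_mono) auto
      finally show False using j d[OF j(1)] by (simp add: excess_def profile_def)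
    qed
    then show ?thesis by auto
  qed
  then show "dom D" using D by (simp add: dom_def)
next
  assume dom: "dom D"
  show "\<forall>x<n. hits k w d x \<noteq> 0"
  proof (intro allI impI notI)
    fix x assume x: "x < n" and "hits k w d x = 0"
    then have le: "profile w {u. u < n \<and> adj x u} j + profile w D j \<le> profile w {..<n} j" if "j < k" for j
      using that d by (auto simp: hits_def excess_def)
    have "\<exists>S. S \<subseteq> {u. u < n \<and> w u = Suc j \<and> \<not> adj x u} \<and> card S = profile w D j" if "j < k" for j
    proof -
      have "{u. u < n \<and> w u = Suc j \<and> \<not> adj x u} =
          {u\<in>{..<n}. w u = Suc j} - {u \<in> {u. u < n \<and> adj x u}. w u = Suc j}" by auto
      then have "card {u. u < n \<and> w u = Suc j \<and> \<not> adj x u} =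
          profile w {..<n} j - profile w {u. u < n \<and> adj x u} j"
        unfolding profile_def by (simp only:, subst card_Diff_subset) auto
      then have "profile w D j \<le> card {u. u < n \<and> w u = Suc j \<and> \<not> adj x u}"
        using le[OF that] by simp
      then show ?thesis by (meson obtain_subset_with_card_n)
    qed
    then obtain S where S: "\<And>j. j < k \<Longrightarrow> S j \<subseteq> {u. u < n \<and> w u = Suc j \<and> \<not> adj x u}"
      "\<And>j. j < k \<Longrightarrow> card (S j) = profile w D j" by metis
    let ?D = "\<Union>j<k. S j"
    have "card {u\<in>D. w u = i} = card {u\<in>?D. w u = i}" for i
    proof (cases "i \<in> {1..k}")
      case True
      then obtain j where j: "i = Suc j" "j < k" by (cases i) auto
      have "{u\<in>?D. w u = i} = S j" using S(1) j by fastforce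
      then show ?thesis using S(2)[OF j(2)] j by (simp add: profile_def)
    next
      case False
      then have "{u\<in>D. w u = i} = {}" using D range by blast
      moreover have "{u\<in>?D. w u = i} = {}" using S(1) False by fastforce
      ultimately show ?thesis by (simp only:)
    qed
    then have "dom ?D" using S(1) by (intro dom_exchange_many[OF inv dom]) fastforce+
    then have "\<exists>u\<in>?D. adj x u" using x by (simp only: dom_def)
    then obtain u j where u: "adj x u" "j < k" "u \<in> S j" by blast
    then show False using S(1)[OF u(2)] by blast
  qed
qed

text \<open>The second condition says that losing one vertex of weight \<open>j + 1\<close> leaves
  some \<open>x\<close> undominated. By \<open>hits_decrease\<close> this is visible in the values
  for \<open>d\<close> itself, so nothing has to be recomputed for the smaller vector.\<close>

definition min_dom_type :: "nat \<Rightarrow> (nat \<Rightarrow> nat) \<Rightarrow> (nat \<Rightarrow> nat) \<Rightarrow> bool" where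
  "min_dom_type k w d \<longleftrightarrow> (\<forall>x<n. hits k w d x \<noteq> 0) \<and>
     (\<forall>j<k. d j \<noteq> 0 \<longrightarrow> (\<exists>x<n. hits k w d x = 1 \<and> excess w d x j = 1))"

text \<open>Lowering \<open>d j\<close> by one affects only the summand of \<open>j\<close>, which
  drops by one unless it is 0 already. A nonzero sum therefore vanishes only if that summand is 1
  and all others are 0.\<close>

lemma hits_decrease:
  assumes "j < k" "d j \<noteq> 0" "hits k w d x \<noteq> 0"
  shows "hits k w (d(j := d j - 1)) x = 0 \<longleftrightarrow> hits k w d x = 1 \<and> excess w d x j = 1"
proof -
  define R where "R e = (\<Sum>i\<in>{..<k}-{j}. excess w e x i)" for e
  have hits: "hits k w e x = excess w e x j + R e" for e
    unfolding hits_def R_def using assms by (subst sum.remove[of _ j]) auto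
  have R: "R (d(j := d j - 1)) = R d"
    unfolding R_def by (rule sum.cong) (auto simp: excess_def)
  have "excess w (d(j := d j - 1)) x j = excess w d x j - 1"
    using assms by (simp add: excess_def)
  then show ?thesis using assms(3) unfolding hits R by auto
qed

lemma min_dom_iff_min_dom_type:
  assumes inv: "class_invariant w" and range: "\<And>u. u < n \<Longrightarrow> w u \<in> {1..k}" and D: "D \<subseteq> {..<n}"
    and d: "\<And>j. j < k \<Longrightarrow> d j = profile w D j"
  shows "min_dom D \<longleftrightarrow> min_dom_type k w d"
proof -
  have dom: "dom D \<longleftrightarrow> (\<forall>x<n. hits k w d x \<noteq> 0)"
    using dom_iff_hits assms by blast
  have fin: "finite D" using D finite_subset by blast
  \<comment> \<open>Only the weight of the deleted vertex matters, so one test per weight replaces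
    one per vertex.\<close>
  have rem: "dom (D - {u}) \<longleftrightarrow> (\<forall>x<n. hits k w (d(j := d j - 1)) x \<noteq> 0)"
    if u: "u \<in> D" "w u = Suc j" for u j
  proof (rule dom_iff_hits[OF inv range])
    fix i assume i: "i < k"
    have "profile w (D - {u}) i = (if i = j then profile w D j - 1 else profile w D i)"
    proof (cases "i = j")
      case True
      have "{v \<in> D - {u}. w v = Suc j} = {v\<in>D. w v = Suc j} - {u}" by auto
      then show ?thesis using u True by (simp add: profile_def)
    next
      case False
      then have "{v \<in> D - {u}. w v = Suc i} = {v\<in>D. w v = Suc i}" using u by auto
      then show ?thesis using False by (simp add: profile_def)
    qed
    then show "(d(j := d j - 1)) i = profile w (D - {u}) i" using d i by auto
  qed (use D in auto)
  have *: "(\<forall>u\<in>D. \<not> dom (D - {u})) \<longleftrightarrow>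
     (\<forall>j<k. d j \<noteq> 0 \<longrightarrow> (\<exists>x<n. hits k w (d(j := d j - 1)) x = 0))"
  proof (intro iffI ballI allI impI)
    fix j assume 1: "\<forall>u\<in>D. \<not> dom (D - {u})" and j: "j < k" "d j \<noteq> 0"
    then have "card {u\<in>D. w u = Suc j} \<noteq> 0" using d[OF j(1)] by (simp add: profile_def)
    then have "{u\<in>D. w u = Suc j} \<noteq> {}" by (metis card.empty)
    then obtain u where u: "u \<in> D" "w u = Suc j" by blast
    then show "\<exists>x<n. hits k w (d(j := d j - 1)) x = 0" using rem[OF u] 1 u(1) by auto
  next
    fix u assume 1: "\<forall>j<k. d j \<noteq> 0 \<longrightarrow> (\<exists>x<n. hits k w (d(j := d j - 1)) x = 0)" and u: "u \<in> D"
    have "w u \<in> {1..k}" using range u D by auto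
    then obtain j where j: "j < k" "w u = Suc j" by (cases "w u") auto
    have "u \<in> {u\<in>D. w u = Suc j}" using u j by simp
    then have "card {u\<in>D. w u = Suc j} \<noteq> 0" using fin by auto
    then have "d j \<noteq> 0" using d[OF j(1)] by (simp add: profile_def)
    then show "\<not> dom (D - {u})" using rem[OF u j(2)] 1 j(1) by auto
  qed
  show ?thesis unfolding min_dom_iff min_dom_type_def dom *
    using hits_decrease by (metis (no_types, lifting))
qed

lemma sum_weight_profile:
  assumes range: "\<And>u. u \<in> D \<Longrightarrow> w u \<in> {1..k}" and fin: "finite D"
  shows "sum w D = (\<Sum>j<k. Suc j * profile w D j)"
proof -
  have "sum w D = (\<Sum>i\<in>{1..k}. \<Sum>u\<in>{u\<in>D. w u = i}. w u)"
    using range fin by (intro sum.group[symmetric]) auto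
  also have "\<dots> = (\<Sum>i\<in>{1..k}. i * card {u\<in>D. w u = i})"
    by (intro sum.cong) auto
  also have "\<dots> = (\<Sum>j<k. Suc j * profile w D j)"
    by (rule sum.reindex_bij_witness[of _ Suc "\<lambda>i. i - 1"]) (auto simp: profile_def)
  finally show ?thesis .
qed

definition consistent :: "nat \<Rightarrow> (nat \<Rightarrow> nat) \<Rightarrow> nat \<Rightarrow> bool" where
  "consistent k w t \<longleftrightarrow> (\<forall>u<n. w u \<noteq> 0) \<and> t \<noteq> 0 \<and>
    (\<forall>d. (\<forall>j<k. d j \<le> profile w {..<n} j) \<longrightarrow> (min_dom_type k w d \<longleftrightarrow> (\<Sum>j<k. Suc j * d j) = t))"

text \<open>Together with \<open>profile_mono\<close> this identifies the box of vectors bounded by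
  the class sizes with the set of count vectors of vertex sets, so that the quantifiers in
  \<open>consistent\<close> and \<open>struct\<close> range over the same objects.\<close>

lemma type_realised:
  assumes "\<And>j. j < k \<Longrightarrow> d j \<le> profile w {..<n} j"
  obtains D where "D \<subseteq> {..<n}" "\<And>j. j < k \<Longrightarrow> d j = profile w D j"
proof -
  have "\<exists>S. S \<subseteq> {u\<in>{..<n}. w u = Suc j} \<and> card S = d j" if "j < k" for j
    using assms[OF that] unfolding profile_def by (meson obtain_subset_with_card_n)
  then obtain S where S: "\<And>j. j < k \<Longrightarrow> S j \<subseteq> {u\<in>{..<n}. w u = Suc j}"
      "\<And>j. j < k \<Longrightarrow> card (S j) = d j" by metis
  have "{u \<in> (\<Union>j<k. S j). w u = Suc j} = S j" if "j < k" for j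
    using S(1) that by fastforce
  then have "d j = profile w (\<Union>j<k. S j) j" if "j < k" for j
    using that S(2) by (simp add: profile_def)
  moreover have "(\<Union>j<k. S j) \<subseteq> {..<n}" using S(1) by fastforce
  ultimately show thesis using that by blast
qed

lemma consistent_iff_struct:
  assumes inv: "class_invariant w" and range: "\<And>u. u < n \<Longrightarrow> w u \<in> {1..k}"
  shows "consistent k w t \<longleftrightarrow> struct w t"
proof -
  have w: "sum w D = (\<Sum>j<k. Suc j * d j)" if "D \<subseteq> {..<n}" "\<And>j. j < k \<Longrightarrow> d j = profile w D j" for D d
    using sum_weight_profile[of D w k] range that finite_subset[OF that(1)] by auto
  have "(\<forall>D\<subseteq>{..<n}. min_dom D \<longleftrightarrow> sum w D = t) \<longleftrightarrow>
    (\<forall>d. (\<forall>j<k. d j \<le> profile w {..<n} j) \<longrightarrow> (min_dom_type k w d \<longleftrightarrow> (\<Sum>j<k. Suc j * d j) = t))"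
  (is "?A \<longleftrightarrow> ?B")
  proof
    assume 1: ?A
    show ?B
    proof (rule allI, rule impI)
      fix d assume d: "\<forall>j<k. d j \<le> profile w {..<n} j"
      obtain D where D: "D \<subseteq> {..<n}" "\<And>j. j < k \<Longrightarrow> d j = profile w D j"
        using type_realised[of k d w] d by metis
      have "min_dom D \<longleftrightarrow> sum w D = t" using 1 D(1) by blast
      then show "min_dom_type k w d \<longleftrightarrow> (\<Sum>j<k. Suc j * d j) = t"
        using min_dom_iff_min_dom_type[where d = d] w[where d = d] inv range D by metis
    qed
  next
    assume 1: ?B
    show ?A
    proof (rule allI, rule impI)
      fix D assume D: "D \<subseteq> {..<n}"
      have "\<forall>j<k. profile w D j \<le> profile w {..<n} j" using D by (simp add: profile_mono)
      then have "min_dom_type k w (profile w D) \<longleftrightarrow> (\<Sum>j<k. Suc j * profile w D j) = t"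
        using 1 by blast
      then show "min_dom D \<longleftrightarrow> sum w D = t"
        using min_dom_iff_min_dom_type[where d = "profile w D"] w[where d = "profile w D"] inv range D
        by metis
    qed
  qed
  moreover have "(\<forall>u<n. w u \<noteq> 0) \<longleftrightarrow> (\<forall>u<n. 1 \<le> w u)" "t \<noteq> 0 \<longleftrightarrow> 1 \<le> t"
    by (auto simp: Suc_le_eq)
  ultimately show ?thesis unfolding consistent_def struct_def by argo
qed


section \<open>Candidates\<close>

text \<open>The vertices of each class are assigned weights increasing with the vertex number;
  \<open>f j\<close> is the first vertex of weight \<open>j + 1\<close>, or \<open>n\<close> if there is none.\<close>

fun weight :: "(nat \<Rightarrow> nat) \<Rightarrow> nat \<Rightarrow> nat \<Rightarrow> nat" where
  "weight f 0 u = 0"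
| "weight f (Suc j) u = (if f j \<le> u \<and> interchangeable u (f j) then Suc j else weight f j u)"

lemma weight_le: "weight f j u \<le> j"
  by (induction j) auto

lemma weight_nonzero:
  "weight f k u = Suc j \<Longrightarrow> f j \<le> u \<and> interchangeable u (f j)"
  by (induction k) (auto split: if_splits)

text \<open>All vertices of weight \<open>j + 1\<close> are interchangeable with \<open>f j\<close>,
  hence with each other by transitivity. Weight 0 has no such common reference vertex and is
  excluded.\<close>

lemma class_invariant_weight: "\<forall>u<n. weight f k u \<noteq> 0 \<Longrightarrow> class_invariant (weight f k)"
  unfolding class_invariant_def
proof (intro allI impI)
  fix u v assume *: "\<forall>u<n. weight f k u \<noteq> 0" and uv: "u < n" "v < n" "weight f k u = weight f k v"
  then obtain j where "weight f k u = Suc j" by (metis not0_implies_Suc)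
  then show "interchangeable u v"
    using uv weight_nonzero interchangeable_trans interchangeable_sym by metis
qed

lemma consistent_weight_imp_struct: "consistent k (weight f k) t \<Longrightarrow> struct (weight f k) t"
proof -
  assume *: "consistent k (weight f k) t"
  then have "\<forall>u<n. weight f k u \<noteq> 0" by (simp add: consistent_def)
  moreover from this have "weight f k u \<in> {1..k}" if "u < n" for u
    using that weight_le[of f k u] by (auto simp: Suc_le_eq)
  ultimately show ?thesis using * consistent_iff_struct[OF class_invariant_weight] by blast
qed

text \<open>The swap is an involution that preserves domination, so it permutes the minimal
  dominating sets.\<close>

lemma struct_swap:
  assumes w: "struct w t" and uv: "u < n" "v < n" "interchangeable u v"
  shows "struct (w \<circ> transpose u v) t"
proof -
  have m: "min_dom (transpose u v ` D)" if "min_dom D" for D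
  proof -
    have "\<not> dom (transpose u v ` D - {x})" if x: "x \<in> transpose u v ` D" for x
    proof
      assume "dom (transpose u v ` D - {x})"
      then have "dom (transpose u v ` (transpose u v ` D - {x}))"
        using uv by (simp add: interchangeable_def)
      moreover have "transpose u v ` (transpose u v ` D - {x}) = D - {transpose u v x}"
        by (simp add: image_set_diff image_image)
      moreover have "transpose u v x \<in> D" using x by auto
      ultimately show False using \<open>min_dom D\<close> by (simp add: min_dom_iff)
    qed
    then show ?thesis using \<open>min_dom D\<close> uv by (simp add: min_dom_iff interchangeable_def)
  qed
  have image: "min_dom (transpose u v ` D) \<longleftrightarrow> min_dom D" for D
    using m[of D] m[of "transpose u v ` D"] by (auto simp: image_image)
  have sum: "sum (w \<circ> transpose u v) D = sum w (transpose u v ` D)" for D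
    by (simp add: sum.reindex)
  have "min_dom D \<longleftrightarrow> sum (w \<circ> transpose u v) D = t" if "D \<subseteq> {..<n}" for D
    using w transpose_closed[OF uv(1,2) that] image[of D] sum[of D] by (simp add: struct_def)
  moreover have "1 \<le> (w \<circ> transpose u v) x" if "x < n" for x
    using w uv(1,2) that by (auto simp: struct_def transpose_def)
  ultimately show ?thesis using w by (simp add: struct_def)
qed

text \<open>A rearrangement argument: among the structures with this target and this bound on the
  weights, take one that maximises the sum of \<open>u * w u\<close>. Swapping a decreasing pair of
  interchangeable vertices would increase the sum.\<close>

lemma ex_sorted_struct:
  assumes "struct w t" "\<forall>u<n. w u \<le> k"
  shows "\<exists>w. struct w t \<and> (\<forall>u<n. w u \<le> k) \<and>
    (\<forall>u<n. \<forall>v<n. u < v \<longrightarrow> interchangeable u v \<longrightarrow> w u \<le> w v)"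
proof -
  let ?P = "\<lambda>w. struct w t \<and> (\<forall>u<n. w u \<le> k)" and ?m = "\<lambda>w. \<Sum>u<n. u * w u"
  have "\<forall>w. ?P w \<longrightarrow> ?m w < Suc (\<Sum>u<n. u * k)"
    by (auto simp: less_Suc_eq_le intro!: sum_mono)
  moreover have "?P w" using assms by blast
  ultimately have "\<exists>w. ?P w \<and> (\<forall>w'. ?P w' \<longrightarrow> ?m w' \<le> ?m w)"
    by (intro ex_has_greatest_nat[where f = ?m])
  then obtain w where w: "?P w" and max: "\<And>w'. ?P w' \<Longrightarrow> ?m w' \<le> ?m w" by blast
  have "w u \<le> w v" if uv: "u < n" "v < n" "u < v" "interchangeable u v" for u v
  proof (rule ccontr)
    assume gt: "\<not> w u \<le> w v"
    let ?w = "w \<circ> transpose u v"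
    have "struct ?w t" using struct_swap[of w t u v] w uv by blast
    moreover have "\<forall>x<n. ?w x \<le> k" using w uv(1,2) by (simp add: transpose_def)
    ultimately have "?P ?w" by blast
    then have "?m ?w \<le> ?m w" by (rule max)
    moreover have split: "?m w' = u * w' u + (v * w' v + (\<Sum>x\<in>{..<n} - {u} - {v}. x * w' x))" for w'
      using uv by (subst sum.remove[of _ u], simp, simp, subst sum.remove[of _ v]) auto
    moreover have "(\<Sum>x\<in>{..<n} - {u} - {v}. x * ?w x) = (\<Sum>x\<in>{..<n} - {u} - {v}. x * w x)"
      by (rule sum.cong) auto
    ultimately have "u * w v + v * w u \<le> u * w u + v * w v" by simp
    \<comment> \<open>With these substitutions the inequality reduces to
      \<open>Suc a * Suc b \<le> 0\<close>.\<close>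
    moreover obtain a b where "v = u + Suc a" "w u = w v + Suc b"
      using uv gt by (metis less_iff_Suc_add add_Suc_right not_le)
    ultimately show False by (simp add: algebra_simps)
  qed
  then show ?thesis using w by blast
qed

text \<open>\<open>weight\<close> gives \<open>u\<close> the largest weight whose starting point
  lies in the class of \<open>u\<close> and not after \<open>u\<close>; for sorted weights this is
  \<open>w u\<close>.\<close>

lemma sorted_struct_weight:
  assumes w: "struct w t" "\<forall>u<n. w u \<le> k"
    and sorted: "\<forall>u<n. \<forall>v<n. u < v \<longrightarrow> interchangeable u v \<longrightarrow> w u \<le> w v"
  shows "\<exists>f. (\<forall>j<k. f j \<le> n) \<and> (\<forall>u<n. weight f k u = w u)"
proof -
  \<comment> \<open>The default \<open>n\<close> exceeds every vertex, so a weight that does not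
    occur is never handed out.\<close>
  define f where "f j = (if \<exists>u<n. w u = Suc j then LEAST u. u < n \<and> w u = Suc j else n)" for j
  have f: "f j < n \<and> w (f j) = Suc j" if "u < n" "w u = Suc j" for u j
    using LeastI[of "\<lambda>u. u < n \<and> w u = Suc j" u] that by (auto simp: f_def)
  have f_le: "f j \<le> u" if "u < n" "w u = Suc j" for u j
    using Least_le[of "\<lambda>u. u < n \<and> w u = Suc j" u] that by (auto simp: f_def)
  have f_w: "w (f j) = Suc j" if "f j < n" for j
  proof -
    have "\<exists>u<n. w u = Suc j" using that by (auto simp: f_def split: if_splits)
    then show ?thesis using f by blast
  qed
  have f_bound: "f j \<le> n" for j
  proof (cases "\<exists>u<n. w u = Suc j")
    case True
    then show ?thesis using f by (meson less_imp_le)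
  next
    case False
    then show ?thesis by (simp only: f_def if_False order_refl)
  qed
  \<comment> \<open>Phrased so that it is trivially true until weight \<open>w u\<close> has been
    considered; from then on it says that later weights do not overwrite it.\<close>
  have weight: "weight f i u = (if w u \<le> i then w u else weight f i u)" if u: "u < n" for i u
  proof (induction i)
    case 0 then show ?case by simp
  next
    case (Suc i)
    consider "w u \<le> i" | "w u = Suc i" | "w u > Suc i" by linarith
    then show ?case
    proof cases
      case 1
      \<comment> \<open>Otherwise \<open>f i\<close>, of weight \<open>i + 1 > w u\<close>, would
        precede or equal \<open>u\<close> in the same class, against sortedness.\<close>
      have "\<not> (f i \<le> u \<and> interchangeable u (f i))"
      proof
        assume *: "f i \<le> u \<and> interchangeable u (f i)"
        then have fi: "f i < n" "interchangeable (f i) u" using u interchangeable_sym by auto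
        then have "w (f i) \<le> w u" using sorted u * by (cases "f i = u") auto
        then show False using f_w[OF fi(1)] 1 by simp
      qed
      then show ?thesis using Suc 1 by simp
    next
      case 2
      have "interchangeable u (f i)"
        using f[OF u 2] struct_interchangeable[OF w(1) u, of "f i"] 2 by simp
      then show ?thesis using 2 f_le[OF u 2] by simp
    qed simp
  qed
  have "weight f k u = w u" if "u < n" for u
    using weight[OF that, of k] w(2) that by simp
  then show ?thesis using f_bound by blast
qed

section \<open>A greedy maximal independent set, the target and completeness\<close>

function greedy :: "nat \<Rightarrow> bool" where
  "greedy v \<longleftrightarrow> (\<forall>u<v. greedy u \<longrightarrow> \<not> adj u v)"
  by auto
termination by (relation "measure id") auto

declare greedy.simps [simp del]

definition target :: "(nat \<Rightarrow> nat) \<Rightarrow> nat" where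
  "target w = (\<Sum>u<n. if greedy u then w u else 0)"

text \<open>A maximal independent set is minimal dominating: maximality gives domination, and by
  independence each member is the only one to dominate itself. Its weight is thus forced to be the
  target.\<close>

lemma min_dom_greedy: "min_dom {u. u < n \<and> greedy u}"
proof -
  have "\<exists>u. u < n \<and> greedy u \<and> adj x u" if "x < n" for x
    using that adj_refl[of x] greedy.simps[of x] adj_sym by (metis less_trans)
  moreover have "u = v" if "greedy u" "greedy v" "adj u v" for u v
    using that greedy.simps[of u] greedy.simps[of v] adj_sym by (metis nat_neq_iff)
  ultimately show ?thesis by (auto simp: min_dom_iff dom_def)
qed

lemma struct_target: "struct w t \<Longrightarrow> t = target w"
proof -
  assume "struct w t"
  then have "\<forall>D\<subseteq>{..<n}. min_dom D \<longleftrightarrow> sum w D = t" by (simp add: struct_def)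
  moreover have "{u. u < n \<and> greedy u} \<subseteq> {..<n}" by auto
  ultimately have "sum w {u. u < n \<and> greedy u} = t" using min_dom_greedy by metis
  moreover have "sum w {u. u < n \<and> greedy u} = target w"
    unfolding target_def by (subst sum.inter_filter[symmetric]) (auto intro!: sum.cong)
  ultimately show ?thesis by simp
qed

lemma struct_cong:
  assumes "\<And>u. u < n \<Longrightarrow> w u = w' u" "struct w t"
  shows "struct w' t"
proof -
  have "sum w D = sum w' D" if "D \<subseteq> {..<n}" for D
    using that assms by (auto intro: sum.cong)
  then show ?thesis using assms by (simp add: struct_def)
qed

definition passes :: "nat \<Rightarrow> (nat \<Rightarrow> nat) \<Rightarrow> bool" where
  "passes k f \<longleftrightarrow> consistent k (weight f k) (target (weight f k))"

text \<open>Completeness of the search. Sorting moves weights between interchangeable vertices and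
  so keeps the target, which the question about a prescribed target relies on.\<close>

lemma struct_imp_passes:
  assumes "struct w t" "\<forall>u<n. w u \<le> k"
  shows "\<exists>f. (\<forall>j<k. f j \<le> n) \<and> passes k f \<and> target (weight f k) = t"
proof -
  obtain w where w: "struct w t" "\<forall>u<n. w u \<le> k"
      "\<forall>u<n. \<forall>v<n. u < v \<longrightarrow> interchangeable u v \<longrightarrow> w u \<le> w v"
    using ex_sorted_struct[OF assms] by blast
  then obtain f where f: "\<forall>j<k. f j \<le> n" "\<forall>u<n. weight f k u = w u"
    using sorted_struct_weight[OF w] by blast
  have s: "struct (weight f k) t" by (rule struct_cong[OF _ w(1)]) (simp add: f(2))
  then have "\<forall>u<n. weight f k u \<noteq> 0" by (simp add: struct_def Suc_le_eq)
  moreover from this have "weight f k u \<in> {1..k}" if "u < n" for u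
    using that weight_le[of f k u] by (auto simp: Suc_le_eq)
  ultimately have "consistent k (weight f k) t"
    using s consistent_iff_struct[OF class_invariant_weight] by blast
  moreover have "t = target (weight f k)" using s by (rule struct_target)
  ultimately show ?thesis using f(1) unfolding passes_def by blast
qed

text \<open>The vertex \<open>v\<close> together with its non-neighbours is a dominating set in
  which \<open>v\<close> is dominated by itself alone. Hence \<open>v\<close> belongs to every
  minimal dominating subset.\<close>

lemma struct_weight_le:
  assumes "struct w t" "v < n"
  shows "w v \<le> t"
proof -
  let ?D = "insert v {u. u < n \<and> \<not> adj v u}"
  have "\<exists>u\<in>?D. adj x u" if x: "x < n" for x
    using adj_sym[of v x] adj_refl[OF x] x by (cases "adj v x") blast+
  moreover have "?D \<subseteq> {..<n}" using assms(2) by auto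
  ultimately have "dom ?D" by (simp only: dom_def) blast
  then obtain D where D: "D \<subseteq> ?D" "min_dom D" by (rule dom_contains_min_dom)
  have dom: "D \<subseteq> {..<n}" "\<forall>x<n. \<exists>u\<in>D. adj x u" using D(2) by (simp_all add: min_dom_def dom_def)
  then obtain u where "u \<in> D" "adj v u" using assms(2) by blast
  then have "v \<in> D" using D(1) by blast
  then have "w v \<le> sum w D" using dom(1) by (intro member_le_sum) (auto intro: finite_subset)
  then show ?thesis using assms(1) D(2) dom(1) by (simp add: struct_def)
qed

end

section \<open>Enumerating a box of vectors\<close>

definition boxsize :: "(nat \<Rightarrow> nat) \<Rightarrow> nat \<Rightarrow> nat" where
  "boxsize b k = (\<Prod>i<k. b i + 1)"

text \<open>The number whose digit \<open>i\<close> has base \<open>b i + 1\<close>, least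
  significant digit at index 0. It serves as the round number of the loop through the box.\<close>

definition mixed_radix :: "(nat \<Rightarrow> nat) \<Rightarrow> nat \<Rightarrow> (nat \<Rightarrow> nat) \<Rightarrow> nat" where
  "mixed_radix b k x = (\<Sum>i<k. x i * boxsize b i)"

lemma boxsize_simps [simp]: "boxsize b 0 = 1" "boxsize b (Suc k) = (b k + 1) * boxsize b k"
  by (simp_all add: boxsize_def)

lemma mixed_radix_simps [simp]:
  "mixed_radix b 0 x = 0" "mixed_radix b (Suc k) x = mixed_radix b k x + x k * boxsize b k"
  by (simp_all add: mixed_radix_def)

lemma mixed_radix_cong: "(\<And>i. i < k \<Longrightarrow> x i = y i) \<Longrightarrow> mixed_radix b k x = mixed_radix b k y"
  by (simp add: mixed_radix_def)

lemma mixed_radix_less: "\<forall>i<k. x i \<le> b i \<Longrightarrow> mixed_radix b k x < boxsize b k"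
proof (induction k)
  case (Suc k)
  then have "mixed_radix b k x < boxsize b k" "x k * boxsize b k \<le> b k * boxsize b k"
    by (auto intro: mult_right_mono)
  then show ?case by (simp only: mixed_radix_simps boxsize_simps distrib_right)
qed simp

lemma mixed_radix_inj:
  "\<forall>i<k. x i \<le> b i \<Longrightarrow> \<forall>i<k. y i \<le> b i \<Longrightarrow> mixed_radix b k x = mixed_radix b k y \<Longrightarrow>
   \<forall>i<k. x i = y i"
proof (induction k)
  case (Suc k)
  have "mixed_radix b k x < boxsize b k" "mixed_radix b k y < boxsize b k"
    using Suc.prems by (auto intro: mixed_radix_less)
  then have eq: "x k = y k \<and> mixed_radix b k x = mixed_radix b k y"
    using index_inj[of "x k" "boxsize b k" "mixed_radix b k x" "y k" "mixed_radix b k y"] Suc.prems(3)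
    by simp
  moreover have "\<forall>i<k. x i \<le> b i" "\<forall>i<k. y i \<le> b i" using Suc.prems by simp_all
  ultimately have "\<forall>i<k. x i = y i" using Suc.IH by blast
  then show ?case using eq by (metis less_Suc_eq)
qed simp

text \<open>An odometer. Register \<open>c\<close> is the carry, initially 1; a digit below its
  bound absorbs it and a full digit is reset. A carry that is left over signals that the box is
  exhausted.\<close>

definition Increment :: "nat \<Rightarrow> nat \<Rightarrow> nat \<Rightarrow> aexp \<Rightarrow> com" where
  "Increment a i c e = Seq (Assign c (Const 1)) (For i (Reg 0)
     (If (Reg c)
       (If (Sub e (Read a (Reg i)))
         (Seq (Write a (Reg i) (Add (Read a (Reg i)) (Const 1))) (Assign c (Const 0)))
         (Write a (Reg i) (Const 0)))
       Skip))"

lemma written_Increment [simp]: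
  "wregs (Increment a i c e) = {i, c}" "warrs (Increment a i c e) = {a}"
  by (auto simp: Increment_def)

lemma runs_Increment:
  assumes ic: "i \<noteq> c" "i \<noteq> 0" "c \<noteq> 0" and k: "reg s 0 = k"
    and e: "\<And>s' j. same {i, c} {a} s s' \<Longrightarrow> reg s' i = j \<Longrightarrow> j < k \<Longrightarrow> aval e s' = b j"
    and cost: "acost e \<le> 5"
    and box: "\<forall>j<k. arr s a j \<le> b j"
  shows "runs (Increment a i c e) s ((k + 1) * 60)
    (\<lambda>s'. (\<forall>j<k. arr s' a j \<le> b j) \<and> reg s' c \<le> 1 \<and>
       mixed_radix b k (arr s' a) + reg s' c * boxsize b k = mixed_radix b k (arr s a) + 1)"
proof -
  let ?body = "If (Reg c)
       (If (Sub e (Read a (Reg i)))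
         (Seq (Write a (Reg i) (Add (Read a (Reg i)) (Const 1))) (Assign c (Const 0)))
         (Write a (Reg i) (Const 0)))
       Skip"
  \<comment> \<open>The processed digits and the carry, worth \<open>boxsize b j\<close>, together
    represent the old number plus one.\<close>
  let ?I = "\<lambda>j s'. (\<forall>j<k. arr s' a j \<le> b j) \<and> (\<forall>i\<ge>j. arr s' a i = arr s a i) \<and> reg s' c \<le> 1 \<and>
       mixed_radix b j (arr s' a) + reg s' c * boxsize b j = mixed_radix b j (arr s a) + 1"
  have "runs (Increment a i c e) s (2 + (k + 1) * (30 + 12)) (?I k)"
    unfolding Increment_def
  proof (rule runs_Seq)
    show "runs (Assign c (Const 1)) s 2 (\<lambda>s'. reg s' c = 1)"
      by (rule runs_Assign) simp_all
  next
    fix s1 assume c1: "reg s1 c = 1"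
      and s1: "same (wregs (Assign c (Const 1))) (warrs (Assign c (Const 1))) s s1"
    show "runs (For i (Reg 0) ?body) s1 ((k + 1) * (30 + 12)) (?I k)"
    proof (rule runs_For[where I = ?I])
      show "?I 0 (s1\<lparr>reg := (reg s1)(i := 0)\<rparr>)"
        using s1 c1 box ic by (simp add: same_def)
      show "aval (Reg 0) s' = k" if "same (insert i (wregs ?body)) (warrs ?body) s1 s'" for s'
        using that s1 ic k by (simp add: same_def)
      fix j s'
      assume j: "j < k" "reg s' i = j" and I: "?I j s'"
        and s': "same (insert i (wregs ?body)) (warrs ?body) s1 s'"
      have ev: "aval e s' = b j"
        using e[of s' j] j s1 s' by (auto simp: same_def)
      let ?x = "arr s a" and ?y = "arr s' a"
      have yj: "?y j = ?x j" "?x j \<le> b j" using I box j by auto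
      have cong: "mixed_radix b j (?y(j := z)) = mixed_radix b j ?y" for z
        by (rule mixed_radix_cong) simp
      consider "reg s' c = 0" | "reg s' c = 1" "?y j < b j" | "reg s' c = 1" "?y j = b j"
        using I yj by linarith
      then have "runs ?body s' (1 + acost (Reg c) + (10 + (1 + acost (Sub e (Read a (Reg i))))))
          (\<lambda>s''. ?I (Suc j) (s''\<lparr>reg := (reg s'')(i := Suc j)\<rparr>))"
      proof cases
        case 1
        then show ?thesis
          using I ic yj by (intro runs_If) (auto intro!: runs_Skip)
      next
        case 2
        have "runs (Seq (Write a (Reg i) (Add (Read a (Reg i)) (Const 1))) (Assign c (Const 0))) s' (8 + 2)
          (\<lambda>s''. ?I (Suc j) (s''\<lparr>reg := (reg s'')(i := Suc j)\<rparr>))"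
        proof (rule runs_Seq)
          show "runs (Write a (Reg i) (Add (Read a (Reg i)) (Const 1))) s' 8
             (\<lambda>s''. arr s'' a = ?y(j := ?y j + 1))"
            using j by (intro runs_Write) simp_all
        next
          fix s2 :: state assume "arr s2 a = ?y(j := ?y j + 1)"
          then show "runs (Assign c (Const 0)) s2 2
             (\<lambda>s''. ?I (Suc j) (s''\<lparr>reg := (reg s'')(i := Suc j)\<rparr>))"
            using I 2 yj ic cong[of "?y j + 1"]
            by (intro runs_Assign) (auto simp: algebra_simps)
        qed
        then show ?thesis
          using 2 j ev by (intro runs_If) (auto intro: runs_conseq[OF runs_If])
      next
        case 3
        have "runs (Write a (Reg i) (Const 0)) s' 10
          (\<lambda>s''. ?I (Suc j) (s''\<lparr>reg := (reg s'')(i := Suc j)\<rparr>))"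
          using I 3 yj ic cong[of 0] j
          by (intro runs_Write) (auto simp: algebra_simps)
        then show ?thesis
          using 3 j ev by (intro runs_If) (auto intro: runs_conseq[OF runs_If])
      qed
      then show "runs ?body s' 30 (\<lambda>s''. ?I (Suc j) (s''\<lparr>reg := (reg s'')(i := Suc j)\<rparr>))"
        using cost by (rule_tac runs_conseq) auto
    qed (use ic in auto)
  qed
  then show ?thesis by (rule runs_conseq) auto
qed

definition Box :: "nat \<Rightarrow> nat \<Rightarrow> nat \<Rightarrow> aexp \<Rightarrow> com \<Rightarrow> com" where
  "Box a i c e body = Seq (Assign c (Const 0))
     (While (Sub (Const 1) (Reg c)) (Seq body (Increment a i c e)))"

lemma written_Box [simp]:
  "wregs (Box a i c e body) = insert i (insert c (wregs body))"
  "warrs (Box a i c e body) = insert a (warrs body)"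
  by (auto simp: Box_def)

text \<open>The invariant is indexed by the set of vectors visited so far. Vectors are total
  functions of which only \<open>k\<close> values count, so a round adds all functions agreeing with
  the array there. \<open>stable\<close> lets the invariant survive the odometer.\<close>

lemma runs_Box:
  fixes I :: "(nat \<Rightarrow> nat) set \<Rightarrow> state \<Rightarrow> bool"
  assumes ic: "i \<noteq> c" "i \<noteq> 0" "c \<noteq> 0" "0 \<notin> wregs body" "c \<notin> wregs body" "a \<notin> warrs body"
    and k: "reg s 0 = k"
    and e: "\<And>s' j. same (insert i (insert c (wregs body))) (insert a (warrs body)) s s' \<Longrightarrow>
      reg s' i = j \<Longrightarrow> j < k \<Longrightarrow> aval e s' = b j"
    and cost: "acost e \<le> 5"
    and zero: "\<forall>j<k. arr s a j = 0"
    and init: "I {} s"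
    and stable: "\<And>S s1 s2. I S s1 \<Longrightarrow> same {i, c} {a} s1 s2 \<Longrightarrow> I S s2"
    and step: "\<And>S s'. same (insert i (insert c (wregs body))) (insert a (warrs body)) s s' \<Longrightarrow>
      \<forall>j<k. arr s' a j \<le> b j \<Longrightarrow> I S s' \<Longrightarrow>
      runs body s' B (I (S \<union> {y. \<forall>j<k. y j = arr s' a j}))"
  shows "runs (Box a i c e body) s (boxsize b k * (B + (k + 1) * 80)) (I {y. \<forall>j<k. y j \<le> b j})"
proof -
  let ?R = "insert i (insert c (wregs body))" and ?A = "insert a (warrs body)"
  let ?P = "boxsize b k" and ?v = "mixed_radix b k"
  let ?S = "\<lambda>m. {y. (\<forall>j<k. y j \<le> b j) \<and> ?v y < m}"
  let ?J = "\<lambda>m s'. same ?R ?A s s' \<and> (\<forall>j<k. arr s' a j \<le> b j) \<and> I (?S m) s' \<and>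
     (if m < ?P then reg s' c = 0 \<and> ?v (arr s' a) = m else reg s' c = 1)"
  have P: "?P > 0" unfolding boxsize_def by (intro prod_pos) simp
  have "runs (Box a i c e body) s
      (2 + ((?P - 0) * (B + (k + 1) * 60 + 1 + acost (Sub (Const 1) (Reg c))) + 1
        + acost (Sub (Const 1) (Reg c)))) (?J ?P)"
    unfolding Box_def
  proof (rule runs_Seq)
    have "I {} (s\<lparr>reg := (reg s)(c := 0)\<rparr>)"
      using init by (rule stable) (simp add: same_def)
    moreover have "?v (arr s a) = 0" using zero by (simp add: mixed_radix_def)
    ultimately show "runs (Assign c (Const 0)) s 2 (?J 0)"
      using zero P by (intro runs_Assign) (auto simp: same_def)
  next
    fix s1 assume "?J 0 s1"
    then show "runs (While (Sub (Const 1) (Reg c)) (Seq body (Increment a i c e))) s1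
     ((?P - 0) * (B + (k + 1) * 60 + 1 + acost (Sub (Const 1) (Reg c))) + 1
        + acost (Sub (Const 1) (Reg c))) (?J ?P)"
    proof (rule runs_While[where I = ?J, rotated 2])
      fix m s2 assume m: "m < ?P" and J: "?J m s2"
      have "runs (Seq body (Increment a i c e)) s2 (B + (k + 1) * 60) (?J (Suc m))"
      proof (rule runs_Seq)
        show "runs body s2 B (I (?S m \<union> {y. \<forall>j<k. y j = arr s2 a j}))"
          using J by (intro step) auto
      next
        fix s3 assume I3: "I (?S m \<union> {y. \<forall>j<k. y j = arr s2 a j}) s3"
          and s3: "same (wregs body) (warrs body) s2 s3"
        have a3: "arr s3 a = arr s2 a" using s3 ic by (simp add: same_def)
        have s3': "same ?R ?A s s3" using J s3 by (auto simp: same_def)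
        \<comment> \<open>\<open>mixed_radix\<close> is injective on the box, so round
          \<open>m\<close> adds exactly the vectors numbered \<open>m\<close>.\<close>
        have S: "?S m \<union> {y. \<forall>j<k. y j = arr s2 a j} = ?S (Suc m)"
        proof (rule set_eqI)
          fix y
          have "(\<forall>j<k. y j \<le> b j) \<and> ?v y = m \<longleftrightarrow> (\<forall>j<k. y j = arr s2 a j)"
            using J m mixed_radix_inj[of k y b "arr s2 a"] mixed_radix_cong[of k y "arr s2 a" b]
            by auto
          then show "y \<in> ?S m \<union> {y. \<forall>j<k. y j = arr s2 a j} \<longleftrightarrow> y \<in> ?S (Suc m)"
            by (auto simp: less_Suc_eq)
        qed
        have "runs (Increment a i c e) s3 ((k + 1) * 60)
          (\<lambda>s'. (\<forall>j<k. arr s' a j \<le> b j) \<and> reg s' c \<le> 1 \<and>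
           ?v (arr s' a) + reg s' c * ?P = ?v (arr s3 a) + 1)"
        proof (rule runs_Increment)
          show "reg s3 0 = k" using s3' ic k by (simp add: same_def)
          fix s' j assume "same {i, c} {a} s3 s'" "reg s' i = j" "j < k"
          then show "aval e s' = b j" using s3' by (intro e) (auto simp: same_def)
        qed (use ic cost J a3 in auto)
        then show "runs (Increment a i c e) s3 ((k + 1) * 60) (?J (Suc m))"
        proof (rule runs_conseq)
          fix s4
          assume 4: "(\<forall>j<k. arr s4 a j \<le> b j) \<and> reg s4 c \<le> 1 \<and>
              ?v (arr s4 a) + reg s4 c * ?P = ?v (arr s3 a) + 1"
            and "same (wregs (Increment a i c e)) (warrs (Increment a i c e)) s3 s4"
          then have s4: "same {i, c} {a} s3 s4" by simp
          have v3: "?v (arr s3 a) = m" using J m a3 by simp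
          have v4: "?v (arr s4 a) < ?P" using 4 by (intro mixed_radix_less) simp
          \<comment> \<open>A leftover carry contributes \<open>?P\<close>, whereas the new total is
            \<open>m + 1 \<le> ?P\<close>; so it occurs in the last round only.\<close>
          have "if Suc m < ?P then reg s4 c = 0 \<and> ?v (arr s4 a) = Suc m else reg s4 c = 1"
          proof (cases "reg s4 c = 0")
            case True
            then show ?thesis using 4 v3 v4 by simp
          next
            case False
            then have "reg s4 c = 1" using 4 by simp
            then show ?thesis using 4 v3 m by simp
          qed
          moreover have "I (?S (Suc m)) s4" using stable[OF I3 s4] S by simp
          moreover have "same ?R ?A s s4" using s3' s4 by (auto simp: same_def)
          ultimately show "?J (Suc m) s4" using 4 by blast
        qed simp
      qed
      then show "aval (Sub (Const 1) (Reg c)) s2 \<noteq> 0 \<and>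
         runs (Seq body (Increment a i c e)) s2 (B + (k + 1) * 60) (?J (Suc m))"
        using J m by simp
    qed auto
  qed
  then show ?thesis
  proof (rule runs_conseq)
    have "1 * 1 \<le> ?P * (k + 1)" by (rule mult_le_mono) (use P in auto)
    moreover have "?P \<le> ?P * (k + 1)" by simp
    ultimately show "2 + ((?P - 0) * (B + (k + 1) * 60 + 1 + acost (Sub (Const 1) (Reg c))) + 1
        + acost (Sub (Const 1) (Reg c))) \<le> ?P * (B + (k + 1) * 80)"
      by (simp add: algebra_simps)
    have "?S ?P = {y. \<forall>j<k. y j \<le> b j}" using mixed_radix_less by blast
    then show "I {y. \<forall>j<k. y j \<le> b j} s'" if "?J ?P s'" for s'
      using that by simp
  qed
qed

section \<open>The program\<close>

definition Eq :: "aexp \<Rightarrow> aexp \<Rightarrow> aexp" where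
  "Eq a b = Sub (Const 1) (Add (Sub a b) (Sub b a))"

text \<open>Conjunction, provided that both values are 0 or 1.\<close>

definition And :: "aexp \<Rightarrow> aexp \<Rightarrow> aexp" where
  "And a b = Sub (Add a b) (Const 1)"

definition Entry :: "nat \<Rightarrow> aexp \<Rightarrow> aexp \<Rightarrow> aexp" where
  "Entry a i j = Read a (Add (Read 2 i) j)"

lemma aval_Eq [simp]: "aval (Eq a b) s = of_bool (aval a s = aval b s)"
  by (simp add: Eq_def)

lemma aval_And [simp]: "aval (And a b) s = aval a s + aval b s - 1"
  by (simp add: And_def)

lemma aval_Entry [simp]: "aval (Entry a i j) s = arr s a (arr s 2 (aval i s) + aval j s)"
  by (simp add: Entry_def)

lemma acost_macros [simp]:
  "acost (Eq a b) = 5 + 2 * acost a + 2 * acost b"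
  "acost (And a b) = 3 + acost a + acost b"
  "acost (Entry c i j) = 3 + acost i + acost j"
  by (simp_all add: Eq_def And_def Entry_def)

text \<open>Registers 0, 1, 2 hold \<open>k\<close>, \<open>n\<close>, \<open>m\<close>.  Matrices are stored row by row with rows of length
  \<open>n\<close>; array 2 holds the multiples of \<open>n\<close>, since there is no multiplication.  Arrays 3, 5, 6 hold
  the closed adjacency matrix, the matrix of \<open>exchange\<close> and the set \<open>greedy\<close>.\<close>

definition multiples_prog :: com where
  "multiples_prog = Tab 2 3 (Add (Add (Reg 0) (Reg 1)) (Const 1))
     (Sum 4 5 (Reg 3) Skip (Reg 1)) (Reg 4)"

text \<open>The sum counts the list entries joining the two vertices in either order. The value
  \<open>1 - ((1 - p) - q)\<close> is the disjunction of \<open>p\<close> and \<open>q\<close> for a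
  truth value \<open>p\<close> and a count \<open>q\<close>.\<close>

definition adj_prog :: com where
  "adj_prog = Tab2 3 3 4 (Reg 1) (Reg 1)
     (Sum 5 6 (Reg 2) Skip
       (Add (And (Eq (Read 0 (Reg 6)) (Reg 3)) (Eq (Read 1 (Reg 6)) (Reg 4)))
            (And (Eq (Read 0 (Reg 6)) (Reg 4)) (Eq (Read 1 (Reg 6)) (Reg 3)))))
     (Sub (Const 1) (Sub (Sub (Const 1) (Eq (Reg 3) (Reg 4))) (Reg 5)))"

text \<open>Array 4 holds the sizes of the differences N[y] - N[x] of closed neighbourhoods. They
  make the innermost condition of \<open>exchange\<close> testable in constant time, which keeps the
  preparation at order n^4.\<close>

definition diff_prog :: com where
  "diff_prog = Tab2 4 3 4 (Reg 1) (Reg 1)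
     (Sum 5 6 (Reg 1) Skip (Sub (Entry 3 (Reg 3) (Reg 6)) (Entry 3 (Reg 4) (Reg 6)))) (Reg 5)"

text \<open>The inner sum counts the witnesses \<open>y\<close>, the outer one the vertices
  \<open>x\<close> without a witness: subtracting the number of witnesses from 1 leaves 1 just when
  there are none.\<close>

definition exchange_prog :: com where
  "exchange_prog = Tab2 5 3 4 (Reg 1) (Reg 1)
     (Sum 5 6 (Reg 1)
       (Sum 7 8 (Reg 1) Skip
         (Sub (Sub (Const 1) (Entry 3 (Reg 8) (Reg 3)))
              (Sub (Entry 4 (Reg 8) (Reg 6)) (Entry 3 (Reg 8) (Reg 4)))))
       (Sub (Sub (Entry 3 (Reg 6) (Reg 3)) (Entry 3 (Reg 6) (Reg 4))) (Reg 7)))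
     (Sub (Const 1) (Reg 5))"

definition greedy_prog :: com where
  "greedy_prog = Tab 6 3 (Reg 1)
     (Sum 4 5 (Reg 3) Skip (And (Read 6 (Reg 5)) (Entry 3 (Reg 5) (Reg 3)))) (Sub (Const 1) (Reg 4))"

definition prep_prog :: com where
  "prep_prog = Seq multiples_prog (Seq adj_prog (Seq diff_prog (Seq exchange_prog greedy_prog)))"

text \<open>A candidate \<open>f\<close> in array 7 yields weights in array 8, the target in register 8, class sizes
  in array 9, and the numbers of neighbours of each weight in array 10.\<close>

definition weight_prog :: com where
  "weight_prog = Tab 8 3 (Reg 1)
     (Fold 4 5 (Reg 0)
       (If (Sub (Const 1) (Sub (Read 7 (Reg 5)) (Reg 3)))
         (If (And (Entry 5 (Reg 3) (Read 7 (Reg 5))) (Entry 5 (Read 7 (Reg 5)) (Reg 3)))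
           (Assign 6 (Add (Reg 5) (Const 1))) (Assign 6 (Reg 4)))
         (Assign 6 (Reg 4)))
       (Reg 6))
     (Reg 4)"

definition zeros_prog :: com where
  "zeros_prog = Sum 7 3 (Reg 1) Skip (Sub (Const 1) (Read 8 (Reg 3)))"

definition target_prog :: com where
  "target_prog = Sum 8 3 (Reg 1)
     (If (Read 6 (Reg 3)) (Assign 4 (Read 8 (Reg 3))) (Assign 4 (Const 0))) (Reg 4)"

definition sizes_prog :: com where
  "sizes_prog = Tab 9 3 (Reg 0)
     (Sum 4 5 (Reg 1) Skip (Eq (Read 8 (Reg 5)) (Add (Reg 3) (Const 1)))) (Reg 4)"

definition neighbours_prog :: com where
  "neighbours_prog = Tab2 10 3 4 (Reg 0) (Reg 1)
     (Sum 5 6 (Reg 1) Skip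
       (And (Eq (Read 8 (Reg 6)) (Add (Reg 3) (Const 1))) (Entry 3 (Reg 4) (Reg 6)))) (Reg 5)"

text \<open>Register 9 counts the reasons for rejecting the candidate.  The inner loop runs through the
  types \<open>d\<close>, in array 11.\<close>

definition Excess :: "nat \<Rightarrow> nat \<Rightarrow> aexp" where
  "Excess x j = Sub (Add (Entry 10 (Reg j) (Reg x)) (Read 11 (Reg j))) (Read 9 (Reg j))"

definition type_weight_prog :: com where
  "type_weight_prog = Sum 12 13 (Reg 0)
     (Sum 14 15 (Add (Reg 13) (Const 1)) Skip (Read 11 (Reg 13))) (Reg 14)"

definition hits_prog :: com where
  "hits_prog = Tab 12 13 (Reg 1) (Sum 14 15 (Reg 0) Skip (Excess 13 15)) (Reg 14)"

definition undominated_prog :: com where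
  "undominated_prog = Sum 16 13 (Reg 1) Skip (Sub (Const 1) (Read 12 (Reg 13)))"

text \<open>Register 17 counts the occurring weights of which a vertex can be spared. The value
  \<open>1 - (1 - d j)\<close> is the sign of \<open>d j\<close>, and the subtrahend is the number
  of vertices that would become undominated.\<close>

definition redundant_prog :: com where
  "redundant_prog = Sum 17 13 (Reg 0)
     (Sum 14 15 (Reg 1) Skip (And (Eq (Read 12 (Reg 15)) (Const 1)) (Eq (Excess 15 13) (Const 1))))
     (Sub (Sub (Const 1) (Sub (Const 1) (Read 11 (Reg 13)))) (Reg 14))"

definition compare_prog :: com where
  "compare_prog = If (Add (Reg 16) (Reg 17))
     (Assign 9 (Add (Reg 9) (Eq (Reg 12) (Reg 8))))
     (Assign 9 (Add (Reg 9) (Sub (Const 1) (Eq (Reg 12) (Reg 8)))))"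

definition type_prog :: com where
  "type_prog = Seq type_weight_prog (Seq hits_prog (Seq undominated_prog
     (Seq redundant_prog compare_prog)))"

text \<open>Register 9 starts with the faults that involve no vector: vertices of weight 0 and a
  target 0.\<close>

definition types_prog :: com where
  "types_prog = Seq (Tab 11 3 (Reg 0) Skip (Const 0))
     (Seq (Assign 9 (Add (Reg 7) (Sub (Const 1) (Reg 8))))
       (Box 11 10 11 (Read 9 (Reg 10)) type_prog))"

text \<open>Registers 0 and 1 still hold the parameters, so the answers wait in registers 18 to 20;
  array 0 is free once the adjacency matrix exists. A later success overwrites the recorded
  structure, but register 20 is never reset.\<close>

definition record_prog :: com where
  "record_prog = If (Reg 9) Skip
     (Seq (Assign 18 (Const 1))
       (Seq (Assign 19 (Reg 8))
         (Seq (If (Eq (Reg 8) (Reg 0)) (Assign 20 (Const 1)) Skip)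
           (Tab 0 3 (Reg 1) Skip (Read 8 (Reg 3))))))"

definition candidate_prog :: com where
  "candidate_prog = Seq weight_prog (Seq zeros_prog (Seq target_prog (Seq sizes_prog
     (Seq neighbours_prog (Seq types_prog record_prog)))))"

definition search_prog :: com where
  "search_prog = Seq (Tab 7 3 (Reg 0) Skip (Const 0)) (Box 7 21 22 (Reg 1) candidate_prog)"

definition equidom_prog :: com where
  "equidom_prog = Seq prep_prog (Seq search_prog
     (Seq (Assign 0 (Reg 18)) (Seq (Assign 1 (Reg 19)) (Assign 2 (Reg 20)))))"

lemmas prog_defs = multiples_prog_def adj_prog_def diff_prog_def exchange_prog_def greedy_prog_def
  weight_prog_def zeros_prog_def target_prog_def sizes_prog_def neighbours_prog_def
  type_weight_prog_def hits_prog_def undominated_prog_def redundant_prog_def compare_prog_def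
  record_prog_def

lemma written_prog [simp]:
  "wregs multiples_prog = {3, 4, 5}" "warrs multiples_prog = {2}"
  "wregs adj_prog = {3, 4, 5, 6}" "warrs adj_prog = {3}"
  "wregs diff_prog = {3, 4, 5, 6}" "warrs diff_prog = {4}"
  "wregs exchange_prog = {3, 4, 5, 6, 7, 8}" "warrs exchange_prog = {5}"
  "wregs greedy_prog = {3, 4, 5}" "warrs greedy_prog = {6}"
  "wregs weight_prog = {3, 4, 5, 6}" "warrs weight_prog = {8}"
  "wregs zeros_prog = {3, 7}" "warrs zeros_prog = {}"
  "wregs target_prog = {3, 4, 8}" "warrs target_prog = {}"
  "wregs sizes_prog = {3, 4, 5}" "warrs sizes_prog = {9}"
  "wregs neighbours_prog = {3, 4, 5, 6}" "warrs neighbours_prog = {10}"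
  "wregs type_weight_prog = {12, 13, 14, 15}" "warrs type_weight_prog = {}"
  "wregs hits_prog = {13, 14, 15}" "warrs hits_prog = {12}"
  "wregs undominated_prog = {13, 16}" "warrs undominated_prog = {}"
  "wregs redundant_prog = {13, 14, 15, 17}" "warrs redundant_prog = {}"
  "wregs compare_prog = {9}" "warrs compare_prog = {}"
  "wregs record_prog = {3, 18, 19, 20}" "warrs record_prog = {0}"
  by (auto simp: prog_defs)

lemma written_type_prog [simp]:
  "wregs type_prog = {9, 12, 13, 14, 15, 16, 17}" "warrs type_prog = {12}"
  by (auto simp: type_prog_def)

lemma written_types_prog [simp]:
  "wregs types_prog = {3, 9, 10, 11, 12, 13, 14, 15, 16, 17}" "warrs types_prog = {11, 12}"
  by (auto simp: types_prog_def)

lemma written_candidate_prog [simp]: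
  "wregs candidate_prog = {3, 4, 5, 6, 7, 8, 9, 10, 11, 12, 13, 14, 15, 16, 17, 18, 19, 20}" "warrs candidate_prog = {0, 8, 9, 10, 11, 12}"
  by (auto simp: candidate_prog_def)

lemma written_search_prog [simp]:
  "wregs search_prog = {3, 4, 5, 6, 7, 8, 9, 10, 11, 12, 13, 14, 15, 16, 17, 18, 19, 20, 21, 22}" "warrs search_prog = {0, 7, 8, 9, 10, 11, 12}"
  by (auto simp: search_prog_def)

section \<open>Correctness of the tables determined by the graph\<close>

lemma of_bool_and: "of_bool P + of_bool Q - 1 = (of_bool (P \<and> Q) :: nat)"
  by auto

lemma sum_of_bool: "(\<Sum>x<n. of_bool (P x)) = card {x. x < n \<and> P x}" for n :: nat
  by (simp add: Int_def)

lemma monus_of_bool: "S = 0 \<longleftrightarrow> P \<Longrightarrow> 1 - S = of_bool P" for S :: nat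
  by (cases P) auto

lemma sum_less_neq_0: "(\<Sum>x<n. g x) \<noteq> 0 \<longleftrightarrow> (\<exists>x<n. g x \<noteq> 0)" for n :: nat and g :: "nat \<Rightarrow> nat"
  by auto

text \<open>The range covers the square matrices, with \<open>n\<close> rows, and the matrix of
  neighbour counts, with \<open>k\<close> rows.\<close>

lemma runs_multiples_prog:
  assumes "reg s 0 = k" "reg s 1 = n"
  shows "runs multiples_prog s (161 * (k + n + 2)\<^sup>2) (\<lambda>s'. \<forall>u<k + n + 1. arr s' 2 u = u * n)"
proof -
  have "runs multiples_prog s ((k + n + 1 + 1) * ((k + n + 1) * 81 + 80))
    (\<lambda>s'. \<forall>u<k + n + 1. arr s' 2 u = u * n)"
    unfolding multiples_prog_def
  proof (rule runs_Tab)
    fix j s'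
    assume j: "j < k + n + 1" "reg s' 3 = j"
      and s': "same (insert 3 (wregs (Sum 4 5 (Reg 3) Skip (Reg 1))))
        (insert 2 (warrs (Sum 4 5 (Reg 3) Skip (Reg 1)))) s s'"
    have "runs (Sum 4 5 (Reg 3) Skip (Reg 1)) s' ((j + 1) * 81) (\<lambda>s''. reg s'' 4 = (\<Sum>i<j. n))"
      by (rule runs_Sum0) (use assms j s' in \<open>auto simp: same_def\<close>)
    then show "runs (Sum 4 5 (Reg 3) Skip (Reg 1)) s' ((k + n + 1) * 81) (\<lambda>s''. aval (Reg 4) s'' = j * n)"
      by (rule runs_conseq) (use j in auto)
  qed (use assms in \<open>auto simp: same_def\<close>)
  then show ?thesis
    by (rule runs_conseq) (auto simp: power2_eq_square algebra_simps)
qed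

context reflexive_graph
begin

definition adj_stored :: "nat \<Rightarrow> state \<Rightarrow> bool" where
  "adj_stored k s \<longleftrightarrow> reg s 0 = k \<and> reg s 1 = n \<and> (\<forall>u<k + n + 1. arr s 2 u = u * n) \<and>
     (\<forall>u<n. \<forall>v<n. arr s 3 (u * n + v) = of_bool (adj u v))"

definition prepared :: "nat \<Rightarrow> state \<Rightarrow> bool" where
  "prepared k s \<longleftrightarrow> adj_stored k s \<and>
     (\<forall>u<n. \<forall>v<n. arr s 5 (u * n + v) = of_bool (exchange u v)) \<and>
     (\<forall>u<n. arr s 6 u = of_bool (greedy u))"

lemma runs_diff_prog:
  assumes "adj_stored k s"
  shows "runs diff_prog s (171 * (n + 1) ^ 3)
    (\<lambda>s'. \<forall>y<n. \<forall>x<n. arr s' 4 (y * n + x) = card {z. z < n \<and> adj y z \<and> \<not> adj x z})"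
proof -
  have "runs diff_prog s ((n + 1) * ((n + 1) * ((n + 1) * 81 + 90)))
    (\<lambda>s'. \<forall>y<n. \<forall>x<n. arr s' 4 (y * n + x) = card {z. z < n \<and> adj y z \<and> \<not> adj x z})"
    unfolding diff_prog_def
  proof (rule runs_Tab2)
    let ?c = "Sum 5 6 (Reg 1) Skip (Sub (Entry 3 (Reg 3) (Reg 6)) (Entry 3 (Reg 4) (Reg 6)))"
    fix y x s'
    assume yx: "y < n" "x < n" "reg s' 3 = y" "reg s' 4 = x"
      and s': "same (insert 3 (insert 4 (wregs ?c))) (insert 4 (warrs ?c)) s s'"
    have "runs ?c s' ((n + 1) * 81)
      (\<lambda>s''. reg s'' 5 = (\<Sum>z<n. of_bool (adj y z) - of_bool (adj x z)))"
      by (rule runs_Sum0) (use assms yx s' in \<open>auto simp: same_def adj_stored_def\<close>)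
    moreover have "(\<Sum>z<n. of_bool (adj y z) - of_bool (adj x z)) =
        (\<Sum>z<n. of_bool (adj y z \<and> \<not> adj x z) :: nat)"
      by (rule sum.cong) auto
    then have "(\<Sum>z<n. of_bool (adj y z) - of_bool (adj x z)) = card {z. z < n \<and> adj y z \<and> \<not> adj x z}"
      by (simp only: sum_of_bool)
    ultimately show "runs ?c s' ((n + 1) * 81)
        (\<lambda>s''. aval (Reg 5) s'' = card {z. z < n \<and> adj y z \<and> \<not> adj x z})"
      by simp
  qed (use assms in \<open>auto simp: same_def adj_stored_def\<close>)
  then show ?thesis
    by (rule runs_conseq) (auto simp: power3_eq_cube algebra_simps)
qed

text \<open>As \<open>x\<close> is not adjacent to \<open>v\<close>, the difference of the
  neighbourhoods contains \<open>v\<close> exactly if \<open>y\<close> is adjacent to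
  \<open>v\<close>. So it has no further element exactly if its size is at most that truth
  value.\<close>

lemma card_diff_le_iff:
  assumes "v < n" "\<not> adj x v"
  shows "card {z. z < n \<and> adj y z \<and> \<not> adj x z} \<le> of_bool (adj y v) \<longleftrightarrow>
    (\<forall>z<n. adj y z \<longrightarrow> adj x z \<or> z = v)"
proof -
  let ?Z = "{z. z < n \<and> adj y z \<and> \<not> adj x z}"
  have fin: "finite ?Z" by simp
  show ?thesis
  proof (cases "adj y v")
    case True
    then have "v \<in> ?Z" using assms by simp
    then have "card ?Z \<le> 1 \<longleftrightarrow> (\<forall>z\<in>?Z. z = v)"
      using fin by (auto simp: card_le_Suc0_iff_eq)
    then show ?thesis using True by auto
  next
    case False
    then show ?thesis using fin by auto
  qed
qed

lemma runs_exchange_prog: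
  assumes "adj_stored k s"
    and "\<forall>y<n. \<forall>x<n. arr s 4 (y * n + x) = card {z. z < n \<and> adj y z \<and> \<not> adj x z}"
  shows "runs exchange_prog s (251 * (n + 1) ^ 4)
    (\<lambda>s'. \<forall>u<n. \<forall>v<n. arr s' 5 (u * n + v) = of_bool (exchange u v))"
proof -
  let ?d = "\<lambda>y x. card {z. z < n \<and> adj y z \<and> \<not> adj x z}"
  have "runs exchange_prog s ((n + 1) * ((n + 1) * ((n + 1) * ((n + 1) * 81 + 80) + 90)))
    (\<lambda>s'. \<forall>u<n. \<forall>v<n. arr s' 5 (u * n + v) = of_bool (exchange u v))"
    unfolding exchange_prog_def
  proof (rule runs_Tab2)
    let ?c1 = "Sum 7 8 (Reg 1) Skip
         (Sub (Sub (Const 1) (Entry 3 (Reg 8) (Reg 3)))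
              (Sub (Entry 4 (Reg 8) (Reg 6)) (Entry 3 (Reg 8) (Reg 4))))"
    let ?c = "Sum 5 6 (Reg 1) ?c1
       (Sub (Sub (Entry 3 (Reg 6) (Reg 3)) (Entry 3 (Reg 6) (Reg 4))) (Reg 7))"
    fix u v s'
    assume uv: "u < n" "v < n" "reg s' 3 = u" "reg s' 4 = v"
      and s': "same (insert 3 (insert 4 (wregs ?c))) (insert 5 (warrs ?c)) s s'"
    \<comment> \<open>\<open>g x y\<close> is nonzero if \<open>y\<close> is a witness for
      \<open>x\<close>, and \<open>h x\<close> is nonzero if \<open>x\<close> violates
      \<open>exchange u v\<close>.\<close>
    define g where "g x y = (1 - of_bool (adj y u)) - (?d y x - of_bool (adj y v))" for x y
    define h where "h x = (of_bool (adj x u) - of_bool (adj x v)) - (\<Sum>y<n. g x y)" for x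
    have "runs ?c s' ((n + 1) * ((n + 1) * 81 + 80)) (\<lambda>s''. reg s'' 5 = (\<Sum>x<n. h x))"
    proof (rule runs_Sum)
      fix x s1
      assume x: "x < n" "reg s1 6 = x"
        and s1: "same (insert 5 (insert 6 (wregs ?c1))) (warrs ?c1) s' s1"
      have "runs ?c1 s1 ((n + 1) * 81) (\<lambda>s''. reg s'' 7 = (\<Sum>y<n. g x y))"
        by (rule runs_Sum0) (use assms uv s' x s1 in \<open>auto simp: same_def adj_stored_def g_def\<close>)
      then show "runs ?c1 s1 ((n + 1) * 81)
        (\<lambda>s''. aval (Sub (Sub (Entry 3 (Reg 6) (Reg 3)) (Entry 3 (Reg 6) (Reg 4))) (Reg 7)) s'' = h x)"
        by (rule runs_conseq) (use assms uv s' x s1 in \<open>auto simp: same_def adj_stored_def h_def\<close>)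
    qed (use assms s' in \<open>auto simp: same_def adj_stored_def\<close>)
    moreover have "(1 - (\<Sum>x<n. h x)) = of_bool (exchange u v)"
    proof -
      have "(1 - of_bool P) - (c - b) \<noteq> 0 \<longleftrightarrow> \<not> P \<and> c \<le> b" for P and c b :: nat
        by (cases P) auto
      then have g: "g x y \<noteq> 0 \<longleftrightarrow> \<not> adj y u \<and> ?d y x \<le> of_bool (adj y v)" for x y
        unfolding g_def .
      have "h x = 0 \<longleftrightarrow> (adj x u \<and> \<not> adj x v \<longrightarrow>
         (\<exists>y<n. \<not> adj y u \<and> (\<forall>z<n. adj y z \<longrightarrow> adj x z \<or> z = v)))" for x
      proof (cases "adj x u \<and> \<not> adj x v")
        case True
        then have "h x = 1 - (\<Sum>y<n. g x y)" by (simp add: h_def)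
        then have "h x = 0 \<longleftrightarrow> (\<Sum>y<n. g x y) \<noteq> 0" by linarith
        also have "\<dots> \<longleftrightarrow> (\<exists>y<n. g x y \<noteq> 0)" by (rule sum_less_neq_0)
        also have "\<dots> \<longleftrightarrow> (\<exists>y<n. \<not> adj y u \<and> (\<forall>z<n. adj y z \<longrightarrow> adj x z \<or> z = v))"
          by (simp only: g card_diff_le_iff[OF uv(2) conjunct2[OF True]])
        finally show ?thesis using True by simp
      next
        case False
        then show ?thesis by (auto simp: h_def)
      qed
      then have "exchange u v \<longleftrightarrow> (\<forall>x<n. h x = 0)" by (simp only: exchange_def)
      moreover have "(\<Sum>x<n. h x) \<noteq> 0 \<longleftrightarrow> (\<exists>x<n. h x \<noteq> 0)" by (rule sum_less_neq_0)
      ultimately have "(\<Sum>x<n. h x) = 0 \<longleftrightarrow> exchange u v" by metis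
      then show ?thesis by (rule monus_of_bool)
    qed
    ultimately show "runs ?c s' ((n + 1) * ((n + 1) * 81 + 80))
       (\<lambda>s''. aval (Sub (Const 1) (Reg 5)) s'' = of_bool (exchange u v))"
      by (auto elim: runs_conseq)
  qed (use assms in \<open>auto simp: same_def adj_stored_def\<close>)
  then show ?thesis
    by (rule runs_conseq) (auto simp: power4_eq_xxxx algebra_simps)
qed

lemma runs_greedy_prog:
  assumes "adj_stored k s"
  shows "runs greedy_prog s (161 * (n + 1)\<^sup>2) (\<lambda>s'. \<forall>u<n. arr s' 6 u = of_bool (greedy u))"
proof -
  let ?c = "Sum 4 5 (Reg 3) Skip (And (Read 6 (Reg 5)) (Entry 3 (Reg 5) (Reg 3)))"
  have "runs greedy_prog s ((n + 1) * ((n + 1) * 81 + 80)) (\<lambda>s'. \<forall>u<n. arr s' 6 u = of_bool (greedy u))"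
    unfolding greedy_prog_def
  proof (rule runs_Tab)
    fix v s'
    assume v: "v < n" "reg s' 3 = v" and I: "\<And>y. y < v \<Longrightarrow> arr s' 6 y = of_bool (greedy y)"
      and s': "same (insert 3 (wregs ?c)) (insert 6 (warrs ?c)) s s'"
    have "runs ?c s' ((v + 1) * 81) (\<lambda>s''. reg s'' 4 = (\<Sum>u<v. of_bool (greedy u \<and> adj u v)))"
      by (rule runs_Sum0) (use assms v s' I in \<open>auto simp: same_def adj_stored_def\<close>)
    then show "runs ?c s' ((n + 1) * 81) (\<lambda>s''. aval (Sub (Const 1) (Reg 4)) s'' = of_bool (greedy v))"
    proof (rule runs_conseq)
      fix s'' :: state assume "reg s'' 4 = (\<Sum>u<v. of_bool (greedy u \<and> adj u v))"
      moreover have "(\<Sum>u<v. of_bool (greedy u \<and> adj u v)) = (0 :: nat) \<longleftrightarrow> greedy v"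
        using greedy.simps[of v] by auto
      ultimately show "aval (Sub (Const 1) (Reg 4)) s'' = of_bool (greedy v)"
        by (metis monus_of_bool aval.simps(1,2,5))
    qed (use v in auto)
  qed (use assms in \<open>auto simp: same_def adj_stored_def\<close>)
  then show ?thesis
    by (rule runs_conseq) (auto simp: power2_eq_square algebra_simps)
qed

end

definition list_adj :: "(nat \<times> nat) list \<Rightarrow> nat \<Rightarrow> nat \<Rightarrow> bool" where
  "list_adj es u v \<longleftrightarrow> u = v \<or> (u, v) \<in> set es \<or> (v, u) \<in> set es"

lemma runs_adj_prog:
  assumes reg: "reg s 1 = n" "reg s 2 = length es" and off: "\<forall>u<n. arr s 2 u = u * n"
    and es: "\<forall>e<length es. arr s 0 e = fst (es ! e) \<and> arr s 1 e = snd (es ! e)"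
  shows "runs adj_prog s (171 * ((n + 1)\<^sup>2 * (length es + 1)))
    (\<lambda>s'. \<forall>u<n. \<forall>v<n. arr s' 3 (u * n + v) = of_bool (list_adj es u v))"
proof -
  let ?x = "Add (And (Eq (Read 0 (Reg 6)) (Reg 3)) (Eq (Read 1 (Reg 6)) (Reg 4)))
            (And (Eq (Read 0 (Reg 6)) (Reg 4)) (Eq (Read 1 (Reg 6)) (Reg 3)))"
  let ?c = "Sum 5 6 (Reg 2) Skip ?x"
  have "runs adj_prog s ((n + 1) * ((n + 1) * ((length es + 1) * 81 + 90)))
    (\<lambda>s'. \<forall>u<n. \<forall>v<n. arr s' 3 (u * n + v) = of_bool (list_adj es u v))"
    unfolding adj_prog_def
  proof (rule runs_Tab2)
    fix u v s'
    assume uv: "u < n" "v < n" "reg s' 3 = u" "reg s' 4 = v"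
      and s': "same (insert 3 (insert 4 (wregs ?c))) (insert 3 (warrs ?c)) s s'"
    define h :: "nat \<Rightarrow> nat" where
      "h e = of_bool (es ! e = (u, v)) + of_bool (es ! e = (v, u))" for e
    have "runs ?c s' ((length es + 1) * 81) (\<lambda>s''. reg s'' 5 = (\<Sum>e<length es. h e))"
    proof (rule runs_Sum0)
      fix e s1 assume e: "e < length es" and s1: "same {5, 6} {} s' s1" and "reg s1 6 = e"
      moreover have "arr s1 0 e = fst (es ! e)" "arr s1 1 e = snd (es ! e)"
        using es e s' s1 by (simp_all add: same_def)
      moreover have "reg s1 3 = u" "reg s1 4 = v" using uv s1 by (simp_all add: same_def)
      ultimately have "aval ?x s1 = (of_bool (fst (es ! e) = u) + of_bool (snd (es ! e) = v) - 1) +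
         (of_bool (fst (es ! e) = v) + of_bool (snd (es ! e) = u) - 1)" by simp
      then show "aval ?x s1 = h e"
        by (simp only: h_def of_bool_and prod_eq_iff fst_conv snd_conv)
    qed (use reg s' in \<open>auto simp: same_def\<close>)
    then show "runs ?c s' ((length es + 1) * 81)
      (\<lambda>s''. aval (Sub (Const 1) (Sub (Sub (Const 1) (Eq (Reg 3) (Reg 4))) (Reg 5))) s''
         = of_bool (list_adj es u v))"
    proof (rule runs_conseq)
      fix s'' :: state
      assume "reg s'' 5 = (\<Sum>e<length es. h e)" and s'': "same (wregs ?c) (warrs ?c) s' s''"
      moreover have "(\<Sum>e<length es. h e) \<noteq> 0 \<longleftrightarrow> (u, v) \<in> set es \<or> (v, u) \<in> set es"
        unfolding sum_less_neq_0 h_def by (auto simp: in_set_conv_nth)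
      ultimately have 5: "reg s'' 5 \<noteq> 0 \<longleftrightarrow> (u, v) \<in> set es \<or> (v, u) \<in> set es" by simp
      have "reg s'' 3 = u" "reg s'' 4 = v" using s'' uv by (auto simp: same_def)
      then have "aval (Sub (Sub (Const 1) (Eq (Reg 3) (Reg 4))) (Reg 5)) s'' = 0 \<longleftrightarrow> list_adj es u v"
        using 5 unfolding list_adj_def by (cases "u = v") auto
      then have "1 - aval (Sub (Sub (Const 1) (Eq (Reg 3) (Reg 4))) (Reg 5)) s'' = of_bool (list_adj es u v)"
        by (rule monus_of_bool)
      then show "aval (Sub (Const 1) (Sub (Sub (Const 1) (Eq (Reg 3) (Reg 4))) (Reg 5))) s''
         = of_bool (list_adj es u v)" by (simp only: aval.simps)
    qed simp
  qed (use reg off in \<open>auto simp: same_def\<close>)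
  then show ?thesis
    by (rule runs_conseq) (auto simp: power2_eq_square algebra_simps)
qed

context reflexive_graph
begin

lemma runs_prep_prog:
  assumes reg: "reg s 0 = k" "reg s 1 = n" "reg s 2 = length es"
    and es: "\<forall>e<length es. arr s 0 e = fst (es ! e) \<and> arr s 1 e = snd (es ! e)"
    and adj: "\<And>u v. list_adj es u v = adj u v"
  shows "runs prep_prog s (161 * (k + n + 2)\<^sup>2 + (171 * ((n + 1)\<^sup>2 * (length es + 1)) +
     (171 * (n + 1) ^ 3 + (251 * (n + 1) ^ 4 + 161 * (n + 1)\<^sup>2)))) (prepared k)"
  unfolding prep_prog_def
proof (rule runs_Seq[OF runs_multiples_prog[OF reg(1,2)]])
  fix s1 assume 1: "\<forall>u<k + n + 1. arr s1 2 u = u * n"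
    and s1: "same (wregs multiples_prog) (warrs multiples_prog) s s1"
  have "runs adj_prog s1 (171 * ((n + 1)\<^sup>2 * (length es + 1)))
    (\<lambda>s'. \<forall>u<n. \<forall>v<n. arr s' 3 (u * n + v) = of_bool (list_adj es u v))"
    by (rule runs_adj_prog) (use 1 s1 reg es in \<open>auto simp: same_def\<close>)
  then show "runs (Seq adj_prog (Seq diff_prog (Seq exchange_prog greedy_prog))) s1
     (171 * ((n + 1)\<^sup>2 * (length es + 1)) +
     (171 * (n + 1) ^ 3 + (251 * (n + 1) ^ 4 + 161 * (n + 1)\<^sup>2))) (prepared k)"
  proof (rule runs_Seq)
    fix s2 assume 2: "\<forall>u<n. \<forall>v<n. arr s2 3 (u * n + v) = of_bool (list_adj es u v)"
      and s2: "same (wregs adj_prog) (warrs adj_prog) s1 s2"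
    have 2: "adj_stored k s2"
      using 1 2 s1 s2 reg adj by (auto simp: adj_stored_def same_def)
    show "runs (Seq diff_prog (Seq exchange_prog greedy_prog)) s2
      (171 * (n + 1) ^ 3 + (251 * (n + 1) ^ 4 + 161 * (n + 1)\<^sup>2)) (prepared k)"
    proof (rule runs_Seq[OF runs_diff_prog[OF 2]])
      fix s3
      assume 3: "\<forall>y<n. \<forall>x<n. arr s3 4 (y * n + x) = card {z. z < n \<and> adj y z \<and> \<not> adj x z}"
        and s3: "same (wregs diff_prog) (warrs diff_prog) s2 s3"
      have b3: "adj_stored k s3" using 2 s3 by (auto simp: adj_stored_def same_def)
      show "runs (Seq exchange_prog greedy_prog) s3 (251 * (n + 1) ^ 4 + 161 * (n + 1)\<^sup>2) (prepared k)"
      proof (rule runs_Seq[OF runs_exchange_prog[OF b3 3]])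
        fix s4 assume 4: "\<forall>u<n. \<forall>v<n. arr s4 5 (u * n + v) = of_bool (exchange u v)"
          and s4: "same (wregs exchange_prog) (warrs exchange_prog) s3 s4"
        have b4: "adj_stored k s4" using b3 s4 by (auto simp: adj_stored_def same_def)
        show "runs greedy_prog s4 (161 * (n + 1)\<^sup>2) (prepared k)"
          using runs_greedy_prog[OF b4] by (rule runs_conseq)
            (use 4 b4 in \<open>auto simp: adj_stored_def prepared_def same_def\<close>)
      qed
    qed
  qed
qed

section \<open>Weights, target and counts of a candidate\<close>

lemma runs_weight_prog:
  assumes s: "prepared k s" and f: "\<And>j. arr s 7 j = f j"
  shows "runs weight_prog s (187 * ((n + 1) * (k + 1))) (\<lambda>s'. \<forall>u<n. arr s' 8 u = weight f k u)"
proof -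
  let ?A = "Sub (Const 1) (Sub (Read 7 (Reg 5)) (Reg 3))"
  let ?B = "And (Entry 5 (Reg 3) (Read 7 (Reg 5))) (Entry 5 (Read 7 (Reg 5)) (Reg 3))"
  let ?b = "If ?A (If ?B (Assign 6 (Add (Reg 5) (Const 1))) (Assign 6 (Reg 4))) (Assign 6 (Reg 4))"
  let ?c = "Fold 4 5 (Reg 0) ?b (Reg 6)"
  have "runs weight_prog s ((n + 1) * ((k + 1) * (27 + 80) + 80))
     (\<lambda>s'. \<forall>u<n. arr s' 8 u = weight f k u)"
    unfolding weight_prog_def
  proof (rule runs_Tab)
    fix u s1
    assume u: "u < n" "reg s1 3 = u" and s1: "same (insert 3 (wregs ?c)) (insert 8 (warrs ?c)) s s1"
    have "runs ?c s1 ((k + 1) * (27 + 80)) (\<lambda>s'. reg s' 4 = weight f k u)"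
    proof (rule runs_Fold[where G = "\<lambda>j. weight f j u"])
      fix j s2
      assume j: "j < k" "reg s2 5 = j" "reg s2 4 = weight f j u"
        and s2: "same (insert 4 (insert 5 (wregs ?b))) (warrs ?b) s1 s2"
      have A: "aval ?A s2 \<noteq> 0 \<longleftrightarrow> f j \<le> u"
        using j u f s1 s2 by (auto simp: same_def)
      \<comment> \<open>The comparison with \<open>u\<close> comes before the matrix access, because
        an entry of a candidate may be \<open>n\<close> and lie outside the matrix.\<close>
      have B: "aval ?B s2 \<noteq> 0 \<longleftrightarrow> interchangeable u (f j)" if le: "f j \<le> u"
      proof -
        have "f j < n" using le u by simp
        then have "aval ?B s2 = of_bool (exchange u (f j)) + of_bool (exchange (f j) u) - 1"
          using j u f s1 s2 s by (simp add: same_def prepared_def adj_stored_def)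
        then show ?thesis using interchangeable_iff[OF u(1) \<open>f j < n\<close>] by auto
      qed
      have "runs ?b s2 (1 + acost ?A + (1 + acost ?B + 4)) (\<lambda>s'. reg s' 6 = weight f (Suc j) u)"
        by (intro runs_If runs_Assign) (use A B j in \<open>simp_all del: aval.simps(5) aval_And\<close>)
      then show "runs ?b s2 27 (\<lambda>s'. aval (Reg 6) s' = weight f (Suc j) u)"
        by (rule runs_conseq) auto
    qed (use s s1 in \<open>auto simp: same_def prepared_def adj_stored_def\<close>)
    then show "runs ?c s1 ((k + 1) * (27 + 80)) (\<lambda>s'. aval (Reg 4) s' = weight f k u)"
      by simp
  qed (use s in \<open>auto simp: same_def prepared_def adj_stored_def\<close>)
  then show ?thesis by (rule runs_conseq) (auto simp: algebra_simps)
qed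

lemma runs_zeros_prog:
  assumes "reg s 1 = n" "\<forall>u<n. arr s 8 u = w u"
  shows "runs zeros_prog s ((n + 1) * 81) (\<lambda>s'. reg s' 7 = 0 \<longleftrightarrow> (\<forall>u<n. w u \<noteq> 0))"
proof -
  have "runs zeros_prog s ((n + 1) * 81) (\<lambda>s'. reg s' 7 = (\<Sum>u<n. 1 - w u))"
    unfolding zeros_prog_def
    by (rule runs_Sum0) (use assms in \<open>auto simp: same_def\<close>)
  moreover have "(\<Sum>u<n. 1 - w u) = 0 \<longleftrightarrow> (\<forall>u<n. w u \<noteq> 0)" by (auto simp: Suc_le_eq)
  ultimately show ?thesis by (elim runs_conseq) simp_all
qed

lemma runs_target_prog:
  assumes "prepared k s" "\<forall>u<n. arr s 8 u = w u"
  shows "runs target_prog s ((n + 1) * 90) (\<lambda>s'. reg s' 8 = target w)"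
proof -
  let ?c = "If (Read 6 (Reg 3)) (Assign 4 (Read 8 (Reg 3))) (Assign 4 (Const 0))"
  have "runs target_prog s ((n + 1) * (10 + 80)) (\<lambda>s'. reg s' 8 = (\<Sum>u<n. if greedy u then w u else 0))"
    unfolding target_prog_def
  proof (rule runs_Sum)
    fix u s' assume u: "u < n" "reg s' 3 = u" and s': "same (insert 8 (insert 3 (wregs ?c))) (warrs ?c) s s'"
    have "runs ?c s' (1 + acost (Read 6 (Reg 3)) + 7)
      (\<lambda>s'. aval (Reg 4) s' = (if greedy u then w u else 0))"
      by (intro runs_If runs_Assign)
        (use assms u s' in \<open>auto simp: same_def prepared_def adj_stored_def\<close>)
    then show "runs ?c s' 10 (\<lambda>s'. aval (Reg 4) s' = (if greedy u then w u else 0))"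
      by (rule runs_conseq) auto
  qed (use assms in \<open>auto simp: same_def prepared_def adj_stored_def\<close>)
  then show ?thesis by (simp add: target_def)
qed

lemma runs_sizes_prog:
  assumes "reg s 0 = k" "reg s 1 = n" "\<forall>u<n. arr s 8 u = w u"
  shows "runs sizes_prog s (161 * ((k + 1) * (n + 1))) (\<lambda>s'. \<forall>j<k. arr s' 9 j = profile w {..<n} j)"
proof -
  let ?c = "Sum 4 5 (Reg 1) Skip (Eq (Read 8 (Reg 5)) (Add (Reg 3) (Const 1)))"
  have "runs sizes_prog s ((k + 1) * ((n + 1) * 81 + 80)) (\<lambda>s'. \<forall>j<k. arr s' 9 j = profile w {..<n} j)"
    unfolding sizes_prog_def
  proof (rule runs_Tab)
    fix j s' assume j: "j < k" "reg s' 3 = j" and s': "same (insert 3 (wregs ?c)) (insert 9 (warrs ?c)) s s'"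
    have "runs ?c s' ((n + 1) * 81) (\<lambda>s''. reg s'' 4 = (\<Sum>u<n. of_bool (w u = Suc j)))"
      by (rule runs_Sum0) (use assms j s' in \<open>auto simp: same_def\<close>)
    moreover have "(\<Sum>u<n. of_bool (w u = Suc j)) = profile w {..<n} j"
      unfolding sum_of_bool profile_def by simp
    ultimately show "runs ?c s' ((n + 1) * 81) (\<lambda>s''. aval (Reg 4) s'' = profile w {..<n} j)"
      by (simp only: aval.simps)
  qed (use assms in \<open>auto simp: same_def\<close>)
  then show ?thesis by (rule runs_conseq) (auto simp: algebra_simps)
qed

lemma runs_neighbours_prog:
  assumes "adj_stored k s" "\<forall>u<n. arr s 8 u = w u"
  shows "runs neighbours_prog s (171 * ((k + 1) * (n + 1)\<^sup>2))
    (\<lambda>s'. \<forall>j<k. \<forall>x<n. arr s' 10 (j * n + x) = profile w {u. u < n \<and> adj x u} j)"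
proof -
  let ?c = "Sum 5 6 (Reg 1) Skip
       (And (Eq (Read 8 (Reg 6)) (Add (Reg 3) (Const 1))) (Entry 3 (Reg 4) (Reg 6)))"
  have "runs neighbours_prog s ((k + 1) * ((n + 1) * ((n + 1) * 81 + 90)))
    (\<lambda>s'. \<forall>j<k. \<forall>x<n. arr s' 10 (j * n + x) = profile w {u. u < n \<and> adj x u} j)"
    unfolding neighbours_prog_def
  proof (rule runs_Tab2)
    fix j x s' assume jx: "j < k" "x < n" "reg s' 3 = j" "reg s' 4 = x"
      and s': "same (insert 3 (insert 4 (wregs ?c))) (insert 10 (warrs ?c)) s s'"
    have "runs ?c s' ((n + 1) * 81) (\<lambda>s''. reg s'' 5 = (\<Sum>u<n. of_bool (w u = Suc j \<and> adj x u)))"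
      by (rule runs_Sum0) (use assms jx s' in \<open>auto simp: same_def adj_stored_def\<close>)
    moreover have "{u. u < n \<and> w u = Suc j \<and> adj x u} = {u \<in> {u. u < n \<and> adj x u}. w u = Suc j}"
      by auto
    then have "(\<Sum>u<n. of_bool (w u = Suc j \<and> adj x u)) = profile w {u. u < n \<and> adj x u} j"
      unfolding sum_of_bool profile_def by simp
    ultimately show "runs ?c s' ((n + 1) * 81)
        (\<lambda>s''. aval (Reg 5) s'' = profile w {u. u < n \<and> adj x u} j)"
      by (simp only: aval.simps)
  qed (use assms in \<open>auto simp: same_def adj_stored_def\<close>)
  then show ?thesis by (rule runs_conseq) (auto simp: power2_eq_square algebra_simps)
qed


section \<open>Testing the count vectors of a candidate\<close>

definition counted :: "nat \<Rightarrow> (nat \<Rightarrow> nat) \<Rightarrow> nat \<Rightarrow> state \<Rightarrow> bool" where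
  "counted k w t s \<longleftrightarrow> adj_stored k s \<and> reg s 8 = t \<and> (\<forall>j<k. arr s 9 j = profile w {..<n} j) \<and>
     (\<forall>j<k. \<forall>x<n. arr s 10 (j * n + x) = profile w {u. u < n \<and> adj x u} j)"

lemma counted_same:
  "counted k w t s \<Longrightarrow> same R A s s' \<Longrightarrow> {0, 1, 8} \<inter> R = {} \<Longrightarrow> {2, 3, 9, 10} \<inter> A = {} \<Longrightarrow> counted k w t s'"
  by (simp add: counted_def adj_stored_def same_def)

lemma aval_Excess:
  assumes "counted k w t s" "\<And>j. arr s 11 j = d j" "reg s y = j" "reg s z = x" "j < k" "x < n"
  shows "aval (Excess z y) s = excess w d x j"
  using assms by (simp add: Excess_def excess_def counted_def adj_stored_def)

lemma runs_type_weight_prog: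
  assumes "reg s 0 = k" "\<And>j. arr s 11 j = d j"
  shows "runs type_weight_prog s ((k + 1) * ((k + 1) * 81 + 80)) (\<lambda>s'. reg s' 12 = (\<Sum>j<k. Suc j * d j))"
  unfolding type_weight_prog_def
proof (rule runs_Sum)
  let ?c = "Sum 14 15 (Add (Reg 13) (Const 1)) Skip (Read 11 (Reg 13))"
  fix j s'
  assume j: "j < k" "reg s' 13 = j" and s': "same (insert 12 (insert 13 (wregs ?c))) (warrs ?c) s s'"
  have "runs ?c s' ((Suc j + 1) * 81) (\<lambda>s''. reg s'' 14 = (\<Sum>i<Suc j. d j))"
    by (rule runs_Sum0) (use assms j s' in \<open>auto simp: same_def\<close>)
  then show "runs ?c s' ((k + 1) * 81) (\<lambda>s''. aval (Reg 14) s'' = Suc j * d j)"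
    by (rule runs_conseq) (use j in auto)
qed (use assms in \<open>auto simp: same_def\<close>)

lemma runs_hits_prog:
  assumes s: "counted k w t s" and d: "\<And>j. arr s 11 j = d j"
  shows "runs hits_prog s ((n + 1) * ((k + 1) * 81 + 80)) (\<lambda>s'. \<forall>x<n. arr s' 12 x = hits k w d x)"
  unfolding hits_prog_def
proof (rule runs_Tab)
  let ?c = "Sum 14 15 (Reg 0) Skip (Excess 13 15)"
  fix x s'
  assume x: "x < n" "reg s' 13 = x" and s': "same (insert 13 (wregs ?c)) (insert 12 (warrs ?c)) s s'"
  have "runs ?c s' ((k + 1) * 81) (\<lambda>s''. reg s'' 14 = (\<Sum>j<k. excess w d x j))"
  proof (rule runs_Sum0)
    fix j s1 assume j: "j < k" "reg s1 15 = j" and s1: "same {14, 15} {} s' s1"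
    have s1': "same {13, 14, 15} {12} s s1" using s' s1 by (auto simp: same_def)
    show "aval (Excess 13 15) s1 = excess w d x j"
    proof (rule aval_Excess)
      show "counted k w t s1" using s s1' by (rule counted_same) simp_all
      show "arr s1 11 j = d j" for j using s1' d by (simp add: same_def)
      show "reg s1 13 = x" using s1 x by (simp add: same_def)
    qed (use j x in auto)
  next
    show "aval (Reg 0) s1 = k" if "same {14, 15} {} s' s1" for s1
      using that s' s by (simp add: same_def counted_def adj_stored_def)
  qed (simp_all add: Excess_def)
  then show "runs ?c s' ((k + 1) * 81) (\<lambda>s''. aval (Reg 14) s'' = hits k w d x)"
    by (simp add: hits_def)
qed (use s in \<open>auto simp: same_def counted_def adj_stored_def\<close>)

lemma runs_undominated_prog:
  assumes "reg s 1 = n" "\<forall>x<n. arr s 12 x = h x"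
  shows "runs undominated_prog s ((n + 1) * 81) (\<lambda>s'. reg s' 16 = 0 \<longleftrightarrow> (\<forall>x<n. h x \<noteq> 0))"
proof -
  have "runs undominated_prog s ((n + 1) * 81) (\<lambda>s'. reg s' 16 = (\<Sum>u<n. 1 - h u))"
    unfolding undominated_prog_def
    by (rule runs_Sum0) (use assms in \<open>auto simp: same_def\<close>)
  moreover have "(\<Sum>u<n. 1 - h u) = 0 \<longleftrightarrow> (\<forall>u<n. h u \<noteq> 0)" by (auto simp: Suc_le_eq)
  ultimately show ?thesis by (elim runs_conseq) simp_all
qed

lemma runs_redundant_prog:
  assumes s: "counted k w t s" and d: "\<And>j. arr s 11 j = d j" and h: "\<forall>x<n. arr s 12 x = hits k w d x"
  shows "runs redundant_prog s ((k + 1) * ((n + 1) * 81 + 80))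
    (\<lambda>s'. reg s' 17 = 0 \<longleftrightarrow> (\<forall>j<k. d j \<noteq> 0 \<longrightarrow> (\<exists>x<n. hits k w d x = 1 \<and> excess w d x j = 1)))"
proof -
  define g :: "nat \<Rightarrow> nat" where "g j = (\<Sum>x<n. of_bool (hits k w d x = 1 \<and> excess w d x j = 1))" for j
  define z where "z j = (1 - (1 - d j)) - g j" for j
  let ?x = "And (Eq (Read 12 (Reg 15)) (Const 1)) (Eq (Excess 15 13) (Const 1))"
  let ?c = "Sum 14 15 (Reg 1) Skip ?x"
  have "runs redundant_prog s ((k + 1) * ((n + 1) * 81 + 80)) (\<lambda>s'. reg s' 17 = (\<Sum>j<k. z j))"
    unfolding redundant_prog_def
  proof (rule runs_Sum)
    fix j s'
    assume j: "j < k" "reg s' 13 = j" and s': "same (insert 17 (insert 13 (wregs ?c))) (warrs ?c) s s'"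
    have "runs ?c s' ((n + 1) * 81) (\<lambda>s''. reg s'' 14 = g j)"
      unfolding g_def
    proof (rule runs_Sum0)
      fix x s1 assume x: "x < n" "reg s1 15 = x" and s1: "same {14, 15} {} s' s1"
      have s1': "same {13, 14, 15, 17} {} s s1" using s' s1 by (auto simp: same_def)
      have "aval (Excess 15 13) s1 = excess w d x j"
      proof (rule aval_Excess)
        show "counted k w t s1" using s s1' by (rule counted_same) simp_all
        show "arr s1 11 j = d j" for j using s1' d by (simp add: same_def)
        show "reg s1 13 = j" using s1 j by (simp add: same_def)
      qed (use j x in auto)
      moreover have "arr s1 12 x = hits k w d x" using s1' h x by (simp add: same_def)
      ultimately have "aval ?x s1 = of_bool (hits k w d x = 1) + of_bool (excess w d x j = 1) - 1"
        using x by simp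
      then show "aval ?x s1 = of_bool (hits k w d x = 1 \<and> excess w d x j = 1)"
        by (simp only: of_bool_and)
    next
      show "aval (Reg 1) s1 = n" if "same {14, 15} {} s' s1" for s1
        using that s' s by (simp add: same_def counted_def adj_stored_def)
    qed (simp_all add: Excess_def)
    then show "runs ?c s' ((n + 1) * 81)
      (\<lambda>s''. aval (Sub (Sub (Const 1) (Sub (Const 1) (Read 11 (Reg 13)))) (Reg 14)) s'' = z j)"
      by (rule runs_conseq) (use j s' d in \<open>auto simp: same_def z_def\<close>)
  qed (use s in \<open>auto simp: same_def counted_def adj_stored_def\<close>)
  moreover have "(\<Sum>j<k. z j) = 0 \<longleftrightarrow>
    (\<forall>j<k. d j \<noteq> 0 \<longrightarrow> (\<exists>x<n. hits k w d x = 1 \<and> excess w d x j = 1))"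
  proof -
    have "z j = 0 \<longleftrightarrow> (d j \<noteq> 0 \<longrightarrow> g j \<noteq> 0)" for j
      unfolding z_def by (cases "d j") auto
    moreover have "g j \<noteq> 0 \<longleftrightarrow> (\<exists>x<n. hits k w d x = 1 \<and> excess w d x j = 1)" for j
      unfolding g_def sum_less_neq_0 by simp
    moreover have "(\<Sum>j<k. z j) \<noteq> 0 \<longleftrightarrow> (\<exists>j<k. z j \<noteq> 0)" by (rule sum_less_neq_0)
    ultimately show ?thesis by metis
  qed
  ultimately show ?thesis by (elim runs_conseq) simp_all
qed

definition type_ok :: "nat \<Rightarrow> (nat \<Rightarrow> nat) \<Rightarrow> nat \<Rightarrow> (nat \<Rightarrow> nat) \<Rightarrow> bool" where
  "type_ok k w t d \<longleftrightarrow> (min_dom_type k w d \<longleftrightarrow> (\<Sum>j<k. Suc j * d j) = t)"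

lemma runs_type_prog:
  assumes s: "counted k w t s" and d: "\<And>j. arr s 11 j = d j"
  shows "runs type_prog s (700 * ((k + 1) * (n + k + 1)))
    (\<lambda>s'. reg s' 9 = 0 \<longleftrightarrow> reg s 9 = 0 \<and> type_ok k w t d)"
proof -
  have k: "reg s 0 = k" using s by (simp add: counted_def adj_stored_def)
  have "runs type_prog s ((k + 1) * ((k + 1) * 81 + 80) + ((n + 1) * ((k + 1) * 81 + 80) +
    ((n + 1) * 81 + ((k + 1) * ((n + 1) * 81 + 80) + 40))))
    (\<lambda>s'. reg s' 9 = 0 \<longleftrightarrow> reg s 9 = 0 \<and> type_ok k w t d)"
    unfolding type_prog_def
  proof (rule runs_Seq[OF runs_type_weight_prog[OF k d]])
    fix s1 assume 1: "reg s1 12 = (\<Sum>j<k. Suc j * d j)"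
      and s1: "same (wregs type_weight_prog) (warrs type_weight_prog) s s1"
    have c1: "counted k w t s1" using s s1 by (rule counted_same) simp_all
    have d1: "\<And>j. arr s1 11 j = d j" using s1 d by (simp add: same_def)
    show "runs (Seq hits_prog (Seq undominated_prog (Seq redundant_prog compare_prog))) s1
      ((n + 1) * ((k + 1) * 81 + 80) + ((n + 1) * 81 + ((k + 1) * ((n + 1) * 81 + 80) + 40)))
      (\<lambda>s'. reg s' 9 = 0 \<longleftrightarrow> reg s 9 = 0 \<and> type_ok k w t d)"
    proof (rule runs_Seq[OF runs_hits_prog[OF c1 d1]])
      fix s2 assume 2: "\<forall>x<n. arr s2 12 x = hits k w d x"
        and s2: "same (wregs hits_prog) (warrs hits_prog) s1 s2"
      have c2: "counted k w t s2" using c1 s2 by (rule counted_same) simp_all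
      have n2: "reg s2 1 = n" using c2 by (simp add: counted_def adj_stored_def)
      show "runs (Seq undominated_prog (Seq redundant_prog compare_prog)) s2
        ((n + 1) * 81 + ((k + 1) * ((n + 1) * 81 + 80) + 40))
        (\<lambda>s'. reg s' 9 = 0 \<longleftrightarrow> reg s 9 = 0 \<and> type_ok k w t d)"
      proof (rule runs_Seq[OF runs_undominated_prog[OF n2 2]])
        fix s3 assume 3: "reg s3 16 = 0 \<longleftrightarrow> (\<forall>x<n. hits k w d x \<noteq> 0)"
          and s3: "same (wregs undominated_prog) (warrs undominated_prog) s2 s3"
        have c3: "counted k w t s3" using c2 s3 by (rule counted_same) simp_all
        have d3: "\<And>j. arr s3 11 j = d j" using d1 s2 s3 by (simp add: same_def)
        have h3: "\<forall>x<n. arr s3 12 x = hits k w d x" using 2 s3 by (simp add: same_def)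
        show "runs (Seq redundant_prog compare_prog) s3 ((k + 1) * ((n + 1) * 81 + 80) + 40)
          (\<lambda>s'. reg s' 9 = 0 \<longleftrightarrow> reg s 9 = 0 \<and> type_ok k w t d)"
        proof (rule runs_Seq[OF runs_redundant_prog[OF c3 d3 h3]])
          fix s4 assume 4: "reg s4 17 = 0 \<longleftrightarrow>
              (\<forall>j<k. d j \<noteq> 0 \<longrightarrow> (\<exists>x<n. hits k w d x = 1 \<and> excess w d x j = 1))"
            and s4: "same (wregs redundant_prog) (warrs redundant_prog) s3 s4"
          have 5: "reg s4 9 = reg s 9" "reg s4 8 = t" "reg s4 12 = (\<Sum>j<k. Suc j * d j)"
            using s1 s2 s3 s4 1 c3 by (simp_all add: same_def counted_def)
          have "reg s4 16 = reg s3 16" using s4 by (simp add: same_def)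
          then have 6: "aval (Add (Reg 16) (Reg 17)) s4 = 0 \<longleftrightarrow> min_dom_type k w d"
            using 3 4 by (simp add: min_dom_type_def)
          have "runs compare_prog s4 (1 + acost (Add (Reg 16) (Reg 17)) + 30)
            (\<lambda>s'. reg s' 9 = 0 \<longleftrightarrow> reg s 9 = 0 \<and> type_ok k w t d)"
            unfolding compare_prog_def
            by (intro runs_If runs_Assign) (use 5 6 in \<open>auto simp: type_ok_def\<close>)
          then show "runs compare_prog s4 40 (\<lambda>s'. reg s' 9 = 0 \<longleftrightarrow> reg s 9 = 0 \<and> type_ok k w t d)"
            by (rule runs_conseq) auto
        qed
      qed
    qed
  qed
  then show ?thesis by (rule runs_conseq) (auto simp: algebra_simps)
qed

lemma hits_cong: "\<forall>j<k. d j = e j \<Longrightarrow> hits k w d x = hits k w e x"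
  unfolding hits_def excess_def by (rule sum.cong) auto

text \<open>Needed because \<open>runs_Box\<close> marks whole families of functions as visited
  after a single test.\<close>

lemma type_ok_cong:
  assumes "\<forall>j<k. d j = e j"
  shows "type_ok k w t d = type_ok k w t e"
proof -
  have "(\<Sum>j<k. Suc j * d j) = (\<Sum>j<k. Suc j * e j)" by (rule sum.cong) (use assms in auto)
  moreover have "min_dom_type k w d = min_dom_type k w e"
    unfolding min_dom_type_def hits_cong[OF assms] excess_def using assms by auto
  ultimately show ?thesis by (simp only: type_ok_def)
qed

lemma runs_types_prog:
  assumes s: "counted k w t s" and zero: "reg s 7 = 0 \<longleftrightarrow> (\<forall>u<n. w u \<noteq> 0)"
  shows "runs types_prog s (200 * (k + 1) + boxsize (profile w {..<n}) k * (800 * ((k + 1) * (n + k + 1))))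
    (\<lambda>s'. reg s' 9 = 0 \<longleftrightarrow> consistent k w t)"
proof -
  let ?b = "profile w {..<n}"
  let ?z = "Tab 11 3 (Reg 0) Skip (Const 0)" and ?a = "Assign 9 (Add (Reg 7) (Sub (Const 1) (Reg 8)))"
  \<comment> \<open>For empty \<open>S\<close> this describes the initial value of register 9; for
    the whole box it is \<open>consistent k w t\<close>.\<close>
  define I where "I S s' \<longleftrightarrow> (reg s' 9 = 0 \<longleftrightarrow> (\<forall>u<n. w u \<noteq> 0) \<and> t \<noteq> 0 \<and> (\<forall>d\<in>S. type_ok k w t d))"
    for S and s' :: state
  have "runs types_prog s ((k + 1) * (1 + 80) + (10 +
      boxsize ?b k * (700 * ((k + 1) * (n + k + 1)) + (k + 1) * 80))) (I {d. \<forall>j<k. d j \<le> ?b j})"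
    unfolding types_prog_def
  proof (rule runs_Seq)
    show "runs ?z s ((k + 1) * (1 + 80)) (\<lambda>s'. \<forall>j<k. arr s' 11 j = 0)"
      by (rule runs_Tab) (use s in \<open>auto simp: counted_def adj_stored_def same_def intro!: runs_Skip\<close>)
    fix s1 assume 1: "\<forall>j<k. arr s1 11 j = 0" and s1: "same (wregs ?z) (warrs ?z) s s1"
    show "runs (Seq ?a (Box 11 10 11 (Read 9 (Reg 10)) type_prog)) s1
      (10 + boxsize ?b k * (700 * ((k + 1) * (n + k + 1)) + (k + 1) * 80)) (I {d. \<forall>j<k. d j \<le> ?b j})"
    proof (rule runs_Seq)
      show "runs ?a s1 10 (I {})"
        by (rule runs_Assign) (use s s1 zero in \<open>auto simp: I_def same_def counted_def\<close>)
      fix s2 assume 2: "I {} s2" and s2: "same (wregs ?a) (warrs ?a) s1 s2"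
      have c2: "counted k w t s2"
        by (rule counted_same[OF counted_same[OF s s1] s2]) simp_all
      show "runs (Box 11 10 11 (Read 9 (Reg 10)) type_prog) s2
         (boxsize ?b k * (700 * ((k + 1) * (n + k + 1)) + (k + 1) * 80)) (I {d. \<forall>j<k. d j \<le> ?b j})"
      proof (rule runs_Box)
        show "reg s2 0 = k" using c2 by (simp add: counted_def adj_stored_def)
        show "\<forall>j<k. arr s2 11 j = 0" using 1 s2 by (simp add: same_def)
        show "I {} s2" by fact
        show "I S s4" if "I S s3" "same {10, 11} {11} s3 s4" for S s3 s4
          using that by (simp add: I_def same_def)
        show "aval (Read 9 (Reg 10)) s' = ?b j"
          if "same (insert 10 (insert 11 (wregs type_prog))) (insert 11 (warrs type_prog)) s2 s'"
            "reg s' 10 = j" "j < k" for s' j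
          using that c2 by (simp add: same_def counted_def)
        fix S s'
        assume s': "same (insert 10 (insert 11 (wregs type_prog))) (insert 11 (warrs type_prog)) s2 s'"
          and I: "I S s'"
        have c': "counted k w t s'" using c2 s' by (rule counted_same) simp_all
        define T where "T = {y. \<forall>j<k. y j = arr s' 11 j}"
        have T: "arr s' 11 \<in> T" by (simp add: T_def)
        have eq: "type_ok k w t y = type_ok k w t (arr s' 11)" if "y \<in> T" for y
          using that by (intro type_ok_cong) (simp add: T_def)
        have ball: "(\<forall>y\<in>T. type_ok k w t y) \<longleftrightarrow> type_ok k w t (arr s' 11)"
          using T eq by metis
        show "runs type_prog s' (700 * ((k + 1) * (n + k + 1))) (I (S \<union> {y. \<forall>j<k. y j = arr s' 11 j}))"
          unfolding T_def[symmetric] using runs_type_prog[OF c' refl]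
        proof (rule runs_conseq)
          fix s'' :: state assume "reg s'' 9 = 0 \<longleftrightarrow> reg s' 9 = 0 \<and> type_ok k w t (arr s' 11)"
          then show "I (S \<union> T) s''" using I by (simp only: I_def ball_Un ball) argo
        qed simp
      qed auto
    qed
  qed
  then show ?thesis
  proof (rule runs_conseq)
    have "(k + 1) * 80 \<le> 100 * ((k + 1) * (n + k + 1))" by (simp add: algebra_simps)
    then have "700 * ((k + 1) * (n + k + 1)) + (k + 1) * 80 \<le> 800 * ((k + 1) * (n + k + 1))" by linarith
    then have "boxsize ?b k * (700 * ((k + 1) * (n + k + 1)) + (k + 1) * 80) \<le>
       boxsize ?b k * (800 * ((k + 1) * (n + k + 1)))" by (rule mult_left_mono) simp
    moreover have "(k + 1) * (1 + 80) + 10 \<le> 200 * (k + 1)" by simp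
    ultimately show "(k + 1) * (1 + 80) + (10 + boxsize ?b k * (700 * ((k + 1) * (n + k + 1)) + (k + 1) * 80))
       \<le> 200 * (k + 1) + boxsize ?b k * (800 * ((k + 1) * (n + k + 1)))"
      unfolding add.assoc[symmetric] by (rule add_mono[rotated])
    show "reg s' 9 = 0 \<longleftrightarrow> consistent k w t" if "I {d. \<forall>j<k. d j \<le> ?b j} s'" for s'
      using that by (simp add: I_def consistent_def type_ok_def)
  qed
qed

lemma runs_record_prog:
  assumes "reg s 0 = k" "reg s 1 = n" "reg s 8 = t" "\<forall>u<n. arr s 8 u = w u"
  shows "runs record_prog s (81 * (n + 1) + 50)
    (\<lambda>s'. if reg s 9 = 0 then
        reg s' 18 = 1 \<and> reg s' 19 = t \<and> reg s' 20 = (if t = k then 1 else reg s 20) \<and>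
        (\<forall>u<n. arr s' 0 u = w u)
      else reg s' 18 = reg s 18 \<and> reg s' 19 = reg s 19 \<and> reg s' 20 = reg s 20 \<and> arr s' 0 = arr s 0)"
    (is "runs _ _ _ ?Q")
proof -
  let ?i = "If (Eq (Reg 8) (Reg 0)) (Assign 20 (Const 1)) Skip"
  let ?t = "Tab 0 3 (Reg 1) Skip (Read 8 (Reg 3))"
  have "runs (Seq (Assign 18 (Const 1)) (Seq (Assign 19 (Reg 8)) (Seq ?i ?t))) s
     (2 + (2 + (1 + acost (Eq (Reg 8) (Reg 0)) + 2 + (n + 1) * (1 + 80)))) ?Q" if "reg s 9 = 0"
  proof (rule runs_Seq)
    show "runs (Assign 18 (Const 1)) s 2 (\<lambda>s'. s' = s\<lparr>reg := (reg s)(18 := 1)\<rparr>)"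
      by (rule runs_Assign) simp_all
    fix s1 assume s1: "s1 = s\<lparr>reg := (reg s)(18 := 1)\<rparr>"
    show "runs (Seq (Assign 19 (Reg 8)) (Seq ?i ?t)) s1
      (2 + (1 + acost (Eq (Reg 8) (Reg 0)) + 2 + (n + 1) * (1 + 80))) ?Q"
    proof (rule runs_Seq)
      show "runs (Assign 19 (Reg 8)) s1 2 (\<lambda>s'. s' = s1\<lparr>reg := (reg s1)(19 := t)\<rparr>)"
        by (rule runs_Assign) (use s1 assms in simp_all)
      fix s2 assume s2: "s2 = s1\<lparr>reg := (reg s1)(19 := t)\<rparr>"
      show "runs (Seq ?i ?t) s2 (1 + acost (Eq (Reg 8) (Reg 0)) + 2 + (n + 1) * (1 + 80)) ?Q"
      proof (rule runs_Seq)
        show "runs ?i s2 (1 + acost (Eq (Reg 8) (Reg 0)) + 2)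
          (\<lambda>s'. reg s' 20 = (if t = k then 1 else reg s 20))"
          by (intro runs_If runs_Assign runs_Skip) (use s1 s2 assms in auto)
        fix s3 assume 3: "reg s3 20 = (if t = k then 1 else reg s 20)"
          and s3: "same (wregs ?i) (warrs ?i) s2 s3"
        have "runs ?t s3 ((n + 1) * (1 + 80)) (\<lambda>s'. \<forall>u<n. arr s' 0 u = w u)"
          by (rule runs_Tab) (use s1 s2 s3 assms in \<open>auto simp: same_def intro!: runs_Skip\<close>)
        then show "runs ?t s3 ((n + 1) * (1 + 80)) ?Q"
          by (rule runs_conseq) (use s1 s2 s3 3 that in \<open>auto simp: same_def\<close>)
      qed
    qed
  qed
  then have "runs record_prog s (1 + acost (Reg 9) +
      (2 + (2 + (1 + acost (Eq (Reg 8) (Reg 0)) + 2 + (n + 1) * (1 + 80))))) ?Q"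
    unfolding record_prog_def by (intro runs_If runs_Skip) simp_all
  then show ?thesis by (rule runs_conseq) auto
qed

end

section \<open>The search through all candidates\<close>

definition prep_time :: "nat \<Rightarrow> nat \<Rightarrow> nat \<Rightarrow> nat" where
  "prep_time n k m = 161 * (k + n + 2)\<^sup>2 + (171 * ((n + 1)\<^sup>2 * (m + 1)) +
     (171 * (n + 1) ^ 3 + (251 * (n + 1) ^ 4 + 161 * (n + 1)\<^sup>2)))"

text \<open>\<open>Q\<close> stands for a common bound on the numbers of count vectors of all
  candidates.\<close>

definition search_time :: "nat \<Rightarrow> nat \<Rightarrow> nat \<Rightarrow> nat" where
  "search_time n k Q = (k + 1) * 81 + (n + 1) ^ k * ((1100 * ((k + 1) * (n + 1)\<^sup>2) +
     Q * (800 * ((k + 1) * (n + k + 1)))) + (k + 1) * 80)"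

context reflexive_graph
begin

lemma prepared_same:
  "prepared k s \<Longrightarrow> same R A s s' \<Longrightarrow> {0, 1} \<inter> R = {} \<Longrightarrow> {2, 3, 5, 6} \<inter> A = {} \<Longrightarrow> prepared k s'"
  by (simp add: prepared_def adj_stored_def same_def)

lemma runs_candidate_prog:
  fixes Q :: nat
  assumes s: "prepared k s" and f: "arr s 7 = f" and Q: "\<And>w. boxsize (profile w {..<n}) k \<le> Q"
  shows "runs candidate_prog s (1100 * ((k + 1) * (n + 1)\<^sup>2) + Q * (800 * ((k + 1) * (n + k + 1))))
    (\<lambda>s'. if passes k f then
        reg s' 18 = 1 \<and> reg s' 19 = target (weight f k) \<and>
        reg s' 20 = (if target (weight f k) = k then 1 else reg s 20) \<and>
        (\<forall>u<n. arr s' 0 u = weight f k u)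
      else reg s' 18 = reg s 18 \<and> reg s' 19 = reg s 19 \<and> reg s' 20 = reg s 20 \<and> arr s' 0 = arr s 0)"
    (is "runs _ _ ?B ?P")
proof -
  let ?w = "weight f k"
  have f': "\<And>j. arr s 7 j = f j" using f by simp
  have "runs candidate_prog s (187 * ((n + 1) * (k + 1)) + ((n + 1) * 81 + ((n + 1) * 90 +
     (161 * ((k + 1) * (n + 1)) + (171 * ((k + 1) * (n + 1)\<^sup>2) +
     ((200 * (k + 1) + boxsize (profile ?w {..<n}) k * (800 * ((k + 1) * (n + k + 1)))) +
      (81 * (n + 1) + 50))))))) ?P"
    unfolding candidate_prog_def
  proof (rule runs_Seq[OF runs_weight_prog[OF s f']])
    fix s1 assume w1: "\<forall>u<n. arr s1 8 u = ?w u" and s1: "same (wregs weight_prog) (warrs weight_prog) s s1"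
    have p1: "prepared k s1" using s s1 by (rule prepared_same) simp_all
    have n1: "reg s1 1 = n" using p1 by (simp add: prepared_def adj_stored_def)
    show "runs (Seq zeros_prog (Seq target_prog (Seq sizes_prog (Seq neighbours_prog
      (Seq types_prog record_prog))))) s1 ((n + 1) * 81 + ((n + 1) * 90 +
     (161 * ((k + 1) * (n + 1)) + (171 * ((k + 1) * (n + 1)\<^sup>2) +
     ((200 * (k + 1) + boxsize (profile ?w {..<n}) k * (800 * ((k + 1) * (n + k + 1)))) +
      (81 * (n + 1) + 50)))))) ?P"
    proof (rule runs_Seq[OF runs_zeros_prog[OF n1 w1]])
      fix s2 assume z2: "reg s2 7 = 0 \<longleftrightarrow> (\<forall>u<n. ?w u \<noteq> 0)"
        and s2: "same (wregs zeros_prog) (warrs zeros_prog) s1 s2"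
      have p2: "prepared k s2" using p1 s2 by (rule prepared_same) simp_all
      have w2: "\<forall>u<n. arr s2 8 u = ?w u" using w1 s2 by (simp add: same_def)
      show "runs (Seq target_prog (Seq sizes_prog (Seq neighbours_prog
        (Seq types_prog record_prog)))) s2 ((n + 1) * 90 +
       (161 * ((k + 1) * (n + 1)) + (171 * ((k + 1) * (n + 1)\<^sup>2) +
       ((200 * (k + 1) + boxsize (profile ?w {..<n}) k * (800 * ((k + 1) * (n + k + 1)))) +
        (81 * (n + 1) + 50))))) ?P"
      proof (rule runs_Seq[OF runs_target_prog[OF p2 w2]])
        fix s3 assume t3: "reg s3 8 = target ?w"
          and s3: "same (wregs target_prog) (warrs target_prog) s2 s3"
        have p3: "prepared k s3" using p2 s3 by (rule prepared_same) simp_all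
        have w3: "\<forall>u<n. arr s3 8 u = ?w u" using w2 s3 by (simp add: same_def)
        have k3: "reg s3 0 = k" "reg s3 1 = n" using p3 by (simp_all add: prepared_def adj_stored_def)
        show "runs (Seq sizes_prog (Seq neighbours_prog (Seq types_prog record_prog))) s3
         (161 * ((k + 1) * (n + 1)) + (171 * ((k + 1) * (n + 1)\<^sup>2) +
         ((200 * (k + 1) + boxsize (profile ?w {..<n}) k * (800 * ((k + 1) * (n + k + 1)))) +
          (81 * (n + 1) + 50)))) ?P"
        proof (rule runs_Seq[OF runs_sizes_prog[OF k3 w3]])
          fix s4 assume c4: "\<forall>j<k. arr s4 9 j = profile ?w {..<n} j"
            and s4: "same (wregs sizes_prog) (warrs sizes_prog) s3 s4"
          have p4: "prepared k s4" using p3 s4 by (rule prepared_same) simp_all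
          then have a4: "adj_stored k s4" by (simp add: prepared_def)
          have w4: "\<forall>u<n. arr s4 8 u = ?w u" using w3 s4 by (simp add: same_def)
          show "runs (Seq neighbours_prog (Seq types_prog record_prog)) s4
           (171 * ((k + 1) * (n + 1)\<^sup>2) +
           ((200 * (k + 1) + boxsize (profile ?w {..<n}) k * (800 * ((k + 1) * (n + k + 1)))) +
            (81 * (n + 1) + 50))) ?P"
          proof (rule runs_Seq[OF runs_neighbours_prog[OF a4 w4]])
            fix s5 assume h5: "\<forall>j<k. \<forall>x<n. arr s5 10 (j * n + x) = profile ?w {u. u < n \<and> adj x u} j"
              and s5: "same (wregs neighbours_prog) (warrs neighbours_prog) s4 s5"
            have p5: "prepared k s5" using p4 s5 by (rule prepared_same) simp_all
            have t5: "reg s5 8 = target ?w" using t3 s4 s5 by (simp add: same_def)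
            have "\<forall>j<k. arr s5 9 j = profile ?w {..<n} j" using c4 s5 by (simp add: same_def)
            then have c5: "counted k ?w (target ?w) s5"
              using p5 t5 h5 by (simp add: counted_def prepared_def)
            have z5: "reg s5 7 = 0 \<longleftrightarrow> (\<forall>u<n. ?w u \<noteq> 0)"
              using z2 s3 s4 s5 by (simp add: same_def)
            have w5: "\<forall>u<n. arr s5 8 u = ?w u" using w4 s5 by (simp add: same_def)
            have r5: "reg s5 18 = reg s 18" "reg s5 19 = reg s 19" "reg s5 20 = reg s 20"
                "arr s5 0 = arr s 0"
              using s1 s2 s3 s4 s5 by (simp_all add: same_def)
            show "runs (Seq types_prog record_prog) s5
             ((200 * (k + 1) + boxsize (profile ?w {..<n}) k * (800 * ((k + 1) * (n + k + 1)))) +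
              (81 * (n + 1) + 50)) ?P"
            proof (rule runs_Seq[OF runs_types_prog[OF c5 z5]])
              fix s6 assume e6: "reg s6 9 = 0 \<longleftrightarrow> consistent k ?w (target ?w)"
                and s6: "same (wregs types_prog) (warrs types_prog) s5 s6"
              have k6: "reg s6 0 = k" "reg s6 1 = n" "reg s6 8 = target ?w"
                using c5 s6 by (simp_all add: counted_def adj_stored_def same_def)
              have w6: "\<forall>u<n. arr s6 8 u = ?w u" using w5 s6 by (simp add: same_def)
              have r6: "reg s6 18 = reg s 18" "reg s6 19 = reg s 19" "reg s6 20 = reg s 20"
                  "arr s6 0 = arr s 0"
                using r5 s6 by (simp_all add: same_def)
              show "runs record_prog s6 (81 * (n + 1) + 50) ?P"
                using runs_record_prog[OF k6 w6]
                by (rule runs_conseq) (simp_all add: e6 r6 passes_def)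
            qed
          qed
        qed
      qed
    qed
  qed
  then show ?thesis
  proof (rule runs_conseq)
    let ?b = "boxsize (profile ?w {..<n}) k * (800 * ((k + 1) * (n + k + 1)))"
    have 1: "?b \<le> Q * (800 * ((k + 1) * (n + k + 1)))"
      by (rule mult_right_mono[OF Q]) simp
    have "(n + 1) * (k + 1) \<le> (k + 1) * (n + 1)\<^sup>2" "n + 1 \<le> (k + 1) * (n + 1)\<^sup>2"
        "k + 1 \<le> (k + 1) * (n + 1)\<^sup>2" "1 \<le> (k + 1) * (n + 1)\<^sup>2"
      by (simp_all add: power2_eq_square algebra_simps)
    \<comment> \<open>All polynomial terms are at most \<open>(k + 1) * (n + 1)^2\<close>, and their
      coefficients add up to 1021.\<close>
    moreover have "187 * X + (a * 81 + (a * 90 + (161 * X + (171 * Y + ((200 * c + b) +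
       (81 * a + 50)))))) \<le> 1100 * Y + q"
      if "X \<le> Y" "a \<le> Y" "c \<le> Y" "1 \<le> Y" "b \<le> q" for X Y a b c q :: nat
      using that by linarith
    ultimately show "187 * ((n + 1) * (k + 1)) + ((n + 1) * 81 + ((n + 1) * 90 +
     (161 * ((k + 1) * (n + 1)) + (171 * ((k + 1) * (n + 1)\<^sup>2) +
     ((200 * (k + 1) + ?b) + (81 * (n + 1) + 50)))))) \<le> ?B"
      using 1 unfolding mult.commute[of "k + 1" "n + 1"] by blast
  qed simp
qed

text \<open>The recorded structure and the answer in register 20 may come from different
  candidates.\<close>

definition search_result :: "nat \<Rightarrow> (nat \<Rightarrow> nat) set \<Rightarrow> state \<Rightarrow> bool" where
  "search_result k S s \<longleftrightarrow> (reg s 18 \<noteq> 0 \<longleftrightarrow> (\<exists>f\<in>S. passes k f)) \<and>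
     (reg s 20 \<noteq> 0 \<longleftrightarrow> (\<exists>f\<in>S. passes k f \<and> target (weight f k) = k)) \<and>
     (reg s 18 \<noteq> 0 \<longrightarrow> (\<exists>f. passes k f \<and> reg s 19 = target (weight f k) \<and>
       (\<forall>u<n. arr s 0 u = weight f k u)))"

lemma weight_cong: "\<forall>j<k. f j = g j \<Longrightarrow> weight f k = weight g k"
proof (induction k)
  case 0
  show ?case by (rule ext) simp
next
  case (Suc k)
  then have "weight f k = weight g k" "f k = g k" by simp_all
  then show ?case by (intro ext) simp
qed

lemma runs_search_prog:
  fixes Q :: nat
  assumes s: "prepared k s" and Q: "\<And>w. boxsize (profile w {..<n}) k \<le> Q"
    and zero: "reg s 18 = 0" "reg s 20 = 0"
  shows "runs search_prog s ((k + 1) * 81 + (n + 1) ^ k * ((1100 * ((k + 1) * (n + 1)\<^sup>2) +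
     Q * (800 * ((k + 1) * (n + k + 1)))) + (k + 1) * 80)) (search_result k {f. \<forall>j<k. f j \<le> n})"
proof -
  let ?z = "Tab 7 3 (Reg 0) Skip (Const 0)"
  let ?B = "1100 * ((k + 1) * (n + 1)\<^sup>2) + Q * (800 * ((k + 1) * (n + k + 1)))"
  have "runs search_prog s ((k + 1) * (1 + 80) + boxsize (\<lambda>_. n) k * (?B + (k + 1) * 80))
     (search_result k {f. \<forall>j<k. f j \<le> n})"
    unfolding search_prog_def
  proof (rule runs_Seq)
    show "runs ?z s ((k + 1) * (1 + 80)) (\<lambda>s'. \<forall>j<k. arr s' 7 j = 0)"
      by (rule runs_Tab) (use s in \<open>auto simp: prepared_def adj_stored_def same_def intro!: runs_Skip\<close>)
    fix s1 assume 1: "\<forall>j<k. arr s1 7 j = 0" and s1: "same (wregs ?z) (warrs ?z) s s1"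
    have p1: "prepared k s1" using s s1 by (rule prepared_same) simp_all
    show "runs (Box 7 21 22 (Reg 1) candidate_prog) s1 (boxsize (\<lambda>_. n) k * (?B + (k + 1) * 80))
      (search_result k {f. \<forall>j<k. f j \<le> n})"
    proof (rule runs_Box)
      show "reg s1 0 = k" using p1 by (simp add: prepared_def adj_stored_def)
      show "\<forall>j<k. arr s1 7 j = 0" by fact
      show "search_result k {} s1" using zero s1 by (simp add: search_result_def same_def)
      show "search_result k S s4" if "search_result k S s3" "same {21, 22} {7} s3 s4" for S s3 s4
        using that by (simp add: search_result_def same_def)
      show "aval (Reg 1) s' = n"
        if "same (insert 21 (insert 22 (wregs candidate_prog))) (insert 7 (warrs candidate_prog)) s1 s'"
        for s'
        using that p1 by (simp add: prepared_def adj_stored_def same_def)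
      fix S s'
      assume s': "same (insert 21 (insert 22 (wregs candidate_prog)))
            (insert 7 (warrs candidate_prog)) s1 s'"
        and I: "search_result k S s'"
      have p': "prepared k s'" using p1 s' by (rule prepared_same) simp_all
      define f where "f = arr s' 7"
      define T where "T = {y. \<forall>j<k. y j = arr s' 7 j}"
      have w: "weight g k = weight f k" if "g \<in> T" for g
        using that by (intro weight_cong) (simp add: T_def f_def)
      have fT: "f \<in> T" by (simp add: T_def f_def)
      have bex: "(\<exists>g\<in>T. passes k g) \<longleftrightarrow> passes k f"
          "(\<exists>g\<in>T. passes k g \<and> target (weight g k) = k) \<longleftrightarrow> passes k f \<and> target (weight f k) = k"
        using w fT unfolding passes_def by (metis, metis)
      show "runs candidate_prog s' ?B (search_result k (S \<union> {y. \<forall>j<k. y j = arr s' 7 j}))"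
        unfolding T_def[symmetric]
        using runs_candidate_prog[OF p' f_def[symmetric] Q]
      proof (rule runs_conseq)
        fix s'' :: state
        assume r: "if passes k f then
            reg s'' 18 = 1 \<and> reg s'' 19 = target (weight f k) \<and>
            reg s'' 20 = (if target (weight f k) = k then 1 else reg s' 20) \<and>
            (\<forall>u<n. arr s'' 0 u = weight f k u)
          else reg s'' 18 = reg s' 18 \<and> reg s'' 19 = reg s' 19 \<and> reg s'' 20 = reg s' 20 \<and>
            arr s'' 0 = arr s' 0"
        show "search_result k (S \<union> T) s''"
        proof (cases "passes k f")
          case True
          then have "reg s'' 18 = 1" "reg s'' 19 = target (weight f k)"
              "reg s'' 20 = (if target (weight f k) = k then 1 else reg s' 20)"
              "\<forall>u<n. arr s'' 0 u = weight f k u"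
            using r by simp_all
          then show ?thesis
            using I True unfolding search_result_def bex_Un bex by auto
        next
          case False
          then have "reg s'' 18 = reg s' 18" "reg s'' 19 = reg s' 19" "reg s'' 20 = reg s' 20"
              "arr s'' 0 = arr s' 0"
            using r by simp_all
          then show ?thesis
            using I False unfolding search_result_def bex_Un bex by simp
        qed
      qed simp
    qed simp_all
  qed
  then show ?thesis by (simp add: boxsize_def)
qed

lemma runs_equidom_prog:
  fixes Q :: nat
  assumes reg: "reg s 0 = k" "reg s 1 = n" "reg s 2 = length es" "reg s 18 = 0" "reg s 20 = 0"
    and es: "\<forall>e<length es. arr s 0 e = fst (es ! e) \<and> arr s 1 e = snd (es ! e)"
    and adj: "\<And>u v. list_adj es u v = adj u v"
    and Q: "\<And>w. boxsize (profile w {..<n}) k \<le> Q"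
  shows "runs equidom_prog s (prep_time n k (length es) + (search_time n k Q + 6))
    (\<lambda>s'. (reg s' 0 \<noteq> 0 \<longleftrightarrow> (\<exists>w t. struct w t \<and> (\<forall>u<n. w u \<le> k))) \<and>
      (reg s' 2 \<noteq> 0 \<longleftrightarrow> (\<exists>w. struct w k)) \<and>
      (reg s' 0 \<noteq> 0 \<longrightarrow> struct (arr s' 0) (reg s' 1) \<and> (\<forall>u<n. arr s' 0 u \<le> k)))"
    (is "runs _ _ _ ?P")
  unfolding equidom_prog_def prep_time_def
proof (rule runs_Seq[OF runs_prep_prog[OF reg(1-3) es adj]])
  fix s1 assume p1: "prepared k s1" and s1: "same (wregs prep_prog) (warrs prep_prog) s s1"
  have z1: "reg s1 18 = 0" "reg s1 20 = 0" using s1 reg by (simp_all add: same_def prep_prog_def)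
  let ?out = "Seq (Assign 0 (Reg 18)) (Seq (Assign 1 (Reg 19)) (Assign 2 (Reg 20)))"
  show "runs (Seq search_prog ?out) s1 (search_time n k Q + 6) ?P"
    unfolding search_time_def
  proof (rule runs_Seq[OF runs_search_prog[OF p1 Q z1]])
    fix s2 assume s2: "search_result k {f. \<forall>j<k. f j \<le> n} s2"
    have passes: "struct (weight f k) (target (weight f k)) \<and> (\<forall>u<n. weight f k u \<le> k)"
      if "passes k f" for f
      using that consistent_weight_imp_struct weight_le unfolding passes_def by blast
    have found: "reg s2 18 \<noteq> 0 \<longleftrightarrow> (\<exists>w t. struct w t \<and> (\<forall>u<n. w u \<le> k))"
    proof -
      have "reg s2 18 \<noteq> 0 \<longleftrightarrow> (\<exists>f. (\<forall>j<k. f j \<le> n) \<and> passes k f)"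
        using s2 by (simp add: search_result_def)
      then show ?thesis using passes struct_imp_passes by metis
    qed
    \<comment> \<open>A structure with target \<open>k\<close> has weights at most \<open>k\<close>
      by \<open>struct_weight_le\<close>, so after sorting it is among the candidates.\<close>
    have found_target: "reg s2 20 \<noteq> 0 \<longleftrightarrow> (\<exists>w. struct w k)"
    proof -
      have "reg s2 20 \<noteq> 0 \<longleftrightarrow> (\<exists>f. (\<forall>j<k. f j \<le> n) \<and> passes k f \<and> target (weight f k) = k)"
        using s2 by (simp add: search_result_def)
      then show ?thesis using passes struct_imp_passes struct_weight_le by metis
    qed
    have witness: "struct (arr s2 0) (reg s2 19) \<and> (\<forall>u<n. arr s2 0 u \<le> k)" if "reg s2 18 \<noteq> 0"
    proof -
      have "\<exists>f. passes k f \<and> reg s2 19 = target (weight f k) \<and> (\<forall>u<n. arr s2 0 u = weight f k u)"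
        using s2 that by (simp add: search_result_def)
      then obtain f where f: "passes k f" "reg s2 19 = target (weight f k)"
          "\<forall>u<n. arr s2 0 u = weight f k u" by (elim exE conjE)
      have "struct (arr s2 0) (reg s2 19)"
        by (rule struct_cong[of "weight f k"]) (use f passes[OF f(1)] in simp_all)
      then show ?thesis using f passes[OF f(1)] by simp
    qed
    have "runs ?out s2 (2 + (2 + 2)) (\<lambda>s'. reg s' 0 = reg s2 18 \<and> reg s' 1 = reg s2 19 \<and>
        reg s' 2 = reg s2 20 \<and> arr s' = arr s2)"
    proof (rule runs_Seq)
      show "runs (Assign 0 (Reg 18)) s2 2 (\<lambda>s'. s' = s2\<lparr>reg := (reg s2)(0 := reg s2 18)\<rparr>)"
        by (rule runs_Assign) simp_all
      fix s3 assume s3: "s3 = s2\<lparr>reg := (reg s2)(0 := reg s2 18)\<rparr>"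
      show "runs (Seq (Assign 1 (Reg 19)) (Assign 2 (Reg 20))) s3 (2 + 2)
        (\<lambda>s'. reg s' 0 = reg s2 18 \<and> reg s' 1 = reg s2 19 \<and> reg s' 2 = reg s2 20 \<and> arr s' = arr s2)"
      proof (rule runs_Seq)
        show "runs (Assign 1 (Reg 19)) s3 2 (\<lambda>s'. s' = s3\<lparr>reg := (reg s3)(1 := reg s3 19)\<rparr>)"
          by (rule runs_Assign) simp_all
        fix s4 assume "s4 = s3\<lparr>reg := (reg s3)(1 := reg s3 19)\<rparr>"
        then show "runs (Assign 2 (Reg 20)) s4 2 (\<lambda>s'. reg s' 0 = reg s2 18 \<and>
            reg s' 1 = reg s2 19 \<and> reg s' 2 = reg s2 20 \<and> arr s' = arr s2)"
          using s3 by (intro runs_Assign) simp_all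
      qed
    qed
    then show "runs ?out s2 6 ?P"
      by (rule runs_conseq) (use found found_target witness in simp_all)
  qed
qed

end

section \<open>The running time\<close>

text \<open>The inequality of the means via \<open>1 + y \<le> exp y\<close>, applied to
  \<open>y = (b j + 1) / A - 1\<close>. Since \<open>A\<close> is at least the mean of the factors,
  the exponents sum to at most 0.\<close>

lemma prod_le_mean_power:
  fixes b :: "nat \<Rightarrow> nat"
  assumes k: "k \<ge> 1" and sum: "(\<Sum>j<k. b j) \<le> n"
  shows "real (boxsize b k) \<le> ((real n + real k) / real k) ^ k"
proof -
  define A where "A = (real n + real k) / real k"
  have A: "A > 0" using k by (simp add: A_def add_nonneg_pos)
  have kA: "real k * A = real n + real k" using k by (simp add: A_def)
  have "real (boxsize b k) / A ^ k = (\<Prod>j<k. (real (b j) + 1) / A)"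
    by (simp add: boxsize_def prod_dividef add.commute)
  also have "\<dots> \<le> (\<Prod>j<k. exp ((real (b j) + 1) / A - 1))"
    using A exp_ge_add_one_self[of "(real (b j) + 1) / A - 1" for j] by (intro prod_mono) auto
  also have "\<dots> = exp (\<Sum>j<k. (real (b j) + 1) / A - 1)"
    by (simp add: exp_sum)
  also have "(\<Sum>j<k. (real (b j) + 1) / A - 1) = (real (\<Sum>j<k. b j) + real k) / A - real k"
    by (simp add: sum_subtractf sum_divide_distrib[symmetric] sum.distrib)
  also have "\<dots> \<le> 0"
  proof -
    have "real (\<Sum>j<k. b j) + real k \<le> real k * A"
      unfolding kA using sum of_nat_mono by fastforce
    then show ?thesis using A by (simp add: divide_le_eq)
  qed
  finally have "real (boxsize b k) / A ^ k \<le> 1" by simp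
  then show ?thesis using A by (simp add: A_def[symmetric] divide_le_eq)
qed

text \<open>The power is at most \<open>exp (k * x)\<close>, and 3 bounds e. The instances are
  \<open>x = 1 / N\<close> and \<open>x = k / N\<close>; the second one requires
  \<open>k^2 \<le> N\<close>.\<close>

lemma one_plus_power_le:
  fixes x :: real
  assumes "x \<ge> 0" "real k * x \<le> 1"
  shows "(1 + x) ^ k \<le> 3"
proof -
  have "(1 + x) ^ k \<le> exp x ^ k"
    using assms exp_ge_add_one_self[of x] by (intro power_mono) auto
  also have "\<dots> = exp (real k * x)" by (simp add: exp_of_nat_mult)
  also have "\<dots> \<le> exp 1" using assms by simp
  also have "\<dots> \<le> 3" by (rule exp_le)
  finally show ?thesis .
qed

text \<open>Both of the last two summands of the time bound have the form \<open>N ^ (2 * k + 2) / k ^ (k + 1)\<close>,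
  with \<open>N = n\<close> and \<open>N = k\<^sup>2\<close>.\<close>

lemma time_bound_ge:
  assumes k: "k \<ge> 1" and N: "N = max (real n) (real k ^ 2)"
  shows "N ^ (2 * k + 2) / real k ^ (k + 1) \<le> time_bound k n m"
proof -
  have powi: "real k powi (- int k - 1) = 1 / real k ^ (k + 1)"
  proof -
    have "- int k - 1 = - int (k + 1)" by simp
    then show ?thesis by (simp only: power_int_minus power_int_of_nat inverse_eq_divide)
  qed
  have 2: "(real k ^ 2) ^ (2 * k + 2) / real k ^ (k + 1) = real k ^ (3 * k + 3)"
  proof -
    have "(real k ^ 2) ^ (2 * k + 2) = real k ^ (3 * k + 3) * real k ^ (k + 1)"
      unfolding power_mult[symmetric] power_add[symmetric] by (rule arg_cong[of _ _ "power (real k)"]) simp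
    then show ?thesis using k by simp
  qed
  have nonneg: "0 \<le> real n * real m ^ 2" "0 \<le> real n ^ k * real k ^ k"
      "0 \<le> real n ^ (2 * k + 2) / real k ^ (k + 1)" "0 \<le> real k ^ (3 * k + 3)"
    by simp_all
  have "time_bound k n m = real n * real m ^ 2 + real n ^ k * real k ^ k +
     real n ^ (2 * k + 2) / real k ^ (k + 1) + real k ^ (3 * k + 3)"
    by (simp add: time_bound_def powi)
  then show ?thesis using nonneg 2 unfolding N max_def by (auto split: if_splits)
qed

text \<open>The three left-hand sides are the orders of the preparation, of the work per candidate
  and of the work per count vector, with \<open>n\<close> replaced by \<open>N\<close>.\<close>

lemma time_estimates:
  fixes N :: real
  assumes k: "k \<ge> 1" and N: "real k ^ 2 \<le> N"
  defines "R \<equiv> N ^ (2 * k + 2) / real k ^ (k + 1)"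
  shows "N ^ 4 \<le> R"
    and "(N + 1) ^ k * ((real k + 1) * (N + 1)\<^sup>2) \<le> 24 * R"
    and "(N + 1) ^ k * (((N + real k) / real k) ^ k * ((real k + 1) * (N + real k + 1))) \<le> 54 * R"
proof -
  have k1: "real k \<ge> 1" using k by simp
  have kN: "real k \<le> N" using N k1 by (smt (verit) power2_eq_square mult_le_cancel_left1)
  have N1: "N \<ge> 1" using kN k1 by linarith
  \<comment> \<open>\<open>R\<close> is a power of \<open>x\<close>, and \<open>x \<ge> N\<close>.
    For \<open>k \<ge> 2\<close> the fourth power of \<open>N\<close> is bounded by
    \<open>x^3\<close>, as \<open>k^2 \<le> N\<close> gives \<open>x^2 \<ge> N^3\<close>.\<close>
  define x where "x = N\<^sup>2 / real k"
  have R: "R = x ^ (k + 1)"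
    unfolding R_def x_def power_divide power_mult[symmetric] by (simp add: algebra_simps)
  have xN: "x \<ge> N"
    unfolding x_def using kN k1 N1 by (simp add: le_divide_eq power2_eq_square mult_left_mono)
  then have x1: "x \<ge> 1" using N1 by linarith
  show "N ^ 4 \<le> R"
  proof (cases "k = 1")
    case True
    then show ?thesis by (simp add: R_def)
  next
    case False
    then have "k \<ge> 2" using k by simp
    have "x\<^sup>2 = N ^ 4 / real k ^ 2" by (simp add: x_def power_divide)
    also have "\<dots> \<ge> N ^ 4 / N"
      by (rule divide_left_mono) (use N N1 k1 in auto)
    finally have "N ^ 4 / N \<le> x\<^sup>2" .
    then have "N ^ 4 / N * N \<le> x\<^sup>2 * x" using xN N1 x1 by (intro mult_mono) auto
    then have "N ^ 4 \<le> x ^ 3" using N1 by (simp add: power3_eq_cube power2_eq_square)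
    also have "\<dots> \<le> x ^ (k + 1)" using x1 \<open>k \<ge> 2\<close> by (intro power_increasing) auto
    finally show ?thesis unfolding R .
  qed
  have e1: "(N + 1) ^ k \<le> 3 * N ^ k"
  proof -
    have "N + 1 = N * (1 + 1 / N)" using N1 by (simp add: field_simps)
    then have "(N + 1) ^ k = N ^ k * (1 + 1 / N) ^ k" by (metis power_mult_distrib)
    also have "\<dots> \<le> N ^ k * 3"
      by (intro mult_left_mono one_plus_power_le) (use N1 kN in \<open>auto simp: field_simps\<close>)
    finally show ?thesis by simp
  qed
  have e2: "((N + real k) / real k) ^ k \<le> 3 * (N / real k) ^ k"
  proof -
    have "(N + real k) / real k = (N / real k) * (1 + real k / N)"
      using N1 k1 by (simp add: field_simps)
    then have "((N + real k) / real k) ^ k = (N / real k) ^ k * (1 + real k / N) ^ k"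
      by (metis power_mult_distrib)
    also have "\<dots> \<le> (N / real k) ^ k * 3"
      by (intro mult_left_mono one_plus_power_le)
        (use N1 k1 N in \<open>auto simp: field_simps power2_eq_square\<close>)
    finally show ?thesis by simp
  qed
  have R': "R = N ^ k * N ^ k * N\<^sup>2 / (real k ^ k * real k)"
  proof -
    have e: "2 * k + 2 = k + k + 2" by simp
    show ?thesis unfolding R_def e power_add power_one_right ..
  qed
  show "(N + 1) ^ k * ((real k + 1) * (N + 1)\<^sup>2) \<le> 24 * R"
  proof -
    have "(real k + 1) * (N + 1)\<^sup>2 \<le> (2 * real k) * (2 * N)\<^sup>2"
      using k1 N1 by (intro mult_mono power_mono) auto
    then have "(N + 1) ^ k * ((real k + 1) * (N + 1)\<^sup>2) \<le> (3 * N ^ k) * ((2 * real k) * (2 * N)\<^sup>2)"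
      by (rule mult_mono[OF e1]) (use k1 N1 in auto)
    \<comment> \<open>24 is the product of 3 from \<open>e1\<close>, 2 from
      \<open>k + 1 \<le> 2 * k\<close> and 4 from \<open>(N + 1)^2 \<le> (2 * N)^2\<close>.\<close>
    also have "\<dots> = 24 * (N ^ k * N\<^sup>2 * real k)" by (simp add: power2_eq_square)
    also have "N ^ k * N\<^sup>2 * real k \<le> R"
    proof -
      \<comment> \<open>For \<open>k \<ge> 2\<close> one has \<open>k + 2 \<le> 2 * k\<close>, and
        \<open>k^2 \<le> N\<close>; for \<open>k = 1\<close> the claim is
        \<open>1 \<le> N\<close>.\<close>
      have "real k ^ (k + 2) \<le> N ^ k"
      proof (cases "k = 1")
        case True
        then show ?thesis using N1 by simp
      next
        case False
        then have "real k ^ (k + 2) \<le> real k ^ (2 * k)"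
          using k k1 by (intro power_increasing) auto
        also have "\<dots> \<le> N ^ k" unfolding power_mult using N by (intro power_mono) auto
        finally show ?thesis .
      qed
      then have "N ^ k * N\<^sup>2 * real k ^ (k + 2) \<le> N ^ k * N\<^sup>2 * N ^ k"
        using N1 by (intro mult_left_mono) auto
      then show ?thesis unfolding R' using k1
        by (simp add: le_divide_eq power_add power2_eq_square mult_ac)
    qed
    finally show ?thesis by simp
  qed
  show "(N + 1) ^ k * (((N + real k) / real k) ^ k * ((real k + 1) * (N + real k + 1))) \<le> 54 * R"
  proof -
    have "(real k + 1) * (N + real k + 1) \<le> (2 * real k) * (3 * N)"
      using k1 N1 kN by (intro mult_mono) auto
    then have "((N + real k) / real k) ^ k * ((real k + 1) * (N + real k + 1))
      \<le> (3 * (N / real k) ^ k) * ((2 * real k) * (3 * N))"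
      by (rule mult_mono[OF e2]) (use k1 N1 in auto)
    then have "(N + 1) ^ k * (((N + real k) / real k) ^ k * ((real k + 1) * (N + real k + 1)))
      \<le> (3 * N ^ k) * ((3 * (N / real k) ^ k) * ((2 * real k) * (3 * N)))"
      by (rule mult_mono[OF e1]) (use k1 N1 in auto)
    \<comment> \<open>54 is the product of 3 from \<open>e1\<close>, 3 from \<open>e2\<close>, 2
      from \<open>k + 1 \<le> 2 * k\<close> and 3 from \<open>N + k + 1 \<le> 3 * N\<close>.\<close>
    also have "\<dots> = 54 * (N ^ k * (N / real k) ^ k * (real k * N))" by simp
    also have "N ^ k * (N / real k) ^ k * (real k * N) \<le> R"
    proof -
      have "N ^ k * N ^ k * N * real k ^ 2 \<le> N ^ k * N ^ k * N * N"
        using N N1 by (intro mult_left_mono) auto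
      then show ?thesis unfolding R' power_divide using k1
        by (simp add: divide_simps power2_eq_square mult_ac)
    qed
    finally show ?thesis by simp
  qed
qed

text \<open>All costs are monotone in \<open>n\<close>, so \<open>n\<close> may be raised to
  \<open>N\<close>, where \<open>time_estimates\<close> applies. Reading the edges costs at most
  order n^4 because \<open>m \<le> n^2\<close>.\<close>

lemma total_time_le:
  fixes n :: nat
  assumes k: "k \<ge> 1" and m: "m \<le> n\<^sup>2" and Q: "real Q \<le> ((real n + real k) / real k) ^ k"
  shows "real (prep_time n k m + (search_time n k Q + 6))
    \<le> 200000 * time_bound k n m"
proof -
  define N where "N = max (real n) (real k ^ 2)"
  define R where "R = N ^ (2 * k + 2) / real k ^ (k + 1)"
  have kN: "real k ^ 2 \<le> N" and nN: "real n \<le> N" by (simp_all add: N_def)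
  note est = time_estimates[OF k kN, folded R_def]
  have k1: "real k \<ge> 1" using k by simp
  have k2: "real k \<le> real k ^ 2" using k1 by (simp add: power2_eq_square)
  have N1: "1 \<le> N" and kN': "real k \<le> N" using kN k1 k2 by linarith+
  have N4: "N \<le> N ^ 4" "N\<^sup>2 \<le> N ^ 4" "1 \<le> N ^ 4"
    using N1 power_increasing[of 1 4 N] power_increasing[of 2 4 N] power_increasing[of 0 4 N] by auto
  have n4: "(real n + 1) ^ 4 \<le> 16 * R"
  proof -
    have "(real n + 1) ^ 4 \<le> (2 * N) ^ 4" using nN N1 by (intro power_mono) auto
    also have "\<dots> = 16 * N ^ 4" by simp
    finally show ?thesis using est(1) by linarith
  qed
  have le4: "(real n + 1) ^ i \<le> (real n + 1) ^ 4" if "i \<le> 4" for i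
    using that by (intro power_increasing) auto
  \<comment> \<open>Each of the five terms contains a quantity at most \<open>16 * R\<close>, and
    the coefficients add up to 915.\<close>
  have prep: "real (prep_time n k m) \<le> 20000 * R"
  proof -
    have "(real k + real n + 2)\<^sup>2 \<le> (4 * N)\<^sup>2" using nN kN' N1 by (intro power_mono) auto
    also have "\<dots> = 16 * N\<^sup>2" by simp
    finally have 1: "(real k + real n + 2)\<^sup>2 \<le> 16 * R" using est(1) N4 by linarith
    have "real m \<le> (real n)\<^sup>2" using m by (metis of_nat_le_iff of_nat_power)
    also have "\<dots> \<le> (real n + 1)\<^sup>2 - 1" by (simp add: power2_eq_square algebra_simps)
    finally have "(real n + 1)\<^sup>2 * (real m + 1) \<le> (real n + 1)\<^sup>2 * (real n + 1)\<^sup>2"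
      by (intro mult_left_mono) auto
    also have "\<dots> = (real n + 1) ^ 4" by (simp flip: power_add)
    finally have 2: "(real n + 1)\<^sup>2 * (real m + 1) \<le> 16 * R" using n4 by linarith
    have "real (prep_time n k m) = 161 * (real k + real n + 2)\<^sup>2 +
       (171 * ((real n + 1)\<^sup>2 * (real m + 1)) + (171 * (real n + 1) ^ 3 +
       (251 * (real n + 1) ^ 4 + 161 * (real n + 1)\<^sup>2)))"
      unfolding prep_time_def by (simp only: of_nat_add of_nat_mult of_nat_power of_nat_numeral of_nat_1)
    then show ?thesis using 1 2 n4 le4[of 3] le4[of 2] by linarith
  qed
  \<comment> \<open>The sum of \<open>81 * 2\<close>, \<open>1100 * 24\<close>,
    \<open>800 * 54\<close> and \<open>80 * 24\<close> is 71682.\<close>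
  have search: "real (search_time n k Q) \<le> 100000 * R"
  proof -
    let ?P = "(real n + 1) ^ k"
    have P: "?P \<le> (N + 1) ^ k" using nN by (intro power_mono) auto
    have 1: "?P * ((real k + 1) * (real n + 1)\<^sup>2) \<le> 24 * R"
    proof -
      have "?P * ((real k + 1) * (real n + 1)\<^sup>2) \<le> (N + 1) ^ k * ((real k + 1) * (N + 1)\<^sup>2)"
        using nN N1 P by (intro mult_mono power_mono) auto
      then show ?thesis using est(2) by linarith
    qed
    have 2: "?P * (real Q * ((real k + 1) * (real n + real k + 1))) \<le> 54 * R"
    proof -
      have "real Q \<le> ((N + real k) / real k) ^ k"
        by (rule order_trans[OF Q]) (intro power_mono divide_right_mono, use nN in auto)
      then have "?P * (real Q * ((real k + 1) * (real n + real k + 1))) \<le>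
        (N + 1) ^ k * (((N + real k) / real k) ^ k * ((real k + 1) * (N + real k + 1)))"
        using nN N1 P by (intro mult_mono) auto
      then show ?thesis using est(3) by linarith
    qed
    have 3: "?P * (real k + 1) \<le> 24 * R"
    proof -
      have "?P * ((real k + 1) * 1) \<le> ?P * ((real k + 1) * (real n + 1)\<^sup>2)"
        by (intro mult_left_mono) auto
      also note 1
      finally show ?thesis by simp
    qed
    have 4: "real k + 1 \<le> 2 * R" using kN' N1 N4 est(1) by linarith
    have "real (search_time n k Q) = (real k + 1) * 81 +
      (1100 * (?P * ((real k + 1) * (real n + 1)\<^sup>2)) +
       800 * (?P * (real Q * ((real k + 1) * (real n + real k + 1)))) + 80 * (?P * (real k + 1)))"
    proof -
      have "a * 81 + P * ((1100 * b + q * (800 * c)) + a * 80) =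
          a * 81 + (1100 * (P * b) + 800 * (P * (q * c)) + 80 * (P * a))" for a b c P q :: real
        by (simp add: algebra_simps)
      then show ?thesis unfolding search_time_def
        by (simp only: of_nat_add of_nat_mult of_nat_power of_nat_numeral of_nat_1)
    qed
    moreover have "a * 81 + (1100 * X + 800 * Y + 80 * Z) \<le> 100000 * R"
      if "X \<le> 24 * R" "Y \<le> 54 * R" "Z \<le> 24 * R" "a \<le> 2 * R" "0 \<le> a" for a X Y Z :: real
      using that by linarith
    ultimately show ?thesis using 1 2 3 4 by simp
  qed
  have "1 \<le> R" using est(1) N4 by linarith
  then have "real (prep_time n k m + (search_time n k Q + 6))
    \<le> 200000 * R" using prep search by simp
  also have "\<dots> \<le> 200000 * time_bound k n m"
    using time_bound_ge[OF k N_def, of m] by (simp add: R_def)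
  finally show ?thesis .
qed

lemma reflexive_graph_list_adj: "reflexive_graph n (list_adj es)"
  by unfold_locales (auto simp: list_adj_def)

section \<open>Numbering the vertices\<close>

locale numbered_graph =
  fixes vs :: "'a list" and es :: "(nat \<times> nat) list" and V :: "'a set" and E :: "'a set set"
  assumes graph: "fin_simple_graph V E" and rep: "represents vs es V E"
begin

definition n :: nat where "n = length vs"

sublocale G: reflexive_graph n "list_adj es"
  by (rule reflexive_graph_list_adj)

lemma vs: "distinct vs" "set vs = V" "V = (!) vs ` {..<n}" "inj_on ((!) vs) {..<n}" "card V = n"
proof -
  show 1: "distinct vs" "set vs = V" using rep by (simp_all add: represents_def)
  then show "V = (!) vs ` {..<n}" by (auto simp: n_def set_conv_nth)
  show "inj_on ((!) vs) {..<n}" using 1(1) by (simp add: n_def inj_on_nth)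
  show "card V = n" using 1 distinct_card by (fastforce simp: n_def)
qed

text \<open>The numbering is injective, so an edge determines its pair of numbers up to order, and
  the list may contain either order.\<close>

lemma edge_iff:
  assumes "u < n" "v < n"
  shows "list_adj es u v \<longleftrightarrow> u = v \<or> {vs ! u, vs ! v} \<in> E"
proof -
  have E: "E = (\<lambda>(i, j). {vs ! i, vs ! j}) ` set es"
    and b: "\<forall>(i, j)\<in>set es. i < length vs \<and> j < length vs"
    using rep by (simp_all add: represents_def)
  have "{vs ! u, vs ! v} \<in> E \<longleftrightarrow> (u, v) \<in> set es \<or> (v, u) \<in> set es"
  proof
    assume "{vs ! u, vs ! v} \<in> E"
    then obtain i j where ij: "(i, j) \<in> set es" "{vs ! u, vs ! v} = {vs ! i, vs ! j}"
      unfolding E by auto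
    then have "i < n" "j < n" using b by (auto simp: n_def)
    then have "(i = u \<and> j = v) \<or> (i = v \<and> j = u)"
      using ij(2) assms vs(1) unfolding doubleton_eq_iff n_def by (metis nth_eq_iff_index_eq)
    then show "(u, v) \<in> set es \<or> (v, u) \<in> set es" using ij(1) by blast
  next
    assume "(u, v) \<in> set es \<or> (v, u) \<in> set es"
    then show "{vs ! u, vs ! v} \<in> E" unfolding E by (auto simp: insert_commute intro: rev_image_eqI)
  qed
  then show ?thesis by (simp only: list_adj_def)
qed

lemma dominating_image:
  assumes D: "D \<subseteq> {..<n}"
  shows "dominating V E ((!) vs ` D) \<longleftrightarrow> G.dom D"
proof -
  have mem: "vs ! x \<in> (!) vs ` D \<longleftrightarrow> x \<in> D" if "x < n" for x
    using vs(4) D that by (simp add: inj_on_image_mem_iff)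
  have sub: "(!) vs ` D \<subseteq> V" using vs(3) D by blast
  have hit: "(vs ! x \<in> (!) vs ` D \<or> (\<exists>y\<in>(!) vs ` D. {y, vs ! x} \<in> E)) \<longleftrightarrow> (\<exists>u\<in>D. list_adj es x u)"
    if x: "x < n" for x
  proof -
    have "(\<exists>y\<in>(!) vs ` D. {y, vs ! x} \<in> E) \<longleftrightarrow> (\<exists>u\<in>D. {vs ! x, vs ! u} \<in> E)"
      by (simp add: insert_commute)
    moreover have "(\<exists>u\<in>D. list_adj es x u) \<longleftrightarrow> (\<exists>u\<in>D. x = u \<or> {vs ! x, vs ! u} \<in> E)"
      using edge_iff[OF x] D by (meson lessThan_iff subsetD)
    ultimately show ?thesis using mem[OF x] by auto
  qed
  have ball: "(\<forall>v\<in>V. P v) \<longleftrightarrow> (\<forall>x<n. P (vs ! x))" for P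
    by (subst vs(3)) blast
  have "(\<forall>v\<in>V. v \<in> (!) vs ` D \<or> (\<exists>y\<in>(!) vs ` D. {y, v} \<in> E)) \<longleftrightarrow>
      (\<forall>x<n. \<exists>u\<in>D. list_adj es x u)"
    unfolding ball by (rule all_cong) (rule hit)
  then show ?thesis unfolding dominating_def G.dom_def using D sub by argo
qed

lemma mds_image:
  assumes D: "D \<subseteq> {..<n}"
  shows "mds V E ((!) vs ` D) \<longleftrightarrow> G.min_dom D"
proof -
  have "(\<exists>D'. D' \<subset> (!) vs ` D \<and> dominating V E D') \<longleftrightarrow> (\<exists>C. C \<subset> D \<and> G.dom C)"
  proof
    assume "\<exists>D'. D' \<subset> (!) vs ` D \<and> dominating V E D'"
    then obtain D' where D': "D' \<subset> (!) vs ` D" "dominating V E D'" by blast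
    then obtain C where C: "C \<subseteq> D" "D' = (!) vs ` C" by (meson psubset_imp_subset subset_imageE)
    then have "G.dom C" using dominating_image[of C] D D'(2) by auto
    then show "\<exists>C. C \<subset> D \<and> G.dom C" using C D'(1) by blast
  next
    assume "\<exists>C. C \<subset> D \<and> G.dom C"
    then obtain C where C: "C \<subset> D" "G.dom C" by blast
    have "(!) vs ` C \<noteq> (!) vs ` D"
      using C(1) D inj_on_image_eq_iff[OF vs(4), of C D] by blast
    then have "(!) vs ` C \<subset> (!) vs ` D" using C(1) by blast
    moreover have "dominating V E ((!) vs ` C)" using dominating_image[of C] C D by blast
    ultimately show "\<exists>D'. D' \<subset> (!) vs ` D \<and> dominating V E D'" by blast
  qed
  then show ?thesis unfolding mds_def G.min_dom_def using dominating_image[OF D] by blast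
qed

lemma equidominating_structure_iff:
  assumes w: "\<And>u. u < n \<Longrightarrow> w (vs ! u) = w' u"
  shows "equidominating_structure V E w t \<longleftrightarrow> G.struct w' t"
proof -
  have sum: "sum w ((!) vs ` D) = sum w' D" if "D \<subseteq> {..<n}" for D
  proof -
    have "sum w ((!) vs ` D) = (\<Sum>u\<in>D. w (vs ! u))"
      using inj_on_subset[OF vs(4) that] by (simp add: sum.reindex)
    also have "\<dots> = sum w' D" using w that by (intro sum.cong) auto
    finally show ?thesis .
  qed
  have "(\<forall>D. D \<subseteq> V \<longrightarrow> (mds V E D \<longleftrightarrow> sum w D = t)) \<longleftrightarrow>
     (\<forall>D\<subseteq>{..<n}. mds V E ((!) vs ` D) \<longleftrightarrow> sum w ((!) vs ` D) = t)"
    unfolding vs(3) by (rule all_subset_image)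
  also have "\<dots> \<longleftrightarrow> (\<forall>D\<subseteq>{..<n}. G.min_dom D \<longleftrightarrow> sum w' D = t)"
    using sum mds_image by (metis (no_types, lifting))
  finally have 1: "(\<forall>D. D \<subseteq> V \<longrightarrow> (mds V E D \<longleftrightarrow> sum w D = t)) \<longleftrightarrow>
     (\<forall>D\<subseteq>{..<n}. G.min_dom D \<longleftrightarrow> sum w' D = t)" .
  have 2: "(\<forall>v\<in>V. w v \<ge> 1) \<longleftrightarrow> (\<forall>u<n. w' u \<ge> 1)"
    unfolding vs(3) using w by auto
  show ?thesis unfolding equidominating_structure_def G.struct_def 1 2 ..
qed

lemma number_weights:
  obtains w :: "'a \<Rightarrow> nat" where "\<And>u. u < n \<Longrightarrow> w (vs ! u) = w' u"
proof
  show "(w' \<circ> the_inv_into {..<n} ((!) vs)) (vs ! u) = w' u" if "u < n" for u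
    using that vs(4) by (simp add: the_inv_into_f_f)
qed

lemma k_equidominating_structure_iff:
  assumes w: "\<And>u. u < n \<Longrightarrow> w (vs ! u) = w' u"
  shows "k_equidominating_structure k V E w t \<longleftrightarrow> G.struct w' t \<and> (\<forall>u<n. w' u \<le> k)"
proof -
  have "(\<forall>v\<in>V. w v \<in> {1..k}) \<longleftrightarrow> (\<forall>u<n. w' u \<ge> 1 \<and> w' u \<le> k)"
    unfolding vs(3) using w by auto
  moreover have "\<forall>u<n. w' u \<ge> 1" if "G.struct w' t" using that by (simp add: G.struct_def)
  moreover have "equidominating_structure V E w t \<longleftrightarrow> G.struct w' t"
    using w by (rule equidominating_structure_iff)
  ultimately show ?thesis unfolding k_equidominating_structure_def by blast
qed

lemma k_equidominating_iff:
  "k_equidominating k V E \<longleftrightarrow> (\<exists>w t. G.struct w t \<and> (\<forall>u<n. w u \<le> k))"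
  unfolding k_equidominating_def
proof
  assume "\<exists>w t. k_equidominating_structure k V E w t"
  then obtain w t where "k_equidominating_structure k V E w t" by blast
  then have "G.struct (\<lambda>u. w (vs ! u)) t \<and> (\<forall>u<n. w (vs ! u) \<le> k)"
    using k_equidominating_structure_iff[of w "\<lambda>u. w (vs ! u)"] by blast
  then show "\<exists>w t. G.struct w t \<and> (\<forall>u<n. w u \<le> k)" by blast
next
  assume "\<exists>w t. G.struct w t \<and> (\<forall>u<n. w u \<le> k)"
  then obtain w' t where w': "G.struct w' t" "\<forall>u<n. w' u \<le> k" by blast
  obtain w where "\<And>u. u < n \<Longrightarrow> w (vs ! u) = w' u" using number_weights by metis
  then show "\<exists>w t. k_equidominating_structure k V E w t"
    using k_equidominating_structure_iff[of w w'] w' by blast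
qed

lemma target_equidominating_iff: "target_equidominating t V E \<longleftrightarrow> (\<exists>w. G.struct w t)"
  unfolding target_equidominating_def
proof
  assume "\<exists>w. equidominating_structure V E w t"
  then obtain w where "equidominating_structure V E w t" by blast
  then have "G.struct (\<lambda>u. w (vs ! u)) t"
    using equidominating_structure_iff[of w "\<lambda>u. w (vs ! u)"] by blast
  then show "\<exists>w. G.struct w t" by blast
next
  assume "\<exists>w. G.struct w t"
  then obtain w' where w': "G.struct w' t" by blast
  obtain w where "\<And>u. u < n \<Longrightarrow> w (vs ! u) = w' u" using number_weights by metis
  then show "\<exists>w. equidominating_structure V E w t"
    using equidominating_structure_iff[of w w'] w' by blast
qed

lemma card_edges: "length es = card E" "card E \<le> n\<^sup>2"
proof -
  show "length es = card E" using rep by (simp add: represents_def)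
  have fin: "finite V" and E: "E \<subseteq> {e. e \<subseteq> V \<and> card e = 2}"
    using graph by (simp_all add: fin_simple_graph_def)
  have "card E \<le> card {e. e \<subseteq> V \<and> card e = 2}"
    by (rule card_mono[OF _ E]) (use fin in simp)
  also have "\<dots> = n choose 2" using n_subsets[OF fin] vs(5) by simp
  also have "\<dots> \<le> n * (n - 1)" unfolding choose_two by (rule div_le_dividend)
  also have "\<dots> \<le> n\<^sup>2" by (simp add: power2_eq_square)
  finally show "card E \<le> n\<^sup>2" .
qed

text \<open>The weight classes are disjoint. They need not exhaust the vertices, since
  \<open>w\<close> is arbitrary and may take values outside 1 to \<open>k\<close>.\<close>

lemma sum_profile_le: "(\<Sum>j<k. G.profile w {..<n} j) \<le> n"
proof -
  have "(\<Sum>j<k. G.profile w {..<n} j) = card (\<Union>j<k. {u\<in>{..<n}. w u = Suc j})"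
    unfolding G.profile_def by (subst card_UN_disjoint) auto
  also have "\<dots> \<le> card {..<n}" by (rule card_mono) auto
  finally show ?thesis by simp
qed

lemma equidom_prog_correct:
  assumes k: "k \<ge> 1"
  shows "\<exists>s. halts_within equidom_prog (input_state k vs es) (200000 * time_bound k (card V) (card E)) s \<and>
    (accepts s \<longleftrightarrow> k_equidominating k V E) \<and>
    (k_equidominating k V E \<longrightarrow>
       (\<exists>w t. outputs_structure vs s w t \<and> k_equidominating_structure k V E w t)) \<and>
    (accepts_target s \<longleftrightarrow> target_equidominating k V E)"
proof -
  define M where "M = ((real n + real k) / real k) ^ k"
  \<comment> \<open>The bound on the number of count vectors is real; rounding it down is harmless,
    as that number is an integer.\<close>
  define Q where "Q = nat \<lfloor>M\<rfloor>"
  have "M \<ge> 0" by (simp add: M_def)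
  then have QM: "real Q \<le> M" unfolding Q_def by simp
  have Q: "boxsize (G.profile w {..<n}) k \<le> Q" for w
    unfolding Q_def using prod_le_mean_power[OF k sum_profile_le[where k = k and w = w]]
    by (simp add: M_def le_nat_floor)
  let ?s = "input_state k vs es"
  have "runs equidom_prog ?s (prep_time n k (length es) + (search_time n k Q + 6))
    (\<lambda>s'. (reg s' 0 \<noteq> 0 \<longleftrightarrow> (\<exists>w t. G.struct w t \<and> (\<forall>u<n. w u \<le> k))) \<and>
      (reg s' 2 \<noteq> 0 \<longleftrightarrow> (\<exists>w. G.struct w k)) \<and>
      (reg s' 0 \<noteq> 0 \<longrightarrow> G.struct (arr s' 0) (reg s' 1) \<and> (\<forall>u<n. arr s' 0 u \<le> k)))"
    by (rule G.runs_equidom_prog) (use Q in \<open>simp_all add: input_state_def n_def\<close>)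
  then obtain T s where s: "exec equidom_prog ?s T s"
      "T \<le> prep_time n k (length es) + (search_time n k Q + 6)"
      "reg s 0 \<noteq> 0 \<longleftrightarrow> k_equidominating k V E" "reg s 2 \<noteq> 0 \<longleftrightarrow> target_equidominating k V E"
      "reg s 0 \<noteq> 0 \<Longrightarrow> G.struct (arr s 0) (reg s 1) \<and> (\<forall>u<n. arr s 0 u \<le> k)"
    unfolding runs_def k_equidominating_iff target_equidominating_iff by blast
  have "real T \<le> 200000 * time_bound k (card V) (card E)"
  proof -
    have "real T \<le> real (prep_time n k (length es) + (search_time n k Q + 6))"
      using s(2) by (rule of_nat_mono)
    also have "\<dots> \<le> 200000 * time_bound k n (length es)"
      by (rule total_time_le[OF k]) (use card_edges QM in \<open>simp_all add: M_def\<close>)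
    finally show ?thesis using vs(5) card_edges(1) by simp
  qed
  moreover have "\<exists>w t. outputs_structure vs s w t \<and> k_equidominating_structure k V E w t"
    if "k_equidominating k V E"
  proof -
    have st: "G.struct (arr s 0) (reg s 1) \<and> (\<forall>u<n. arr s 0 u \<le> k)" using s(3,5) that by blast
    obtain w where w: "\<And>u. u < n \<Longrightarrow> w (vs ! u) = arr s 0 u" using number_weights by metis
    then have "outputs_structure vs s w (reg s 1)" by (simp add: outputs_structure_def n_def)
    moreover have "k_equidominating_structure k V E w (reg s 1)"
      using k_equidominating_structure_iff[of w "arr s 0"] w st by blast
    ultimately show ?thesis by blast
  qed
  ultimately show ?thesis
    using s(1,3,4) unfolding halts_within_def accepts_def accepts_target_def by blast
qed

end

theorem theorem4p1:
  shows "\<exists>(P :: com) (C :: real).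
    (\<forall>k (V :: 'a set) E vs es.
       k \<ge> 1 \<longrightarrow> fin_simple_graph V E \<longrightarrow> represents vs es V E \<longrightarrow>
       (\<exists>s. halts_within P (input_state k vs es) (C * time_bound k (card V) (card E)) s \<and>
            (accepts s \<longleftrightarrow> k_equidominating k V E) \<and>
            (k_equidominating k V E \<longrightarrow>
               (\<exists>w t. outputs_structure vs s w t \<and> k_equidominating_structure k V E w t)))) \<and>
    (\<forall>t (V :: 'a set) E vs es.
       t \<ge> 1 \<longrightarrow> fin_simple_graph V E \<longrightarrow> represents vs es V E \<longrightarrow>
       (\<exists>s. halts_within P (input_state t vs es) (C * time_bound t (card V) (card E)) s \<and>
            (accepts_target s \<longleftrightarrow> target_equidominating t V E)))"
\<comment> \<open>A single run answers both questions, so the two halves are projections of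
  \<open>equidom_prog_correct\<close>; the constant is that of \<open>total_time_le\<close>.\<close>
proof (rule exI[of _ equidom_prog], rule exI[of _ 200000], rule conjI; intro allI impI)
  fix k :: nat and V :: "'a set" and E vs es
  assume k: "k \<ge> 1" and "fin_simple_graph V E" "represents vs es V E"
  then interpret numbered_graph vs es V E by unfold_locales
  show "\<exists>s. halts_within equidom_prog (input_state k vs es) (200000 * time_bound k (card V) (card E)) s \<and>
            (accepts s \<longleftrightarrow> k_equidominating k V E) \<and>
            (k_equidominating k V E \<longrightarrow>
               (\<exists>w t. outputs_structure vs s w t \<and> k_equidominating_structure k V E w t))"
    using equidom_prog_correct[OF k] by blast
next
  fix t :: nat and V :: "'a set" and E vs es
  assume t: "t \<ge> 1" and "fin_simple_graph V E" "represents vs es V E"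
  then interpret numbered_graph vs es V E by unfold_locales
  show "\<exists>s. halts_within equidom_prog (input_state t vs es) (200000 * time_bound t (card V) (card E)) s \<and>
            (accepts_target s \<longleftrightarrow> target_equidominating t V E)"
    using equidom_prog_correct[OF t] by blast
qed

end
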